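(* Let $\mu$ be a macro state and $B$ any operator on $\mathcal{H}$, and let $w_{\mu B}(t):=\frac1{d_\mu}\operatorname{tr}\bigl[P_\mu e^{iHt}Be^{-iHt}\bigr]$. Then: (i) for every $t\in\mathbb{R}$ and every $\varepsilon>0$, for $(1-\varepsilon)$-most $\psi_0\in\mathbb{S}(\mathcal{H}_\mu)$, $$\bigl|\langle\psi_t|B|\psi_t\rangle-w_{\mu B}(t)\bigr|\le\min\Bigl\{\frac{\|B\|}{\sqrt{\varepsilon d_\mu}},\ \sqrt{\frac{\|B\|\operatorname{tr}|B|}{\varepsilon d_\mu^2}},\ \sqrt{\frac{18\pi^3\log(4/\varepsilon)}{d_\mu}}\,\|B\|\Bigr\};$$ (ii) for every $T>0$ and $\varepsilon>0$, for $(1-\varepsilon)$-most $\psi_0\in\mathbb{S}(\mathcal{H}_\mu)$, $$\frac1T\int_0^T\bigl|\langle\psi_t|B|\psi_t\rangle-w_{\mu B}(t)\bigr|^2dt\le\frac{\|B\|^2}{\varepsilon d_\mu}.$$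
   Context: $\mathcal{H}$ is a finite-dimensional complex Hilbert space with an orthogonal decomposition $\mathcal{H}=\bigoplus_\nu\mathcal{H}_\nu$ into nonzero subspaces (macro spaces); $P_\mu$ is the orthogonal projection onto $\mathcal{H}_\mu$, $d_\mu=\dim\mathcal{H}_\mu$. $H$ is self-adjoint on $\mathcal{H}$, $\psi_t=e^{-iHt}\psi_0$. $\|B\|$ is the operator norm, $|B|=(B^\dagger B)^{1/2}$. $u_\mu$ is the normalized uniform measure on the unit sphere $\mathbb{S}(\mathcal{H}_\mu)$; "$s(\psi)$ holds for $(1-\varepsilon)$-most $\psi$" means $u_\mu(\{\psi:s(\psi)\})\ge1-\varepsilon$. *)

theory Defs
  imports "HOL-Analysis.Analysis"
begin

text \<open>The Hilbert space is \<open>complex^'n\<close> for a finite index type \<open>'n\<close>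
  (every finite-dimensional complex Hilbert space is isometric to such a space);
  operators are square complex matrices \<open>complex^'n^'n\<close> acting by \<open>*v\<close>.\<close>

type_synonym 'n cmat = "complex^'n^'n"

definition cinner :: "complex^('n::finite) \<Rightarrow> complex^('n::finite) \<Rightarrow> complex" where
  "cinner x y = (\<Sum>i\<in>UNIV. cnj (x$i) * y$i)"

definition adj :: "('n::finite) cmat \<Rightarrow> ('n::finite) cmat" where
  "adj A = (\<chi> i j. cnj (A$j$i))"

definition mscale :: "complex \<Rightarrow> ('n::finite) cmat \<Rightarrow> ('n::finite) cmat" where
  "mscale c A = (\<chi> i j. c * A$i$j)"

definition mpow :: "('n::finite) cmat \<Rightarrow> nat \<Rightarrow> ('n::finite) cmat" where
  "mpow A k = (((**) A) ^^ k) (mat 1)"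

text \<open>Matrix exponential, via its power series (entrywise).\<close>
definition mexp :: "('n::finite) cmat \<Rightarrow> ('n::finite) cmat" where
  "mexp A = (\<chi> i j. \<Sum>k. (mpow A k)$i$j / of_nat (fact k))"

definition self_adjoint :: "('n::finite) cmat \<Rightarrow> bool" where
  "self_adjoint A \<longleftrightarrow> adj A = A"

definition orth_proj :: "('n::finite) cmat \<Rightarrow> bool" where
  "orth_proj P \<longleftrightarrow> self_adjoint P \<and> P ** P = P"

text \<open>Positive (semidefinite) operator.\<close>
definition positive_op :: "('n::finite) cmat \<Rightarrow> bool" where
  "positive_op A \<longleftrightarrow> self_adjoint A \<and> (\<forall>x. 0 \<le> Re (cinner x (A *v x)))"

text \<open>Absolute value \<open>|B| = (B\<^sup>\<dagger>B)^(1/2)\<close>: the unique positive square root.\<close>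
definition mabs :: "('n::finite) cmat \<Rightarrow> ('n::finite) cmat" where
  "mabs B = (THE A. positive_op A \<and> A ** A = adj B ** B)"

text \<open>Operator norm.\<close>
definition opnorm :: "('n::finite) cmat \<Rightarrow> real" where
  "opnorm B = onorm (\<lambda>x. B *v x)"

text \<open>The (macro) subspace with orthogonal projection P, and its complex dimension.\<close>
definition range_space :: "('n::finite) cmat \<Rightarrow> (complex^'n) set" where
  "range_space P = {x. P *v x = x}"

definition cdim :: "('n::finite) cmat \<Rightarrow> nat" where
  "cdim P = vec.dim (range_space P)"

definition onb :: "('n::finite) cmat \<Rightarrow> (nat \<Rightarrow> complex^'n) \<Rightarrow> bool" where
  "onb P b \<longleftrightarrow> (\<forall>k<cdim P. b k \<in> range_space P) \<and>
     (\<forall>j<cdim P. \<forall>k<cdim P. cinner (b j) (b k) = (if j = k then 1 else 0))"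

text \<open>Normalized uniform (surface) measure on the unit sphere of the subspace
  \<open>range_space P\<close>, defined as the cone measure: normalized Lebesgue measure on the
  unit ball of coordinates \<open>\<complex>^d\<close> (w.r.t. an orthonormal basis), pushed to the sphere
  by radial projection.\<close>
definition coord_ball :: "nat \<Rightarrow> (nat \<Rightarrow> complex) set" where
  "coord_ball d = {c \<in> PiE {..<d} (\<lambda>_. UNIV). (\<Sum>k<d. (cmod (c k))\<^sup>2) \<le> 1}"

definition sphere_measure :: "('n::finite) cmat \<Rightarrow> (complex^'n) measure" where
  "sphere_measure P =
     (let d = cdim P; b = (SOME b. onb P b) in
      distr (uniform_measure (PiM {..<d} (\<lambda>_. (lborel :: complex measure))) (coord_ball d))
            borel
            (\<lambda>c. let v = (\<Sum>k<d. c k *s b k) in (1 / norm v) *\<^sub>R v))"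

text \<open>Time evolution \<open>e^{-iHt}\<close>, and \<open>w_{\<mu>B}(t) = tr[P e^{iHt} B e^{-iHt}]/d\<close>.\<close>
definition evol :: "('n::finite) cmat \<Rightarrow> real \<Rightarrow> ('n::finite) cmat" where
  "evol H t = mexp (mscale (- \<i> * of_real t) H)"

definition wfun :: "('n::finite) cmat \<Rightarrow> ('n::finite) cmat \<Rightarrow> ('n::finite) cmat \<Rightarrow> real \<Rightarrow> complex" where
  "wfun H P B t = trace (P ** mexp (mscale (\<i> * of_real t) H) ** B ** mexp (mscale (- \<i> * of_real t) H))
                  / of_nat (cdim P)"

text \<open>Expectation \<open>\<langle>\<psi>|B|\<psi>\<rangle>\<close>.\<close>
definition expect :: "complex^('n::finite) \<Rightarrow> ('n::finite) cmat \<Rightarrow> complex" where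
  "expect \<psi> B = cinner \<psi> (B *v \<psi>)"

end

theory Submission
  imports Defs "HOL-Probability.Probability"
begin

text \<open>
  Let \<open>q(\<psi>) = \<langle>\<psi>|X|\<psi>\<rangle>\<close> for a Hermitian \<open>X\<close> on the macro space, with eigenvalues \<open>x\<^sub>1, \<dots>, x\<^sub>d\<close>.
  Comparing the uniform distribution on the sphere with a complex Gaussian vector through polar
  coordinates, and evaluating the Gaussian integral of \<open>exp q\<close>, gives the exact identity
  \<open>E (1 - q(\<psi>))\<^sup>-\<^sup>d = \<Prod>\<^sub>j 1 / (1 - x\<^sub>j)\<close> whenever all \<open>x\<^sub>j < 1\<close>. Everything follows from it.
  Replacing \<open>X\<close> by \<open>\<plusminus>\<theta>X\<close> with \<open>tr X = 0\<close> and letting \<open>\<theta> \<rightarrow> 0\<close> bounds the variance of \<open>q\<close> by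
  \<open>tr X\<^sup>2 / (d (d + 1))\<close>, which with the Chebyshev inequality (and Fubini for the time average) yields the
  first two bounds of (i) and (ii). A Chernoff argument with a suitable small \<open>\<theta>\<close> yields a Gaussian tail
  whose constant is much better than the one obtained from Levy's lemma, hence the third bound.
  A general \<open>B\<close> is split into its Hermitian and anti-Hermitian parts.
\<close>

section \<open>The complex inner product and the spectral theorem\<close>

text \<open>Why the power -d: along the ray through a unit vector, a Gaussian multiplied by exp q
  has radial part r^(2d-1) exp(-r^2 (1-q)), and its integral is a multiple of (1-q)^(-d). Averaging
  this power instead of exp q is what makes the identity exact, and the coefficient d(d+1)/2 of q^2
  in its expansion is what puts d(d+1) into the variance bound. The shape of the proof comes from
  \<open>sphere_measure\<close>: it is an image of Lebesgue measure in coordinates with respect to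
  some unspecified basis, while q is diagonal in an eigenbasis that depends on the operator and on
  t. The two bases are reconciled inside a Gaussian integral, and the sphere is reached only through
  the scaling of balls. The 4 in log(4/\<epsilon>) counts two signs times two Hermitian parts. The
  tail obtained has rate 11/512 in the exponent, and 18 pi^3 times 11/512 is well above 1, so the
  stated constant leaves room to spare.\<close>

lemma cinner_add_right: "cinner x (y + z) = cinner x y + cinner x z"
  by (simp add: cinner_def algebra_simps sum.distrib)

lemma cinner_add_left: "cinner (x + y) z = cinner x z + cinner y z"
  by (simp add: cinner_def algebra_simps sum.distrib)

lemma cinner_diff_right: "cinner x (y - z) = cinner x y - cinner x z"
  by (simp add: cinner_def algebra_simps sum_subtractf)

lemma cinner_diff_left: "cinner (x - y) z = cinner x z - cinner y z"
  by (simp add: cinner_def algebra_simps sum_subtractf)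

lemma cinner_scale_right: "cinner x (c *s y) = c * cinner x y"
  by (simp add: cinner_def sum_distrib_left algebra_simps)

lemma cinner_scale_left: "cinner (c *s x) y = cnj c * cinner x y"
  by (simp add: cinner_def sum_distrib_left algebra_simps)

lemma scaleR_eq_scale: "r *\<^sub>R (x :: complex^'n) = complex_of_real r *s x"
  by (simp add: vec_eq_iff scaleR_conv_of_real[where 'a=complex])

lemma cinner_zero [simp]: "cinner x 0 = 0" "cinner 0 x = 0"
  by (simp_all add: cinner_def)

lemma cinner_sum_right: "cinner x (\<Sum>i\<in>I. f i) = (\<Sum>i\<in>I. cinner x (f i))"
  by (induction I rule: infinite_finite_induct) (auto simp: cinner_add_right)

lemma cinner_sum_left: "cinner (\<Sum>i\<in>I. f i) x = (\<Sum>i\<in>I. cinner (f i) x)"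
  by (induction I rule: infinite_finite_induct) (auto simp: cinner_add_left)

lemma cnj_cinner: "cnj (cinner x y) = cinner y x"
  by (simp add: cinner_def mult.commute)

lemma cmod_cinner_commute: "cmod (cinner x y) = cmod (cinner y x)"
  by (metis cnj_cinner complex_mod_cnj)

text \<open>The bridge to the real Euclidean structure of the space: Cauchy-Schwarz, compactness of
  spheres and norms are all taken from there.\<close>

lemma Re_cinner: "Re (cinner x y) = inner x y"
  by (simp add: cinner_def inner_vec_def inner_complex_def)

lemma cinner_self: "cinner x x = of_real ((norm x)\<^sup>2)"
proof -
  have "cinner x x = of_real (\<Sum>i\<in>UNIV. (cmod (x $ i))\<^sup>2)"
    by (simp add: cinner_def mult.commute[of "cnj _"] complex_norm_square[symmetric] del: of_real_power)
  also have "(\<Sum>i\<in>UNIV. (cmod (x $ i))\<^sup>2) = (norm x)\<^sup>2"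
    by (simp add: norm_vec_def L2_set_def sum_nonneg)
  finally show ?thesis .
qed

lemma cinner_adj_left: "cinner (adj A *v x) y = cinner x (A *v y)"
  unfolding cinner_def adj_def matrix_vector_mult_def
  by (simp add: sum_distrib_left sum_distrib_right mult_ac)
     (rule sum.swap[THEN trans], simp add: mult_ac)

text \<open>Multiplying \<open>x\<close> by w = \<open>cinner x y\<close> turns the inner product
  into the nonnegative real number |w|^2, so the real Cauchy-Schwarz inequality applies; one factor
  |w| is then cancelled.\<close>

lemma cmod_cinner_le: "cmod (cinner x y) \<le> norm x * norm y"
proof -
  define w where "w = cinner x y"
  have "cmod w * cmod w = Re (cnj w * w)"
    by (simp add: mult.commute[of "cnj w"] complex_norm_square[symmetric] power2_eq_square flip: of_real_mult)
  also have "\<dots> = inner (w *s x) y"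
    by (simp add: w_def cinner_scale_left flip: Re_cinner)
  also have "\<dots> \<le> norm (w *s x) * norm y" by (rule norm_cauchy_schwarz)
  also have "norm (w *s x) = cmod w * norm x"
    by (simp add: norm_vec_def norm_mult L2_set_right_distrib)
  finally have "cmod w * cmod w \<le> cmod w * (norm x * norm y)" by (simp add: mult_ac)
  then show ?thesis unfolding w_def[symmetric]
    by (cases "w = 0") (auto simp: mult_le_cancel_left)
qed

lemma subspace_of_vec_subspace:
  fixes W :: "(complex^'n::finite) set"
  assumes "vec.subspace W" shows "subspace W"
  using assms unfolding subspace_def vec.subspace_def by (auto simp: scaleR_eq_scale)

lemma matrix_scale: "(A :: 'n::finite cmat) *v (c *s x) = c *s (A *v x)"
  by (simp add: matrix_vector_mult_def vec_eq_iff sum_distrib_left mult_ac)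

lemma matrix_scaleR: "(A :: 'n::finite cmat) *v (r *\<^sub>R x) = r *\<^sub>R (A *v x)"
  by (simp add: scaleR_eq_scale matrix_scale)

lemma self_adjoint_cinner:
  "self_adjoint A \<Longrightarrow> cinner (A *v x) y = cinner x (A *v y)"
  unfolding self_adjoint_def by (metis cinner_adj_left)

section \<open>Orthonormal families: expansions, Bessel's inequality and dimension\<close>

definition orthonormal :: "nat \<Rightarrow> (nat \<Rightarrow> complex^'n::finite) \<Rightarrow> bool" where
  "orthonormal m v \<longleftrightarrow> (\<forall>j<m. \<forall>k<m. cinner (v j) (v k) = (if j = k then 1 else 0))"

lemma orthonormal_cinner_sum:
  assumes "orthonormal m v" "j < m"
  shows "cinner (v j) (\<Sum>k<m. c k *s v k) = c j"
proof -
  have "cinner (v j) (\<Sum>k<m. c k *s v k) = (\<Sum>k<m. if k = j then c k else 0)"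
    unfolding cinner_sum_right cinner_scale_right
    using assms by (intro sum.cong) (auto simp: orthonormal_def)
  then show ?thesis using assms(2) by simp
qed

lemma orthonormal_cinner_sums:
  assumes "orthonormal m v"
  shows "cinner (\<Sum>k<m. a k *s v k) (\<Sum>k<m. c k *s v k) = (\<Sum>k<m. cnj (a k) * c k)"
  unfolding cinner_sum_left cinner_scale_left
  by (intro sum.cong refl) (simp add: orthonormal_cinner_sum[OF assms])

lemma orthonormal_norm_sum:
  assumes "orthonormal m v"
  shows "(norm (\<Sum>k<m. c k *s v k))\<^sup>2 = (\<Sum>k<m. (cmod (c k))\<^sup>2)"
proof -
  have "complex_of_real ((norm (\<Sum>k<m. c k *s v k))\<^sup>2) = of_real (\<Sum>k<m. (cmod (c k))\<^sup>2)"
    unfolding cinner_self[symmetric] orthonormal_cinner_sums[OF assms]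
    by (simp add: mult.commute[of "cnj _"] complex_norm_square[symmetric] del: of_real_power)
  then show ?thesis by (simp only: of_real_eq_iff)
qed

text \<open>The projection \<open>p\<close> onto the span satisfies <p,x> = |p|^2, so |x|^2 - |p|^2
  = |x - p|^2.\<close>

lemma bessel:
  assumes "orthonormal m v"
  shows "(\<Sum>k<m. (cmod (cinner (v k) x))\<^sup>2) \<le> (norm x)\<^sup>2"
proof -
  define p where "p = (\<Sum>k<m. cinner (v k) x *s v k)"
  have np: "(norm p)\<^sup>2 = (\<Sum>k<m. (cmod (cinner (v k) x))\<^sup>2)"
    unfolding p_def by (rule orthonormal_norm_sum[OF assms])
  have "cinner p x = of_real (\<Sum>k<m. (cmod (cinner (v k) x))\<^sup>2)"
    unfolding p_def cinner_sum_left cinner_scale_left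
    by (simp add: mult.commute[of "cnj _"] complex_norm_square[symmetric] del: of_real_power)
  then have "inner p x = (norm p)\<^sup>2" unfolding np by (metis Re_cinner Re_complex_of_real)
  then have "(norm (x - p))\<^sup>2 = (norm x)\<^sup>2 - (norm p)\<^sup>2"
    by (simp add: power2_norm_eq_inner inner_diff inner_commute)
  then show ?thesis using np by (metis diff_ge_0_iff_ge zero_le_power2)
qed

lemma orthonormal_norm:
  assumes "orthonormal m v" "k < m" shows "norm (v k) = 1"
proof -
  have "complex_of_real ((norm (v k))\<^sup>2) = 1"
    using assms by (simp only: cinner_self[symmetric]) (simp add: orthonormal_def)
  then have "(norm (v k))\<^sup>2 = 1" by (simp only: of_real_eq_1_iff)
  then have "norm (v k) = 1 \<or> norm (v k) = - 1" by (simp only: power2_eq_1_iff)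
  then show ?thesis using norm_ge_zero[of "v k"] by linarith
qed

lemma orthonormal_inj_on:
  assumes "orthonormal m v" shows "inj_on v {..<m}"
  using assms unfolding orthonormal_def inj_on_def by (metis lessThan_iff zero_neq_one)

lemma orthonormal_independent:
  assumes "orthonormal m v" shows "vec.independent (v ` {..<m})"
proof -
  have *: "u (v k) = 0" if "(\<Sum>w\<in>v ` {..<m}. u w *s w) = 0" "k < m" for u k
  proof -
    have "(\<Sum>w\<in>v ` {..<m}. u w *s w) = (\<Sum>k<m. u (v k) *s v k)"
      by (simp add: sum.reindex[OF orthonormal_inj_on[OF assms]])
    then have "cinner (v k) 0 = u (v k)"
      using orthonormal_cinner_sum[OF assms that(2), of "\<lambda>k. u (v k)"] that by simp
    then show ?thesis by simp
  qed
  show ?thesis unfolding vec.independent_explicit_module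
  proof (intro allI impI)
    fix t u w assume t: "finite t" "t \<subseteq> v ` {..<m}" "(\<Sum>v\<in>t. u v *s v) = 0" "w \<in> t"
    define u' where "u' = (\<lambda>w. if w \<in> t then u w else 0)"
    have "(\<Sum>w\<in>v ` {..<m}. u' w *s w) = (\<Sum>w\<in>t. u' w *s w)"
      by (rule sum.mono_neutral_right) (use t in \<open>auto simp: u'_def\<close>)
    also have "\<dots> = 0" using t(3) by (simp add: u'_def cong: sum.cong)
    finally have "u' w = 0" using * t(2,4) by blast
    then show "u w = 0" using t(4) by (simp add: u'_def)
  qed
qed

text \<open>A dimension count replaces a maximality argument: orthonormal vectors are independent,
  and there are as many of them as the dimension of \<open>V\<close>.\<close>

lemma orthonormal_span_dim:
  assumes "orthonormal (vec.dim V) v" "vec.subspace V" "\<And>k. k < vec.dim V \<Longrightarrow> v k \<in> V"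
  shows "vec.span (v ` {..<vec.dim V}) = V"
proof -
  have "card (v ` {..<vec.dim V}) = vec.dim V"
    by (simp add: card_image orthonormal_inj_on[OF assms(1)])
  then have "V \<subseteq> vec.span (v ` {..<vec.dim V})"
    using assms(3) orthonormal_independent[OF assms(1)]
    by (intro vec.card_ge_dim_independent) auto
  moreover have "vec.span (v ` {..<vec.dim V}) \<subseteq> V"
    using assms(3) by (intro vec.span_minimal[OF _ assms(2)]) auto
  ultimately show ?thesis by auto
qed

lemma orthonormal_span_expand:
  assumes o: "orthonormal m v" and "x \<in> vec.span (v ` {..<m})"
  shows "x = (\<Sum>k<m. cinner (v k) x *s v k)"
proof -
  obtain u where u: "x = (\<Sum>w\<in>v ` {..<m}. u w *s w)"
    using assms(2) by (auto simp: vec.span_finite)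
  then have "x = (\<Sum>k<m. u (v k) *s v k)"
    by (simp add: sum.reindex[OF orthonormal_inj_on[OF o]])
  then show ?thesis
    using orthonormal_cinner_sum[OF o, of _ "\<lambda>k. u (v k)"] by (auto intro!: sum.cong)
qed

text \<open>A maximiser \<open>x\<close> of the Rayleigh quotient on the compact unit sphere of
  \<open>W\<close> is an eigenvector. With lam the maximum, K = lam - A is positive semidefinite on
  \<open>W\<close> and <x, K x> = 0; for a semidefinite form this forces K x = 0.\<close>

lemma self_adjoint_eigenvector:
  fixes A :: "'n::finite cmat"
  assumes A: "self_adjoint A" and W: "vec.subspace W" and inv: "\<And>x. x \<in> W \<Longrightarrow> A *v x \<in> W"
    and nz: "y \<in> W" "y \<noteq> 0"
  shows "\<exists>x lam. x \<in> W \<and> norm x = 1 \<and> A *v x = complex_of_real lam *s x"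
proof -
  have sW: "subspace W" by (rule subspace_of_vec_subspace[OF W])
  let ?f = "\<lambda>x. inner x (A *v x)"
  let ?S = "W \<inter> sphere 0 1"
  have "compact ?S" by (rule closed_Int_compact[OF closed_subspace[OF sW]]) simp
  moreover have "(1 / norm y) *\<^sub>R y \<in> ?S" using nz sW by (auto simp: subspace_scale)
  moreover have "continuous_on ?S ?f" by (intro continuous_intros)
  ultimately obtain x where x: "x \<in> ?S" "\<And>z. z \<in> ?S \<Longrightarrow> ?f z \<le> ?f x"
    using continuous_attains_sup[of ?S ?f] by (metis empty_iff)
  define lam where "lam = ?f x"
  define K where "K z = lam *\<^sub>R z - A *v z" for z
  have xW: "x \<in> W" and nx: "norm x = 1" using x by auto
  have K_W: "K z \<in> W" if "z \<in> W" for z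
    unfolding K_def using that inv sW by (intro subspace_diff subspace_scale) auto
  have K_sym: "inner z (K w) = inner (K z) w" for z w
    using arg_cong[OF self_adjoint_cinner[OF A, of z w], of Re]
    by (simp add: K_def inner_diff Re_cinner)
  have K_pos: "0 \<le> inner z (K z)" if "z \<in> W" for z
  proof (cases "z = 0")
    case False
    have "(1 / norm z) *\<^sub>R z \<in> ?S" using False that sW by (auto simp: subspace_scale)
    then have "?f ((1 / norm z) *\<^sub>R z) \<le> lam" using x(2) lam_def by blast
    then have "?f z / (norm z)\<^sup>2 \<le> lam"
      by (simp add: matrix_scaleR power2_eq_square)
    then show ?thesis using False
      by (simp add: K_def inner_diff power2_norm_eq_inner[symmetric] divide_simps mult.commute)
  qed (simp add: K_def)
  have xK: "inner x (K x) = 0"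
    by (simp add: K_def inner_diff lam_def power2_norm_eq_inner[symmetric] nx)
  define n where "n = (norm (K x))\<^sup>2"
  define p where "p = inner (K x) (K (K x))"
  have quad: "0 \<le> 2 * t * n + t\<^sup>2 * p" for t
  proof -
    have "0 \<le> inner (x + t *\<^sub>R K x) (K (x + t *\<^sub>R K x))"
      by (intro K_pos subspace_add[OF sW] subspace_scale[OF sW] K_W xW)
    also have "K (x + t *\<^sub>R K x) = K x + t *\<^sub>R K (K x)"
      by (simp add: K_def matrix_vector_right_distrib matrix_vector_mult_diff_distrib
          matrix_scaleR algebra_simps)
    also have "inner (x + t *\<^sub>R K x) \<dots> = 2 * t * n + t\<^sup>2 * p"
      using K_sym[of x "K x"]
      by (simp add: inner_add xK n_def p_def dot_square_norm power2_eq_square algebra_simps)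
    finally show ?thesis .
  qed
  have "n = 0"
  proof (rule ccontr)
    assume "n \<noteq> 0"
    then have n: "n > 0" by (simp add: n_def)
    have ap: "\<bar>p\<bar> + 1 > 0" by linarith
    \<comment> \<open>A negative \<open>t\<close> this small keeps |t p| below n, so the linear term
      2 t n wins over t^2 p and the quadratic becomes negative.\<close>
    define t where "t = - (n / (\<bar>p\<bar> + 1))"
    have t: "t < 0" using n ap by (simp add: t_def)
    have "\<bar>t\<bar> * (\<bar>p\<bar> + 1) = n" using n ap by (simp add: t_def)
    then have "\<bar>t * p\<bar> + \<bar>t\<bar> = n" by (simp add: abs_mult algebra_simps)
    then have "0 < 2 * n + t * p" using n by linarith
    then have "t * (2 * n + t * p) < 0" using t by (simp add: mult_neg_pos)
    then show False using quad[of t] by (simp add: algebra_simps power2_eq_square)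
  qed
  then have "A *v x = complex_of_real lam *s x"
    by (simp add: n_def K_def scaleR_eq_scale)
  then show ?thesis using xW nx by blast
qed

text \<open>Stated for an invariant subspace because it is applied both to the whole space (for the
  Hamiltonian and for |B|) and to a macro space (for compressed operators). The eigenvectors are
  found one at a time: the part of \<open>V\<close> orthogonal to those already found is again
  invariant, and it contains the nonzero vector x - p, where x lies in \<open>V\<close> outside
  their span and p is its projection onto that span.\<close>

theorem self_adjoint_spectral:
  fixes A :: "'n::finite cmat"
  assumes A: "self_adjoint A" and V: "vec.subspace V" and inv: "\<And>x. x \<in> V \<Longrightarrow> A *v x \<in> V"
  obtains v and lam :: "nat \<Rightarrow> real" where "orthonormal (vec.dim V) v"
    "\<And>k. k < vec.dim V \<Longrightarrow> v k \<in> V"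
    "\<And>k. k < vec.dim V \<Longrightarrow> A *v v k = of_real (lam k) *s v k"
proof -
  have "\<exists>v lam. orthonormal m v \<and> (\<forall>k<m. v k \<in> V \<and> A *v v k = complex_of_real (lam k) *s v k)"
    if "m \<le> vec.dim V" for m
    using that
  proof (induction m)
    case 0
    then show ?case by (simp add: orthonormal_def)
  next
    case (Suc m)
    then obtain v lam where o: "orthonormal m v" and vV: "\<And>k. k < m \<Longrightarrow> v k \<in> V"
      and ev: "\<And>k. k < m \<Longrightarrow> A *v v k = complex_of_real (lam k) *s v k" by auto
    have "\<not> V \<subseteq> vec.span (v ` {..<m})"
    proof
      assume "V \<subseteq> vec.span (v ` {..<m})"
      then have "vec.dim V \<le> card (v ` {..<m})" by (intro vec.dim_le_card) auto
      also have "\<dots> \<le> m" by (metis card_image_le card_lessThan finite_lessThan)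
      finally show False using Suc.prems by simp
    qed
    then obtain x where x: "x \<in> V" "x \<notin> vec.span (v ` {..<m})" by auto
    define p where "p = (\<Sum>k<m. cinner (v k) x *s v k)"
    define W where "W = {z \<in> V. \<forall>k<m. cinner (v k) z = 0}"
    have pS: "p \<in> vec.span (v ` {..<m})"
      unfolding p_def by (intro vec.span_sum vec.span_scale vec.span_base) auto
    have pV: "p \<in> V"
      unfolding p_def using vV by (intro vec.subspace_sum[OF V] vec.subspace_scale[OF V]) auto
    have 1: "vec.subspace W"
      using V by (auto simp: W_def vec.subspace_def cinner_add_right cinner_scale_right)
    have 2: "A *v z \<in> W" if "z \<in> W" for z
    proof -
      have "cinner (v k) (A *v z) = 0" if "k < m" for k
        using that \<open>z \<in> W\<close> ev[OF that]
        by (simp add: self_adjoint_cinner[OF A, symmetric] cinner_scale_left W_def)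
      then show ?thesis using that inv by (auto simp: W_def)
    qed
    have 3: "x - p \<in> W"
      using x(1) pV orthonormal_cinner_sum[OF o, of _ "\<lambda>k. cinner (v k) x"]
      by (auto simp: W_def vec.subspace_diff[OF V] cinner_diff_right p_def)
    have 4: "x - p \<noteq> 0" using x(2) pS by auto
    obtain y \<mu> where y: "y \<in> W" "norm y = 1" "A *v y = complex_of_real \<mu> *s y"
      using self_adjoint_eigenvector[OF A 1 2 3 4] by auto
    have yv: "cinner (v k) y = 0" "cinner y (v k) = 0" if "k < m" for k
    proof -
      show "cinner (v k) y = 0" using y(1) that by (auto simp: W_def)
      then show "cinner y (v k) = 0" by (metis cnj_cinner complex_cnj_zero)
    qed
    have yy: "cinner y y = 1" using y(2) by (simp add: cinner_self)
    have "orthonormal (Suc m) (v(m := y))"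
      using o yv yy by (auto simp: orthonormal_def less_Suc_eq)
    moreover have "\<forall>k<Suc m. (v(m := y)) k \<in> V \<and>
        A *v (v(m := y)) k = complex_of_real ((lam(m := \<mu>)) k) *s (v(m := y)) k"
      using vV ev y by (auto simp: less_Suc_eq W_def)
    ultimately show ?case by blast
  qed
  from this[of "vec.dim V"] that show ?thesis by auto
qed

section \<open>Gaussian integrals and polar coordinates on coordinate space\<close>

text \<open>Completing the square in the real and in the imaginary part leaves two normal densities.
  The linear term is the point: for \<beta> = 1 the integral produces exp(|w|^2), which is how the
  square of a linear form gets linearised later.\<close>

lemma complex_gaussian_nn_integral:
  fixes w :: complex
  assumes b: "\<beta> > 0"
  shows "(\<integral>\<^sup>+x. ennreal (exp (- \<beta> * (cmod x)\<^sup>2 + 2 * Re (cnj w * x))) \<partial>lborel)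
       = ennreal (pi / \<beta> * exp ((cmod w)\<^sup>2 / \<beta>))"
proof -
  define g where "g a y = exp (- \<beta> * y\<^sup>2 + 2 * a * y)" for a y :: real
  have real_gauss: "(\<integral>\<^sup>+y. ennreal (g a y) \<partial>lborel) = ennreal (sqrt (pi / \<beta>) * exp (a\<^sup>2 / \<beta>))" for a
  proof -
    define s where "s = 1 / sqrt (2 * \<beta>)"
    have s: "s > 0" "s\<^sup>2 = 1 / (2 * \<beta>)" using b by (auto simp: s_def power_divide)
    have "g a y = sqrt (pi / \<beta>) * exp (a\<^sup>2 / \<beta>) * normal_density (a / \<beta>) s y" for y
    proof -
      have "- \<beta> * y\<^sup>2 + 2 * a * y = a\<^sup>2 / \<beta> + (- (y - a / \<beta>)\<^sup>2 / (2 * s\<^sup>2))"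
        unfolding s(2) using b by (simp add: field_simps power2_eq_square)
      moreover have "2 * pi * s\<^sup>2 = pi / \<beta>" using b by (simp add: s(2))
      ultimately show ?thesis
        using b unfolding g_def normal_density_def by (simp only: exp_add) simp
    qed
    then have "(\<integral>\<^sup>+y. ennreal (g a y) \<partial>lborel)
        = (\<integral>\<^sup>+y. ennreal (sqrt (pi / \<beta>) * exp (a\<^sup>2 / \<beta>)) * ennreal (normal_density (a / \<beta>) s y) \<partial>lborel)"
      using b by (simp add: ennreal_mult)
    also have "\<dots> = ennreal (sqrt (pi / \<beta>) * exp (a\<^sup>2 / \<beta>)) * (\<integral>\<^sup>+y. ennreal (normal_density (a / \<beta>) s y) \<partial>lborel)"
      by (rule nn_integral_cmult) simp
    also have "(\<integral>\<^sup>+y. ennreal (normal_density (a / \<beta>) s y) \<partial>lborel) = 1"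
      using prob_space.emeasure_space_1[OF prob_space_normal_density[OF s(1), of "a / \<beta>"]]
      by (simp add: emeasure_density)
    finally show ?thesis by simp
  qed
  have "(\<integral>\<^sup>+x. ennreal (exp (- \<beta> * (cmod x)\<^sup>2 + 2 * Re (cnj w * x))) \<partial>lborel)
      = (\<integral>\<^sup>+x. (\<Prod>b\<in>Basis. ennreal (g (w \<bullet> b) (x \<bullet> b))) \<partial>lborel)"
  proof (rule nn_integral_cong)
    fix x :: complex
    have "exp (- \<beta> * (cmod x)\<^sup>2 + 2 * Re (cnj w * x)) = g (Re w) (Re x) * g (Im w) (Im x)"
      by (simp add: g_def exp_add[symmetric] cmod_power2 algebra_simps)
    then show "ennreal (exp (- \<beta> * (cmod x)\<^sup>2 + 2 * Re (cnj w * x))) = (\<Prod>b\<in>Basis. ennreal (g (w \<bullet> b) (x \<bullet> b)))"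
      by (simp add: Basis_complex_def ennreal_mult g_def)
  qed
  also have "\<dots> = (\<Prod>b\<in>Basis. \<integral>\<^sup>+y. ennreal (g (w \<bullet> b) y) \<partial>lborel)"
    by (rule nn_integral_lborel_prod) (auto simp: g_def)
  also have "\<dots> = ennreal (sqrt (pi / \<beta>) * exp ((Re w)\<^sup>2 / \<beta>)) * ennreal (sqrt (pi / \<beta>) * exp ((Im w)\<^sup>2 / \<beta>))"
    by (simp add: real_gauss Basis_complex_def)
  also have "\<dots> = ennreal ((sqrt (pi / \<beta>) * sqrt (pi / \<beta>)) * (exp ((Re w)\<^sup>2 / \<beta>) * exp ((Im w)\<^sup>2 / \<beta>)))"
    using b by (simp only: ennreal_mult[symmetric] mult_nonneg_nonneg real_sqrt_ge_zero exp_ge_zero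
        divide_nonneg_pos pi_ge_zero mult_ac)
  also have "\<dots> = ennreal (pi / \<beta> * exp ((cmod w)\<^sup>2 / \<beta>))"
    using b by (simp only: real_sqrt_mult_self exp_add[symmetric] cmod_power2 add_divide_distrib) simp
  finally show ?thesis .
qed

abbreviation cpm :: "nat \<Rightarrow> (nat \<Rightarrow> complex) measure" where
  "cpm d \<equiv> PiM {..<d} (\<lambda>_. lborel)"

interpretation cpm: product_sigma_finite "\<lambda>_::nat. lborel :: complex measure"
  by standard

lemma sigma_finite_cpm: "sigma_finite_measure (cpm d)"
  by (rule cpm.sigma_finite) simp

lemma cpm_component: "k < d \<Longrightarrow> (\<lambda>c. c k) \<in> borel_measurable (cpm d)"
  using measurable_component_singleton[of k "{..<d}" "\<lambda>_. lborel :: complex measure"] by simp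

lemma cnj_borel_measurable [measurable]: "cnj \<in> borel_measurable borel"
  by (intro borel_measurable_continuous_onI continuous_intros)

lemma cpm_gaussian_nn_integral:
  assumes b: "\<And>k. k < d \<Longrightarrow> \<beta> k > 0"
  shows "(\<integral>\<^sup>+c. ennreal (exp (\<Sum>k<d. - \<beta> k * (cmod (c k))\<^sup>2 + 2 * Re (cnj (w k) * c k))) \<partial>cpm d)
       = ennreal (\<Prod>k<d. pi / \<beta> k * exp ((cmod (w k))\<^sup>2 / \<beta> k))"
proof -
  have "(\<integral>\<^sup>+c. ennreal (exp (\<Sum>k<d. - \<beta> k * (cmod (c k))\<^sup>2 + 2 * Re (cnj (w k) * c k))) \<partial>cpm d)
     = (\<integral>\<^sup>+c. (\<Prod>k<d. ennreal (exp (- \<beta> k * (cmod (c k))\<^sup>2 + 2 * Re (cnj (w k) * c k)))) \<partial>cpm d)"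
    by (simp add: exp_sum prod_ennreal)
  also have "\<dots> = (\<Prod>k<d. \<integral>\<^sup>+x. ennreal (exp (- \<beta> k * (cmod x)\<^sup>2 + 2 * Re (cnj (w k) * x))) \<partial>lborel)"
    by (rule cpm.product_nn_integral_prod) auto
  also have "\<dots> = (\<Prod>k<d. ennreal (pi / \<beta> k * exp ((cmod (w k))\<^sup>2 / \<beta> k)))"
    using b by (intro prod.cong refl complex_gaussian_nn_integral) auto
  also have "\<dots> = ennreal (\<Prod>k<d. pi / \<beta> k * exp ((cmod (w k))\<^sup>2 / \<beta> k))"
    using b by (intro prod_ennreal) (auto simp: less_imp_le)
  finally show ?thesis .
qed

text \<open>Writing the square of each linear form as a Gaussian average of exponentials of that form
  (the Hubbard--Stratonovich transformation) diagonalises the quadratic form without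
  appealing to the unitary invariance of Lebesgue measure.\<close>

lemma cpm_quadratic_nn_integral:
  fixes u :: "nat \<Rightarrow> nat \<Rightarrow> complex" and \<kappa> :: "nat \<Rightarrow> real"
  assumes k: "\<And>j. j < d \<Longrightarrow> \<kappa> j > 0"
    and rows: "\<And>i j. i < d \<Longrightarrow> j < d \<Longrightarrow> (\<Sum>l<d. u i l * cnj (u j l)) = (if i = j then 1 else 0)"
    and iso: "\<And>c. (\<Sum>j<d. (cmod (\<Sum>l<d. u j l * c l))\<^sup>2) = (\<Sum>l<d. (cmod (c l))\<^sup>2)"
  shows "(\<integral>\<^sup>+c. ennreal (exp (- (\<Sum>j<d. \<kappa> j * (cmod (\<Sum>l<d. u j l * c l))\<^sup>2))) \<partial>cpm d)
       = ennreal (pi ^ d / (\<Prod>j<d. \<kappa> j))"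
proof -
  \<comment> \<open>Since \<beta> exceeds every \<open>\<kappa> j\<close>, the assumption
    \<open>iso\<close> turns \<beta>|c|^2 minus the given form into the sum of the squares |s j L c
    j|^2. These squares are the ones to be linearised.\<close>
  define \<beta> where "\<beta> = 1 + (\<Sum>j<d. \<kappa> j)"
  have kb: "\<kappa> j \<le> \<beta>" if "j < d" for j
    using member_le_sum[of j "{..<d}" \<kappa>] that k by (force simp: \<beta>_def less_imp_le)
  have b: "\<beta> > 0" unfolding \<beta>_def using k by (intro add_pos_nonneg sum_nonneg) (auto simp: less_imp_le)
  define s where "s j = sqrt (\<beta> - \<kappa> j)" for j
  have s2: "(s j)\<^sup>2 = \<beta> - \<kappa> j" if "j < d" for j using kb[OF that] by (simp add: s_def)
  define L where "L c j = (\<Sum>l<d. u j l * c l)" for c j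
  define w where "w z l = (\<Sum>j<d. s j * cnj (u j l) * z j)" for z l
  \<comment> \<open>The joint integrand: integrating over z restores the given form up to the factor
    pi^d, while integrating over c first leaves a form that is diagonal in z.\<close>
  define E where "E c z = exp (- (\<Sum>l<d. \<beta> * (cmod (c l))\<^sup>2)) *
      exp (\<Sum>j<d. - 1 * (cmod (z j))\<^sup>2 + 2 * Re (cnj (s j * L c j) * z j))" for c z
  have pt: "ennreal (exp (- (\<Sum>j<d. \<kappa> j * (cmod (L c j))\<^sup>2)))
      = ennreal (1 / pi ^ d) * (\<integral>\<^sup>+z. ennreal (E c z) \<partial>cpm d)" for c
  proof -
    have "(\<integral>\<^sup>+z. ennreal (E c z) \<partial>cpm d)
        = ennreal (exp (- (\<Sum>l<d. \<beta> * (cmod (c l))\<^sup>2))) *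
          (\<integral>\<^sup>+z. ennreal (exp (\<Sum>j<d. - 1 * (cmod (z j))\<^sup>2 + 2 * Re (cnj (s j * L c j) * z j))) \<partial>cpm d)"
      unfolding E_def by (subst nn_integral_cmult[symmetric]) (auto simp: ennreal_mult)
    also have "\<dots> = ennreal (exp (- (\<Sum>l<d. \<beta> * (cmod (c l))\<^sup>2))) *
        ennreal (\<Prod>j<d. pi / 1 * exp ((cmod (s j * L c j))\<^sup>2 / 1))"
      by (subst cpm_gaussian_nn_integral) auto
    also have "\<dots> = ennreal (exp (- (\<Sum>l<d. \<beta> * (cmod (c l))\<^sup>2)) *
        (pi ^ d * exp (\<Sum>j<d. (cmod (s j * L c j))\<^sup>2)))"
      by (simp add: prod.distrib exp_sum ennreal_mult prod_nonneg)
    also have "exp (- (\<Sum>l<d. \<beta> * (cmod (c l))\<^sup>2)) * (pi ^ d * exp (\<Sum>j<d. (cmod (s j * L c j))\<^sup>2))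
        = pi ^ d * exp (- (\<Sum>l<d. \<beta> * (cmod (c l))\<^sup>2) + (\<Sum>j<d. (cmod (s j * L c j))\<^sup>2))"
      by (simp only: exp_add mult_ac)
    also have "(\<Sum>j<d. (cmod (s j * L c j))\<^sup>2) = (\<Sum>j<d. (\<beta> - \<kappa> j) * (cmod (L c j))\<^sup>2)"
      by (intro sum.cong refl) (simp add: norm_mult power_mult_distrib s2)
    also have "\<dots> = \<beta> * (\<Sum>l<d. (cmod (c l))\<^sup>2) - (\<Sum>j<d. \<kappa> j * (cmod (L c j))\<^sup>2)"
      using iso[of c] by (simp add: L_def left_diff_distrib sum_subtractf flip: sum_distrib_left)
    finally have "(\<integral>\<^sup>+z. ennreal (E c z) \<partial>cpm d) = ennreal (pi ^ d * exp (- (\<Sum>j<d. \<kappa> j * (cmod (L c j))\<^sup>2)))"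
      by (simp add: sum_distrib_left)
    then show ?thesis by (simp add: ennreal_mult[symmetric])
  qed
  have E_alt: "E c z = exp (- (\<Sum>j<d. (cmod (z j))\<^sup>2)) *
      exp (\<Sum>l<d. - \<beta> * (cmod (c l))\<^sup>2 + 2 * Re (cnj (w z l) * c l))" for c z
  proof -
    have "(\<Sum>j<d. Re (cnj (s j * L c j) * z j)) = Re (\<Sum>j<d. \<Sum>l<d. s j * cnj (u j l) * cnj (c l) * z j)"
      by (simp add: L_def sum_distrib_left sum_distrib_right mult_ac)
    also have "\<dots> = Re (\<Sum>l<d. \<Sum>j<d. s j * cnj (u j l) * cnj (c l) * z j)"
      by (subst sum.swap) simp
    also have "\<dots> = (\<Sum>l<d. Re (cnj (c l) * w z l))"
      by (simp add: w_def sum_distrib_left mult_ac)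
    also have "\<dots> = (\<Sum>l<d. Re (cnj (w z l) * c l))"
      by (intro sum.cong refl) simp
    finally show ?thesis
      unfolding E_def exp_add[symmetric]
      by (simp add: sum.distrib sum_subtractf sum_negf flip: sum_distrib_left)
  qed
  \<comment> \<open>Here the other half of unitarity enters: \<open>iso\<close> says that u
    preserves norms, \<open>rows\<close> that its adjoint does.\<close>
  have w2: "(\<Sum>l<d. (cmod (w z l))\<^sup>2) = (\<Sum>j<d. (\<beta> - \<kappa> j) * (cmod (z j))\<^sup>2)" for z
  proof -
    define y where "y j = s j * z j" for j
    have "complex_of_real (\<Sum>l<d. (cmod (w z l))\<^sup>2) = (\<Sum>l<d. w z l * cnj (w z l))"
      by (simp add: complex_norm_square del: of_real_power)
    also have "\<dots> = (\<Sum>l<d. \<Sum>i<d. \<Sum>j<d. y i * cnj (y j) * (u j l * cnj (u i l)))"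
      unfolding w_def y_def by (simp add: sum_product mult_ac)
    also have "\<dots> = (\<Sum>i<d. \<Sum>l<d. \<Sum>j<d. y i * cnj (y j) * (u j l * cnj (u i l)))"
      by (rule sum.swap)
    also have "\<dots> = (\<Sum>i<d. \<Sum>j<d. \<Sum>l<d. y i * cnj (y j) * (u j l * cnj (u i l)))"
      by (rule sum.cong[OF refl], rule sum.swap)
    also have "\<dots> = (\<Sum>i<d. \<Sum>j<d. if j = i then y i * cnj (y j) else 0)"
      unfolding sum_distrib_left[symmetric] by (intro sum.cong refl) (simp add: rows)
    also have "\<dots> = (\<Sum>i<d. y i * cnj (y i))" by (intro sum.cong refl) simp
    also have "\<dots> = complex_of_real (\<Sum>j<d. (\<beta> - \<kappa> j) * (cmod (z j))\<^sup>2)"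
      unfolding of_real_sum
    proof (intro sum.cong refl)
      fix i assume "i \<in> {..<d}"
      then have "(cmod (y i))\<^sup>2 = (\<beta> - \<kappa> i) * (cmod (z i))\<^sup>2"
        by (simp add: y_def norm_mult power_mult_distrib s2)
      then show "y i * cnj (y i) = complex_of_real ((\<beta> - \<kappa> i) * (cmod (z i))\<^sup>2)"
        by (metis complex_norm_square)
    qed
    finally show ?thesis by (simp only: of_real_eq_iff)
  qed
  \<comment> \<open>The exponents combine to -|z j|^2 + (\<beta> - \<kappa> j)/\<beta> |z j|^2 =
    -(\<kappa> j/\<beta>)|z j|^2, so the mixed terms are gone and the auxiliary \<beta> cancels in
    the final product.\<close>
  have inner: "(\<integral>\<^sup>+c. ennreal (E c z) \<partial>cpm d) = ennreal ((pi / \<beta>) ^ d) *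
      ennreal (exp (\<Sum>j<d. - (\<kappa> j / \<beta>) * (cmod (z j))\<^sup>2 + 2 * Re (cnj 0 * z j)))" for z
  proof -
    have "(\<integral>\<^sup>+c. ennreal (E c z) \<partial>cpm d) = ennreal (exp (- (\<Sum>j<d. (cmod (z j))\<^sup>2))) *
       (\<integral>\<^sup>+c. ennreal (exp (\<Sum>l<d. - \<beta> * (cmod (c l))\<^sup>2 + 2 * Re (cnj (w z l) * c l))) \<partial>cpm d)"
      unfolding E_alt by (subst nn_integral_cmult[symmetric]) (auto simp: ennreal_mult)
    also have "\<dots> = ennreal (exp (- (\<Sum>j<d. (cmod (z j))\<^sup>2))) *
        ennreal (\<Prod>l<d. pi / \<beta> * exp ((cmod (w z l))\<^sup>2 / \<beta>))"
      by (subst cpm_gaussian_nn_integral) (auto simp: b)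
    also have "(\<Prod>l<d. pi / \<beta> * exp ((cmod (w z l))\<^sup>2 / \<beta>)) = (pi / \<beta>) ^ d * exp ((\<Sum>l<d. (cmod (w z l))\<^sup>2) / \<beta>)"
      by (simp only: prod.distrib exp_sum sum_divide_distrib finite_lessThan prod_constant card_lessThan)
    also have "ennreal (exp (- (\<Sum>j<d. (cmod (z j))\<^sup>2))) * ennreal ((pi / \<beta>) ^ d * exp ((\<Sum>l<d. (cmod (w z l))\<^sup>2) / \<beta>))
      = ennreal ((pi / \<beta>) ^ d) * ennreal (exp (- (\<Sum>j<d. (cmod (z j))\<^sup>2) + (\<Sum>l<d. (cmod (w z l))\<^sup>2) / \<beta>))"
      unfolding exp_add using b by (simp add: ennreal_mult mult_ac)
    also have "- (\<Sum>j<d. (cmod (z j))\<^sup>2) + (\<Sum>l<d. (cmod (w z l))\<^sup>2) / \<beta>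
       = (\<Sum>j<d. - (\<kappa> j / \<beta>) * (cmod (z j))\<^sup>2 + 2 * Re (cnj 0 * z j))"
      unfolding w2 sum_divide_distrib sum_negf[symmetric] sum.distrib[symmetric]
      using b by (intro sum.cong refl) (simp add: field_simps)
    finally show ?thesis .
  qed
  interpret S: pair_sigma_finite "cpm d" "cpm d"
    by (intro pair_sigma_finite.intro sigma_finite_cpm)
  have meas: "(\<lambda>(c, z). ennreal (E c z)) \<in> borel_measurable (cpm d \<Otimes>\<^sub>M cpm d)"
  proof -
    have [measurable]: "(\<lambda>x. fst x j) \<in> borel_measurable (cpm d \<Otimes>\<^sub>M cpm d)"
      "(\<lambda>x. snd x j) \<in> borel_measurable (cpm d \<Otimes>\<^sub>M cpm d)" if "j \<in> {..<d}" for j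
      using that by (auto intro!: measurable_compose[OF measurable_fst] measurable_compose[OF measurable_snd]
          cpm_component)
    show ?thesis unfolding E_def L_def by measurable
  qed
  have pos: "0 \<le> 1 / pi ^ d" "0 \<le> (pi / \<beta>) ^ d" "0 \<le> pi ^ d * \<beta> ^ d / (\<Prod>j<d. \<kappa> j)"
    using b k by (auto intro!: divide_nonneg_nonneg prod_nonneg simp: less_imp_le)
  have "(\<integral>\<^sup>+c. ennreal (exp (- (\<Sum>j<d. \<kappa> j * (cmod (L c j))\<^sup>2))) \<partial>cpm d)
      = ennreal (1 / pi ^ d) * (\<integral>\<^sup>+c. (\<integral>\<^sup>+z. ennreal (E c z) \<partial>cpm d) \<partial>cpm d)"
    unfolding pt by (rule nn_integral_cmult) (use meas in measurable)
  also have "(\<integral>\<^sup>+c. (\<integral>\<^sup>+z. ennreal (E c z) \<partial>cpm d) \<partial>cpm d) = (\<integral>\<^sup>+z. (\<integral>\<^sup>+c. ennreal (E c z) \<partial>cpm d) \<partial>cpm d)"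
    using S.Fubini'[of "\<lambda>c z. ennreal (E c z)"] meas by simp
  also have "\<dots> = ennreal ((pi / \<beta>) ^ d) * (\<integral>\<^sup>+z.
      ennreal (exp (\<Sum>j<d. - (\<kappa> j / \<beta>) * (cmod (z j))\<^sup>2 + 2 * Re (cnj 0 * z j))) \<partial>cpm d)"
    unfolding inner by (rule nn_integral_cmult) measurable
  also have "\<dots> = ennreal ((pi / \<beta>) ^ d) * ennreal (\<Prod>j<d. pi / (\<kappa> j / \<beta>) * exp ((cmod 0)\<^sup>2 / (\<kappa> j / \<beta>)))"
    by (subst cpm_gaussian_nn_integral) (auto simp: b k)
  also have "(\<Prod>j<d. pi / (\<kappa> j / \<beta>) * exp ((cmod 0)\<^sup>2 / (\<kappa> j / \<beta>))) = pi ^ d * \<beta> ^ d / (\<Prod>j<d. \<kappa> j)"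
    by (simp add: prod_dividef prod.distrib power_mult_distrib)
  also have "ennreal (1 / pi ^ d) * (ennreal ((pi / \<beta>) ^ d) * ennreal (pi ^ d * \<beta> ^ d / (\<Prod>j<d. \<kappa> j)))
     = ennreal (1 / pi ^ d * ((pi / \<beta>) ^ d * (pi ^ d * \<beta> ^ d / (\<Prod>j<d. \<kappa> j))))"
    by (simp only: ennreal_mult[OF pos(1) mult_nonneg_nonneg[OF pos(2,3)]] ennreal_mult[OF pos(2,3)])
  also have "1 / pi ^ d * ((pi / \<beta>) ^ d * (pi ^ d * \<beta> ^ d / (\<Prod>j<d. \<kappa> j))) = pi ^ d / (\<Prod>j<d. \<kappa> j)"
    using b by (simp add: power_divide)
  finally show ?thesis unfolding L_def .
qed

section \<open>Scaling of coordinate space and the radial integrals\<close>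

definition cnormsq :: "nat \<Rightarrow> (nat \<Rightarrow> complex) \<Rightarrow> real" where
  "cnormsq d c = (\<Sum>k<d. (cmod (c k))\<^sup>2)"

text \<open>Restricted to the index set because the points of \<open>cpm d\<close> are extensional
  functions, and a pointwise multiple could leave that space.\<close>

definition cscale :: "nat \<Rightarrow> real \<Rightarrow> (nat \<Rightarrow> complex) \<Rightarrow> nat \<Rightarrow> complex" where
  "cscale d s c = (\<lambda>k\<in>{..<d}. s *\<^sub>R c k)"

lemma cscale_measurable [measurable]: "cscale d s \<in> cpm d \<rightarrow>\<^sub>M cpm d"
  unfolding cscale_def by measurable

lemma cnormsq_measurable [measurable]: "cnormsq d \<in> borel_measurable (cpm d)"
  unfolding cnormsq_def by measurable

lemma cnormsq_cscale: "cnormsq d (cscale d s c) = s\<^sup>2 * cnormsq d c"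
  by (simp add: cnormsq_def cscale_def sum_distrib_left power_mult_distrib)

lemma coord_ball_eq: "coord_ball d = {c \<in> space (cpm d). cnormsq d c \<le> 1}"
  by (simp add: coord_ball_def space_PiM cnormsq_def)

lemma coord_ball_sets [measurable]: "coord_ball d \<in> sets (cpm d)"
  unfolding coord_ball_eq by measurable

lemma emeasure_lborel_complex_scale:
  fixes A :: "complex set"
  assumes "s > 0" and [measurable]: "A \<in> sets borel"
  shows "emeasure lborel A = ennreal (s\<^sup>2) * emeasure lborel {x. s *\<^sub>R x \<in> A}"
proof -
  have "emeasure lborel A
      = emeasure (density (distr lborel borel (\<lambda>x::complex. 0 + s *\<^sub>R x)) (\<lambda>_. \<bar>s\<bar> ^ DIM(complex))) A"
    using lborel_affine[of s "0 :: complex"] assms(1) by simp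
  also have "\<dots> = ennreal (s\<^sup>2) * emeasure (distr lborel borel (\<lambda>x::complex. s *\<^sub>R x)) A"
    using assms(1) by (simp add: emeasure_density nn_integral_cmult)
  also have "emeasure (distr lborel borel (\<lambda>x::complex. s *\<^sub>R x)) A = emeasure lborel {x. s *\<^sub>R x \<in> A}"
    by (simp add: emeasure_distr vimage_def)
  finally show ?thesis .
qed

text \<open>It suffices to compare on boxes, which determine a product measure. Each complex
  coordinate is a real plane and contributes s^2.\<close>

lemma cpm_scale:
  assumes s: "s > 0"
  shows "density (distr (cpm d) (cpm d) (cscale d s)) (\<lambda>_. ennreal (s ^ (2 * d))) = cpm d"
proof (rule cpm.PiM_eqI)
  fix A :: "nat \<Rightarrow> complex set" assume "\<And>i. i \<in> {..<d} \<Longrightarrow> A i \<in> sets lborel"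
  then have A: "A i \<in> sets borel" if "i < d" for i using that by auto
  have A': "{x. s *\<^sub>R x \<in> A i} \<in> sets borel" if "i < d" for i
  proof -
    have "(\<lambda>x. s *\<^sub>R x) -` A i \<inter> space borel \<in> sets borel"
      by (rule measurable_sets[OF _ A[OF that]]) measurable
    then show ?thesis by (simp add: vimage_def)
  qed
  have P: "Pi\<^sub>E {..<d} A \<in> sets (cpm d)" using A by (intro sets_PiM_I_finite) auto
  have "cscale d s -` Pi\<^sub>E {..<d} A \<inter> space (cpm d) = Pi\<^sub>E {..<d} (\<lambda>i. {x. s *\<^sub>R x \<in> A i})"
    by (auto simp: cscale_def space_PiM PiE_def Pi_def extensional_def restrict_def)
  then have "emeasure (density (distr (cpm d) (cpm d) (cscale d s)) (\<lambda>_. ennreal (s ^ (2 * d)))) (Pi\<^sub>E {..<d} A)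
      = ennreal (s ^ (2 * d)) * emeasure (cpm d) (Pi\<^sub>E {..<d} (\<lambda>i. {x. s *\<^sub>R x \<in> A i}))"
    using P by (simp add: emeasure_density nn_integral_cmult emeasure_distr)
  also have "\<dots> = ennreal (s ^ (2 * d)) * (\<Prod>i<d. emeasure lborel {x. s *\<^sub>R x \<in> A i})"
    using A' by (subst cpm.emeasure_PiM) auto
  also have "\<dots> = (\<Prod>i<d. ennreal (s\<^sup>2) * emeasure lborel {x. s *\<^sub>R x \<in> A i})"
    using s by (simp add: prod.distrib ennreal_power power_mult)
  also have "\<dots> = (\<Prod>i<d. emeasure lborel (A i))"
    by (intro prod.cong refl emeasure_lborel_complex_scale[symmetric] s) (auto intro: A)
  finally show "emeasure (density (distr (cpm d) (cpm d) (cscale d s)) (\<lambda>_. ennreal (s ^ (2 * d)))) (Pi\<^sub>E {..<d} A)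
      = (\<Prod>i<d. emeasure lborel (A i))" .
qed auto

lemma cpm_nn_integral_scale:
  assumes s: "s > 0" and f [measurable]: "f \<in> borel_measurable (cpm d)"
  shows "(\<integral>\<^sup>+c. f c \<partial>cpm d) = ennreal (s ^ (2 * d)) * (\<integral>\<^sup>+c. f (cscale d s c) \<partial>cpm d)"
proof -
  have "(\<integral>\<^sup>+c. f c \<partial>cpm d)
      = (\<integral>\<^sup>+c. f c \<partial>density (distr (cpm d) (cpm d) (cscale d s)) (\<lambda>_. ennreal (s ^ (2 * d))))"
    by (simp only: cpm_scale[OF s])
  also have "\<dots> = ennreal (s ^ (2 * d)) * (\<integral>\<^sup>+c. f (cscale d s c) \<partial>cpm d)"
    by (subst nn_integral_density) (auto simp: nn_integral_cmult nn_integral_distr)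
  finally show ?thesis .
qed

text \<open>The layer-cake formula for the exponential: with \<open>a\<close> the squared radius it
  rewrites a Gaussian weight as a superposition of indicators of balls.\<close>

lemma nn_integral_exp_tail:
  fixes g a :: real
  assumes g: "g > 0"
  shows "(\<integral>\<^sup>+r. ennreal (g * exp (- g * r)) * indicator {a..} r \<partial>lborel) = ennreal (exp (- g * a))"
proof -
  have "((\<lambda>r. - exp (- g * r)) \<longlongrightarrow> - 0) at_top"
    using g by (intro tendsto_minus filterlim_compose[OF exp_at_bot]
      filterlim_tendsto_neg_mult_at_bot[OF tendsto_const _ filterlim_ident]) simp
  then have "(\<integral>\<^sup>+r. ennreal (g * exp (- g * r)) * indicator {a..} r \<partial>lborel) = ennreal (0 - (- exp (- g * a)))"
    using g by (intro nn_integral_FTC_atLeast) (auto intro!: derivative_eq_intros)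
  then show ?thesis by simp
qed

text \<open>Euler's integral for d! after the substitution x = g r; it evaluates what remains of the
  radial variable once all balls have been scaled to the unit ball.\<close>

lemma nn_integral_power_exp:
  fixes g :: real
  assumes g: "g > 0"
  shows "(\<integral>\<^sup>+r. ennreal (r ^ d * exp (- g * r)) * indicator {0..} r \<partial>lborel) = ennreal (fact d / g ^ Suc d)"
proof -
  have "ennreal (fact d) = (\<integral>\<^sup>+x. ennreal (x ^ d * exp (- x)) * indicator {0..} x \<partial>lborel)"
    by (simp add: nn_intergal_power_times_exp_Ici)
  also have "\<dots> = ennreal \<bar>g\<bar> * (\<integral>\<^sup>+r. ennreal ((0 + g * r) ^ d * exp (- (0 + g * r))) * indicator {0..} (0 + g * r) \<partial>lborel)"
    using g by (intro nn_integral_real_affine) auto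
  also have "\<dots> = ennreal g * (\<integral>\<^sup>+r. ennreal (g ^ d) * (ennreal (r ^ d * exp (- g * r)) * indicator {0..} r) \<partial>lborel)"
  proof -
    have "ennreal ((0 + g * r) ^ d * exp (- (0 + g * r))) * indicator {0..} (0 + g * r)
        = ennreal (g ^ d) * (ennreal (r ^ d * exp (- g * r)) * indicator {0..} r)" for r
    proof (cases "0 \<le> r")
      case True
      then show ?thesis using g by (simp add: ennreal_mult[symmetric] power_mult_distrib mult_ac)
    next
      case False
      then have "g * r < 0" using g by (simp add: mult_pos_neg)
      then show ?thesis using False by simp
    qed
    then show ?thesis using g by simp
  qed
  also have "\<dots> = ennreal (g ^ Suc d) * (\<integral>\<^sup>+r. ennreal (r ^ d * exp (- g * r)) * indicator {0..} r \<partial>lborel)"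
    using g by (subst nn_integral_cmult) (auto simp: ennreal_mult mult_ac)
  finally have eq: "ennreal (fact d) = ennreal (g ^ Suc d) * (\<integral>\<^sup>+r. ennreal (r ^ d * exp (- g * r)) * indicator {0..} r \<partial>lborel)" .
  have "ennreal (fact d / g ^ Suc d) = ennreal (1 / g ^ Suc d) * ennreal (fact d)"
    using g by (simp flip: ennreal_mult)
  also have "\<dots> = (ennreal (1 / g ^ Suc d) * ennreal (g ^ Suc d)) * (\<integral>\<^sup>+r. ennreal (r ^ d * exp (- g * r)) * indicator {0..} r \<partial>lborel)"
    by (simp only: eq mult.assoc)
  also have "ennreal (1 / g ^ Suc d) * ennreal (g ^ Suc d) = 1"
    using g by (simp del: power_Suc flip: ennreal_mult)
  finally show ?thesis by simp
qed

text \<open>Polar coordinates without a surface measure: a layer-cake decomposition of the exponential in the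
  squared radius reduces the identity to the scaling of balls.\<close>

lemma cpm_polar:
  fixes f g :: "(nat \<Rightarrow> complex) \<Rightarrow> real"
  assumes [measurable]: "f \<in> borel_measurable (cpm d)" "g \<in> borel_measurable (cpm d)"
    and f: "\<And>c. 0 \<le> f c" and g: "\<And>c. c \<in> space (cpm d) \<Longrightarrow> 0 < g c"
    and f_inv: "\<And>s c. s > 0 \<Longrightarrow> f (cscale d s c) = f c"
    and g_inv: "\<And>s c. s > 0 \<Longrightarrow> g (cscale d s c) = g c"
  shows "(\<integral>\<^sup>+c. ennreal (f c * exp (- g c * cnormsq d c)) \<partial>cpm d)
       = (\<integral>\<^sup>+c. ennreal (fact d * f c / g c ^ d) * indicator (coord_ball d) c \<partial>cpm d)"
proof -
  have n0: "0 \<le> cnormsq d c" for c by (simp add: cnormsq_def sum_nonneg)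
  define h where "h c r = ennreal (f c * (g c * exp (- g c * r)))" for c r
  have [measurable]: "(\<lambda>(c, r). h c r) \<in> borel_measurable (cpm d \<Otimes>\<^sub>M lborel)"
    unfolding h_def by measurable
  have "(\<integral>\<^sup>+c. ennreal (f c * exp (- g c * cnormsq d c)) \<partial>cpm d)
      = (\<integral>\<^sup>+c. (\<integral>\<^sup>+r. h c r * indicator {cnormsq d c..} r \<partial>lborel) \<partial>cpm d)"
  proof (rule nn_integral_cong)
    fix c assume c: "c \<in> space (cpm d)"
    have "(\<integral>\<^sup>+r. h c r * indicator {cnormsq d c..} r \<partial>lborel)
        = (\<integral>\<^sup>+r. ennreal (f c) * (ennreal (g c * exp (- g c * r)) * indicator {cnormsq d c..} r) \<partial>lborel)"
      using f[of c] g[OF c] by (simp add: h_def ennreal_mult mult_ac)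
    also have "\<dots> = ennreal (f c) * (\<integral>\<^sup>+r. ennreal (g c * exp (- g c * r)) * indicator {cnormsq d c..} r \<partial>lborel)"
      by (rule nn_integral_cmult) measurable
    also have "\<dots> = ennreal (f c * exp (- g c * cnormsq d c))"
      by (subst nn_integral_exp_tail[OF g[OF c]]) (simp add: ennreal_mult f)
    finally show "ennreal (f c * exp (- g c * cnormsq d c)) = (\<integral>\<^sup>+r. h c r * indicator {cnormsq d c..} r \<partial>lborel)" ..
  qed
  also have "\<dots> = (\<integral>\<^sup>+c. (\<integral>\<^sup>+r. h c r * (if cnormsq d c \<le> r then 1 else 0) \<partial>lborel) \<partial>cpm d)"
    by (intro nn_integral_cong) (auto simp: indicator_def)
  also have "\<dots> = (\<integral>\<^sup>+r. (\<integral>\<^sup>+c. h c r * (if cnormsq d c \<le> r then 1 else 0) \<partial>cpm d) \<partial>lborel)"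
  proof -
    interpret pair_sigma_finite "cpm d" "lborel :: real measure"
      by (intro pair_sigma_finite.intro sigma_finite_cpm lborel.sigma_finite_measure_axioms)
    show ?thesis
      by (rule Fubini'[symmetric]) measurable
  qed
  \<comment> \<open>Scaling by sqrt r maps the unit ball to the ball of squared radius r with
    Jacobian (sqrt r)^(2d) = r^d. As f and g are constant along rays, nothing else changes. The
    value r = 0, where scaling is not invertible, is a null set.\<close>
  also have "\<dots> = (\<integral>\<^sup>+r. (\<integral>\<^sup>+c. ennreal (r ^ d) * indicator {0..} r * h c r * indicator (coord_ball d) c \<partial>cpm d) \<partial>lborel)"
  proof (rule nn_integral_cong_AE, use AE_lborel_singleton[of 0] in eventually_elim)
    fix r :: real assume r0: "r \<noteq> 0"
    show "(\<integral>\<^sup>+c. h c r * (if cnormsq d c \<le> r then 1 else 0) \<partial>cpm d)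
        = (\<integral>\<^sup>+c. ennreal (r ^ d) * indicator {0..} r * h c r * indicator (coord_ball d) c \<partial>cpm d)"
    proof (cases "r > 0")
      case True
      have "(\<integral>\<^sup>+c. h c r * (if cnormsq d c \<le> r then 1 else 0) \<partial>cpm d)
          = ennreal (sqrt r ^ (2 * d)) * (\<integral>\<^sup>+c. h (cscale d (sqrt r) c) r *
              (if cnormsq d (cscale d (sqrt r) c) \<le> r then 1 else 0) \<partial>cpm d)"
        using True by (intro cpm_nn_integral_scale) auto
      also have "\<dots> = ennreal (r ^ d) * (\<integral>\<^sup>+c. h c r * indicator (coord_ball d) c \<partial>cpm d)"
        using True by (auto simp: power_mult h_def f_inv g_inv cnormsq_cscale coord_ball_eq indicator_def
            intro!: arg_cong2[where f="(*)"] nn_integral_cong)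
      also have "\<dots> = (\<integral>\<^sup>+c. ennreal (r ^ d) * indicator {0..} r * h c r * indicator (coord_ball d) c \<partial>cpm d)"
        using True by (subst nn_integral_cmult[symmetric]) (auto simp: mult_ac)
      finally show ?thesis .
    next
      case False
      then have "r < 0" using r0 by simp
      then have "\<not> cnormsq d c \<le> r" for c using n0[of c] by linarith
      then show ?thesis using \<open>r < 0\<close> by simp
    qed
  qed
  also have "\<dots> = (\<integral>\<^sup>+c. (\<integral>\<^sup>+r. ennreal (r ^ d) * indicator {0..} r * h c r * indicator (coord_ball d) c \<partial>lborel) \<partial>cpm d)"
  proof -
    interpret pair_sigma_finite "cpm d" "lborel :: real measure"
      by (intro pair_sigma_finite.intro sigma_finite_cpm lborel.sigma_finite_measure_axioms)
    show ?thesis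
      by (rule Fubini') measurable
  qed
  also have "\<dots> = (\<integral>\<^sup>+c. ennreal (fact d * f c / g c ^ d) * indicator (coord_ball d) c \<partial>cpm d)"
  proof (rule nn_integral_cong)
    fix c assume c: "c \<in> space (cpm d)"
    have "(\<integral>\<^sup>+r. ennreal (r ^ d) * indicator {0..} r * h c r * indicator (coord_ball d) c \<partial>lborel)
        = (\<integral>\<^sup>+r. (ennreal (f c * g c) * indicator (coord_ball d) c) *
            (ennreal (r ^ d * exp (- g c * r)) * indicator {0..} r) \<partial>lborel)"
      using f[of c] g[OF c] by (intro nn_integral_cong) (auto simp: h_def indicator_def ennreal_mult mult_ac)
    also have "\<dots> = (ennreal (f c * g c) * indicator (coord_ball d) c) * ennreal (fact d / g c ^ Suc d)"
      by (subst nn_integral_cmult) (auto simp only: nn_integral_power_exp[OF g[OF c]], measurable)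
    also have "\<dots> = ennreal (fact d * f c / g c ^ d) * indicator (coord_ball d) c"
      using f[of c] g[OF c] by (auto simp: indicator_def field_simps simp flip: ennreal_mult)
    finally show "(\<integral>\<^sup>+r. ennreal (r ^ d) * indicator {0..} r * h c r * indicator (coord_ball d) c \<partial>lborel)
        = ennreal (fact d * f c / g c ^ d) * indicator (coord_ball d) c" .
  qed
  finally show ?thesis .
qed

section \<open>The uniform measure on the sphere of a macro space\<close>

lemma continuous_on_cinner [continuous_intros]:
  assumes "continuous_on S f" "continuous_on S g"
  shows "continuous_on S (\<lambda>x. cinner (f x) (g x))"
  unfolding cinner_def using assms by (intro continuous_intros)

lemma continuous_on_vector_scale [continuous_intros]:
  assumes "continuous_on S f"
  shows "continuous_on S (\<lambda>x. f x *s (v :: complex^'n::finite))"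
  unfolding vector_scalar_mult_def using assms by (intro continuous_intros)

lemma range_space_subspace: "vec.subspace (range_space P)"
  by (auto simp: range_space_def vec.subspace_def matrix_vector_right_distrib matrix_scale)

lemma onb_iff: "onb P b \<longleftrightarrow> orthonormal (cdim P) b \<and> (\<forall>k<cdim P. b k \<in> range_space P)"
  by (auto simp: onb_def orthonormal_def)

lemma onb_exists:
  assumes "orth_proj P" shows "\<exists>b. onb P b"
proof -
  have sa: "self_adjoint P" using assms by (simp add: orth_proj_def)
  have inv: "P *v x \<in> range_space P" if "x \<in> range_space P" for x
    using that by (simp add: range_space_def)
  obtain v lam where "orthonormal (cdim P) v" "\<And>k. k < cdim P \<Longrightarrow> v k \<in> range_space P"
    "\<And>k. k < cdim P \<Longrightarrow> P *v v k = complex_of_real (lam k) *s v k"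
    by (rule self_adjoint_spectral[OF sa range_space_subspace inv, folded cdim_def]) (assumption, rule that)
  then show ?thesis using onb_iff by blast
qed

lemma onb_expand:
  assumes "onb P b" "x \<in> range_space P"
  shows "x = (\<Sum>k<cdim P. cinner (b k) x *s b k)"
  using assms orthonormal_span_dim[of "range_space P" b] range_space_subspace[of P]
  by (intro orthonormal_span_expand) (auto simp: onb_iff cdim_def)

lemma onb_parseval:
  assumes "onb P b" "x \<in> range_space P"
  shows "(norm x)\<^sup>2 = (\<Sum>k<cdim P. (cmod (cinner (b k) x))\<^sup>2)"
  using orthonormal_norm_sum[of "cdim P" b "\<lambda>k. cinner (b k) x"] onb_expand[OF assms] assms(1)
  by (simp add: onb_iff)

lemma onb_sum_in_range:
  assumes "onb P b" shows "(\<Sum>k<cdim P. c k *s b k) \<in> range_space P"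
  using assms by (intro vec.subspace_sum[OF range_space_subspace] vec.subspace_scale[OF range_space_subspace])
    (auto simp: onb_def)

lemma cdim_pos:
  assumes "range_space P \<noteq> {0}" shows "cdim P > 0"
proof (rule ccontr)
  assume "\<not> cdim P > 0"
  then have "range_space P \<subseteq> {0}" by (simp add: cdim_def vec.dim_eq_0)
  then show False using assms vec.subspace_0[OF range_space_subspace[of P]] by auto
qed

text \<open>The radial projection inside \<open>sphere_measure\<close>. At the origin the convention
  1 / 0 = 0 makes its value the zero vector, not a unit vector.\<close>

definition dirvec :: "nat \<Rightarrow> (nat \<Rightarrow> complex^'n::finite) \<Rightarrow> (nat \<Rightarrow> complex) \<Rightarrow> complex^'n" where
  "dirvec d b c = (1 / norm (\<Sum>k<d. c k *s b k)) *\<^sub>R (\<Sum>k<d. c k *s b k)"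

lemma dirvec_measurable [measurable]: "dirvec d b \<in> borel_measurable (cpm d)"
proof -
  have "(\<lambda>c. c k *s b k) \<in> borel_measurable (cpm d)" if "k \<in> {..<d}" for k
    using that by (intro measurable_compose[OF cpm_component] borel_measurable_continuous_onI continuous_intros) auto
  then have [measurable]: "(\<lambda>c. \<Sum>k<d. c k *s b k) \<in> borel_measurable (cpm d)"
    by (rule borel_measurable_sum)
  show ?thesis unfolding dirvec_def by measurable
qed

lemma dirvec_cscale: "s > 0 \<Longrightarrow> dirvec d b (cscale d s c) = dirvec d b c"
proof -
  assume s: "s > 0"
  have "(\<Sum>k<d. cscale d s c k *s b k) = s *\<^sub>R (\<Sum>k<d. c k *s b k)"
    by (simp add: cscale_def scaleR_eq_scale vec.scale_sum_right scaleR_conv_of_real[where 'a=complex])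
  then show ?thesis using s by (simp add: dirvec_def)
qed

lemma sphere_measure_eq:
  "sphere_measure P = distr (uniform_measure (cpm (cdim P)) (coord_ball (cdim P))) borel
     (dirvec (cdim P) (SOME b. onb P b))"
  unfolding sphere_measure_def Let_def dirvec_def ..

text \<open>\<open>cpm_polar\<close> with f = g = 1: the Gaussian integral pi^d equals d! times the
  volume.\<close>

lemma emeasure_coord_ball: "emeasure (cpm d) (coord_ball d) = ennreal (pi ^ d / fact d)"
proof -
  have "ennreal (pi ^ d) = (\<integral>\<^sup>+c. ennreal (exp (\<Sum>k<d. - 1 * (cmod (c k))\<^sup>2 + 2 * Re (cnj 0 * c k))) \<partial>cpm d)"
    by (subst cpm_gaussian_nn_integral) auto
  also have "\<dots> = (\<integral>\<^sup>+c. ennreal (1 * exp (- 1 * cnormsq d c)) \<partial>cpm d)"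
    by (simp add: cnormsq_def sum_negf)
  also have "\<dots> = (\<integral>\<^sup>+c. ennreal (fact d * 1 / 1 ^ d) * indicator (coord_ball d) c \<partial>cpm d)"
    by (rule cpm_polar) auto
  also have "\<dots> = ennreal (fact d) * emeasure (cpm d) (coord_ball d)"
    by (simp add: nn_integral_cmult)
  finally have eq: "ennreal (pi ^ d) = ennreal (fact d) * emeasure (cpm d) (coord_ball d)" .
  have "ennreal (pi ^ d / fact d) = ennreal (1 / fact d) * ennreal (pi ^ d)"
    by (simp flip: ennreal_mult)
  also have "\<dots> = (ennreal (1 / fact d) * ennreal (fact d)) * emeasure (cpm d) (coord_ball d)"
    by (simp only: eq mult.assoc)
  also have "ennreal (1 / fact d) * ennreal (fact d) = 1"
    by (simp flip: ennreal_mult)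
  finally show ?thesis by simp
qed

lemma prob_space_sphere_measure: "prob_space (sphere_measure P)"
proof -
  have "prob_space (uniform_measure (cpm (cdim P)) (coord_ball (cdim P)))"
    by (rule prob_space_uniform_measure) (auto simp: emeasure_coord_ball)
  then show ?thesis unfolding sphere_measure_eq
    by (rule prob_space.prob_space_distr) simp
qed

lemma sets_sphere_measure [measurable_cong, simp]: "sets (sphere_measure P) = sets borel"
  by (simp add: sphere_measure_eq)

lemma space_sphere_measure [simp]: "space (sphere_measure P) = UNIV"
  by (simp add: sphere_measure_eq)

text \<open>Only coordinates with zero sum vector are sent off the sphere. They lie in the
  hyperplane c 0 = 0, which is null; that there is a coordinate 0 at all is the nontriviality of the
  macro space.\<close>

lemma AE_sphere_measure:
  assumes P: "orth_proj P" "range_space P \<noteq> {0}"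
  shows "AE \<psi> in sphere_measure P. \<psi> \<in> range_space P \<and> norm \<psi> = 1"
proof -
  let ?d = "cdim P"
  define b where "b = (SOME b. onb P b)"
  have b: "onb P b" unfolding b_def using onb_exists[OF P(1)] by (rule someI_ex)
  have d: "0 < ?d" by (rule cdim_pos[OF P(2)])
  have "{\<psi>. P *v \<psi> = \<psi> \<and> norm \<psi> = 1} \<in> sets borel"
    by (intro borel_closed closed_Collect_conj closed_Collect_eq continuous_intros)
  then have S: "{\<psi> \<in> space borel. \<psi> \<in> range_space P \<and> norm \<psi> = 1} \<in> sets borel"
    by (simp add: range_space_def)
  \<comment> \<open>The hyperplane is written as a box: one side has measure 0, so the product is 0
    although the other sides have infinite measure.\<close>
  define A where "A k = (if k = 0 then {0} else UNIV :: complex set)" for k :: nat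
  have "{c \<in> space (cpm ?d). c 0 = 0} = Pi\<^sub>E {..<?d} A"
    using d by (auto simp: space_PiM PiE_def Pi_def A_def extensional_def)
  moreover have "emeasure (cpm ?d) (Pi\<^sub>E {..<?d} A) = (\<Prod>k<?d. emeasure lborel (A k))"
    by (rule cpm.emeasure_PiM) (auto simp: A_def)
  moreover have "(\<Prod>k<?d. emeasure lborel (A k)) = 0"
    using d by (auto simp: A_def intro!: bexI[of _ 0])
  ultimately have "AE c in cpm ?d. c 0 \<noteq> 0"
    by (intro AE_I[of _ _ "Pi\<^sub>E {..<?d} A"]) (auto simp: A_def intro!: sets_PiM_I_finite)
  moreover have "dirvec ?d b c \<in> range_space P \<and> norm (dirvec ?d b c) = 1" if "c 0 \<noteq> 0" for c
  proof -
    define x where "x = (\<Sum>k<?d. c k *s b k)"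
    have "cinner (b 0) x = c 0"
      unfolding x_def using orthonormal_cinner_sum[of ?d b 0 c] b d by (auto simp: onb_iff)
    then have "x \<noteq> 0" using that by auto
    moreover have "x \<in> range_space P" unfolding x_def by (rule onb_sum_in_range[OF b])
    moreover have "dirvec ?d b c = complex_of_real (1 / norm x) *s x"
      by (simp only: dirvec_def x_def[symmetric] scaleR_eq_scale)
    ultimately have "dirvec ?d b c \<in> range_space P" and "x \<noteq> 0"
      by (simp_all only: vec.subspace_scale[OF range_space_subspace[of P]] not_False_eq_True)
    then show ?thesis by (simp add: dirvec_def x_def[symmetric])
  qed
  ultimately have "AE c in cpm ?d. dirvec ?d b c \<in> range_space P \<and> norm (dirvec ?d b c) = 1"
    by (auto elim: eventually_mono)
  then have "AE c in uniform_measure (cpm ?d) (coord_ball ?d). dirvec ?d b c \<in> range_space P \<and> norm (dirvec ?d b c) = 1"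
    by (intro AE_uniform_measureI) auto
  then show ?thesis unfolding sphere_measure_eq b_def[symmetric]
    using S by (subst AE_distr_iff) auto
qed

text \<open>\<open>cpm_polar\<close> with f = 1 and g = K along directions, read from right to left.
  The d! it produces cancels against the ball volume pi^d / d!. Positivity is required at every
  value of \<open>dirvec\<close>, hence also at the zero vector.\<close>

lemma sphere_measure_nn_integral:
  fixes K :: "complex^'n::finite \<Rightarrow> real"
  assumes [measurable]: "K \<in> borel_measurable borel"
    and K: "\<And>c. 0 < K (dirvec (cdim P) (SOME b. onb P b) c)"
  shows "(\<integral>\<^sup>+\<psi>. ennreal (1 / K \<psi> ^ cdim P) \<partial>sphere_measure P)
       = ennreal (1 / pi ^ cdim P) * (\<integral>\<^sup>+c. ennreal (exp (- K (dirvec (cdim P) (SOME b. onb P b) c) * cnormsq (cdim P) c)) \<partial>cpm (cdim P))"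
proof -
  let ?d = "cdim P"
  let ?g = "\<lambda>c. K (dirvec (cdim P) (SOME b. onb P b) c)"
  define J where "J = (\<integral>\<^sup>+c. ennreal (1 / ?g c ^ ?d) * indicator (coord_ball ?d) c \<partial>cpm ?d)"
  have "(\<integral>\<^sup>+c. ennreal (1 * exp (- ?g c * cnormsq ?d c)) \<partial>cpm ?d)
      = (\<integral>\<^sup>+c. ennreal (fact ?d * 1 / ?g c ^ ?d) * indicator (coord_ball ?d) c \<partial>cpm ?d)"
    by (rule cpm_polar) (auto simp: K dirvec_cscale)
  also have "\<dots> = (\<integral>\<^sup>+c. ennreal (fact ?d) * (ennreal (1 / ?g c ^ ?d) * indicator (coord_ball ?d) c) \<partial>cpm ?d)"
    using K by (intro nn_integral_cong) (auto simp: indicator_def less_imp_le simp flip: ennreal_mult)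
  also have "\<dots> = ennreal (fact ?d) * J"
    unfolding J_def by (rule nn_integral_cmult) measurable
  finally have 1: "(\<integral>\<^sup>+c. ennreal (exp (- ?g c * cnormsq ?d c)) \<partial>cpm ?d) = ennreal (fact ?d) * J" by simp
  have "(\<integral>\<^sup>+\<psi>. ennreal (1 / K \<psi> ^ ?d) \<partial>sphere_measure P) = J / ennreal (pi ^ ?d / fact ?d)"
    unfolding sphere_measure_eq J_def
    by (subst nn_integral_distr) (auto simp: nn_integral_uniform_measure emeasure_coord_ball)
  also have "\<dots> = ennreal (fact ?d / pi ^ ?d) * J"
    by (simp add: divide_ennreal_def inverse_ennreal mult.commute field_simps)
  also have "ennreal (fact ?d / pi ^ ?d) = ennreal (1 / pi ^ ?d) * ennreal (fact ?d)"
    by (simp flip: ennreal_mult)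
  finally show ?thesis by (simp only: 1 mult.assoc)
qed

text \<open>Multiplied by the squared radius, K becomes the quadratic form with eigenvalues 1 - x j,
  so the Gaussian integral applies. The basis \<open>b\<close> chosen inside
  \<open>sphere_measure\<close> and the eigenbasis \<open>v\<close> are related by the unitary
  matrix \<open>u\<close>; Parseval's identity in \<open>v\<close> and expansion in \<open>b\<close>
  supply the two unitarity conditions.\<close>

lemma sphere_measure_quadratic:
  fixes P :: "'n::finite cmat" and x :: "nat \<Rightarrow> real"
  assumes P: "orth_proj P" and v: "onb P v" and x: "\<And>j. j < cdim P \<Longrightarrow> x j < 1"
  shows "(\<integral>\<^sup>+\<psi>. ennreal (1 / (1 - (\<Sum>j<cdim P. x j * (cmod (cinner (v j) \<psi>))\<^sup>2)) ^ cdim P) \<partial>sphere_measure P)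
       = ennreal (\<Prod>j<cdim P. 1 / (1 - x j))"
proof -
  define d where "d = cdim P"
  define b where "b = (SOME b. onb P b)"
  have b: "onb P b" unfolding b_def using onb_exists[OF P] by (rule someI_ex)
  define K where "K \<psi> = 1 - (\<Sum>j<d. x j * (cmod (cinner (v j) \<psi>))\<^sup>2)" for \<psi>
  define y where "y c = (\<Sum>k<d. c k *s b k)" for c
  define u where "u j l = cinner (v j) (b l)" for j l
  have ny: "(norm (y c))\<^sup>2 = cnormsq d c" for c
    using orthonormal_norm_sum[of d b c] b by (simp add: y_def cnormsq_def onb_iff d_def)
  have yR: "y c \<in> range_space P" for c unfolding y_def d_def by (rule onb_sum_in_range[OF b])
  have vy: "cinner (v j) (y c) = (\<Sum>l<d. u j l * c l)" for j c
    by (simp add: y_def u_def cinner_sum_right cinner_scale_right mult.commute)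
  have pars: "(\<Sum>j<d. (cmod (cinner (v j) (y c)))\<^sup>2) = cnormsq d c" for c
    using onb_parseval[OF v yR] ny by (simp add: d_def)
  have dv: "(cmod (cinner (v j) (dirvec d b c)))\<^sup>2 = (cmod (cinner (v j) (y c)))\<^sup>2 / cnormsq d c" for j c
    unfolding dirvec_def y_def[symmetric]
    by (simp add: scaleR_eq_scale cinner_scale_right norm_mult norm_divide power_mult_distrib power_divide ny)
  have quad: "K (dirvec d b c) * cnormsq d c = (\<Sum>j<d. (1 - x j) * (cmod (cinner (v j) (y c)))\<^sup>2)" for c
  proof (cases "cnormsq d c = 0")
    case True
    then have "(cmod (cinner (v j) (y c)))\<^sup>2 = 0" if "j < d" for j
      using pars[of c] that by (simp add: sum_nonneg_eq_0_iff)
    then show ?thesis using True by simp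
  next
    case False
    then have "K (dirvec d b c) * cnormsq d c = cnormsq d c - (\<Sum>j<d. x j * (cmod (cinner (v j) (y c)))\<^sup>2)"
      by (simp add: K_def dv left_diff_distrib sum_distrib_right)
    then show ?thesis using pars[of c] by (simp add: left_diff_distrib sum_subtractf)
  qed
  \<comment> \<open>At the origin \<open>dirvec\<close> vanishes and K = 1. Elsewhere a sum of
    nonnegative terms that vanished would force every coordinate, hence the radius, to be 0.\<close>
  have Kpos: "0 < K (dirvec d b c)" for c
  proof (cases "cnormsq d c = 0")
    case True
    then show ?thesis by (simp add: K_def dv)
  next
    case False
    then have n: "cnormsq d c > 0" using ny[of c] by (metis zero_le_power2 less_le)
    have nn: "0 \<le> (1 - x j) * (cmod (cinner (v j) (y c)))\<^sup>2" if "j \<in> {..<d}" for j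
      using x that by (auto simp: d_def less_imp_le)
    have "(\<Sum>j<d. (1 - x j) * (cmod (cinner (v j) (y c)))\<^sup>2) \<noteq> 0"
    proof
      assume "(\<Sum>j<d. (1 - x j) * (cmod (cinner (v j) (y c)))\<^sup>2) = 0"
      then have *: "\<forall>j\<in>{..<d}. (1 - x j) * (cmod (cinner (v j) (y c)))\<^sup>2 = 0"
        using nn by (subst (asm) sum_nonneg_eq_0_iff) auto
      then have "(cmod (cinner (v j) (y c)))\<^sup>2 = 0" if "j < d" for j
      proof -
        have "(1 - x j) * (cmod (cinner (v j) (y c)))\<^sup>2 = 0" using * that by blast
        moreover have "x j < 1" using x that by (simp add: d_def)
        ultimately show ?thesis by (metis diff_gt_0_iff_gt less_irrefl mult_eq_0_iff)
      qed
      then have "cnormsq d c = 0" unfolding pars[of c, symmetric] by simp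
      then show False using False by simp
    qed
    moreover have "(\<Sum>j<d. (1 - x j) * (cmod (cinner (v j) (y c)))\<^sup>2) \<ge> 0" using nn by (rule sum_nonneg)
    ultimately have "0 < K (dirvec d b c) * cnormsq d c" unfolding quad by linarith
    then show ?thesis using n by (simp add: zero_less_mult_iff)
  qed
  have rows: "(\<Sum>l<d. u i l * cnj (u j l)) = (if i = j then 1 else 0)" if "i < d" "j < d" for i j
  proof -
    have vj: "v j \<in> range_space P" using v that by (simp add: onb_def d_def)
    have "(if i = j then 1 else 0) = cinner (v i) (v j)" using v that by (simp add: onb_def d_def)
    also have "\<dots> = cinner (v i) (\<Sum>l<d. cinner (b l) (v j) *s b l)"
      using onb_expand[OF b vj] by (simp add: d_def)
    also have "\<dots> = (\<Sum>l<d. u i l * cnj (u j l))"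
      by (simp add: u_def cinner_sum_right cinner_scale_right mult.commute cnj_cinner)
    finally show ?thesis ..
  qed
  have [measurable]: "K \<in> borel_measurable borel"
    unfolding K_def by (intro borel_measurable_continuous_onI continuous_intros)
  have "(\<integral>\<^sup>+\<psi>. ennreal (1 / K \<psi> ^ cdim P) \<partial>sphere_measure P)
      = ennreal (1 / pi ^ d) * (\<integral>\<^sup>+c. ennreal (exp (- K (dirvec d b c) * cnormsq d c)) \<partial>cpm d)"
    unfolding d_def b_def by (rule sphere_measure_nn_integral) (use Kpos in \<open>auto simp: d_def b_def\<close>)
  also have "(\<integral>\<^sup>+c. ennreal (exp (- K (dirvec d b c) * cnormsq d c)) \<partial>cpm d)
      = (\<integral>\<^sup>+c. ennreal (exp (- (\<Sum>j<d. (1 - x j) * (cmod (\<Sum>l<d. u j l * c l))\<^sup>2))) \<partial>cpm d)"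
    by (simp only: mult_minus_left quad vy)
  also have "\<dots> = ennreal (pi ^ d / (\<Prod>j<d. 1 - x j))"
  proof (rule cpm_quadratic_nn_integral)
    show "(\<Sum>j<d. (cmod (\<Sum>l<d. u j l * c l))\<^sup>2) = (\<Sum>l<d. (cmod (c l))\<^sup>2)" for c
      using pars[of c] by (simp add: vy cnormsq_def)
  qed (use x rows in \<open>auto simp: d_def\<close>)
  also have "ennreal (1 / pi ^ d) * ennreal (pi ^ d / (\<Prod>j<d. 1 - x j)) = ennreal (\<Prod>j<d. 1 / (1 - x j))"
    using x by (subst ennreal_mult[symmetric]) (auto simp: prod_dividef d_def intro!: less_imp_le divide_pos_pos prod_pos)
  finally show ?thesis by (simp add: K_def d_def)
qed

section \<open>Moment and tail bounds for diagonal quadratic forms\<close>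

text \<open>The right-hand sides are twice the even and the odd part of (1-x)^(-d), whose power
  series has nonnegative coefficients; the left-hand sides are the leading terms. With a = 1/(1-x)
  and b = 1/(1+x) one has a = 1 + x a and b = 1 - x b, so each induction step for the sum uses the
  difference and vice versa; this is why both claims are proved together. The base estimate a^n +
  b^n \<ge> 2 follows from a b \<ge> 1.\<close>

lemma inverse_powers_ge_nonneg:
  fixes x :: real
  assumes x: "0 \<le> x" "x < 1"
  shows "2 + real d * (real d + 1) * x\<^sup>2 \<le> (1 / (1 - x)) ^ d + (1 / (1 + x)) ^ d
       \<and> 2 * real d * x \<le> (1 / (1 - x)) ^ d - (1 / (1 + x)) ^ d"
proof (induction d)
  case (Suc d)
  define a b where "a = 1 / (1 - x)" and "b = 1 / (1 + x)"
  have ab: "a > 0" "b > 0" "a = 1 + x * a" "b = 1 - x * b"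
    using x by (auto simp: a_def b_def field_simps)
  have "x * x < 1" using x mult_strict_mono[of x 1 x 1] by (cases "x = 0") auto
  then have "1 \<le> 1 / (1 - x * x)" by simp
  also have "1 / (1 - x * x) = a * b" by (simp add: a_def b_def algebra_simps)
  finally have "1 \<le> a * b" .
  then have "1 \<le> a ^ Suc d * b ^ Suc d" unfolding power_mult_distrib[symmetric] by (rule one_le_power)
  moreover have "0 \<le> (a ^ Suc d - b ^ Suc d)\<^sup>2" by simp
  ultimately have "2\<^sup>2 \<le> (a ^ Suc d + b ^ Suc d)\<^sup>2"
    by (simp add: power2_diff power2_sum)
  moreover have "0 \<le> a ^ Suc d + b ^ Suc d"
    by (intro add_nonneg_nonneg zero_le_power less_imp_le ab(1,2))
  ultimately have S2: "2 \<le> a ^ Suc d + b ^ Suc d"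
    by (rule power2_le_imp_le)
  have ea: "a ^ Suc d = a ^ d + x * a ^ Suc d" and eb: "b ^ Suc d = b ^ d - x * b ^ Suc d"
  proof -
    have "(1 + x * a) * a ^ d = a ^ d + x * a ^ Suc d" "(1 - x * b) * b ^ d = b ^ d - x * b ^ Suc d"
      by (simp_all add: algebra_simps)
    then show "a ^ Suc d = a ^ d + x * a ^ Suc d" "b ^ Suc d = b ^ d - x * b ^ Suc d"
      unfolding ab(3,4)[symmetric] by simp_all
  qed
  have IH: "2 + real d * (real d + 1) * x\<^sup>2 \<le> a ^ d + b ^ d" "2 * real d * x \<le> a ^ d - b ^ d"
    using Suc.IH by (auto simp: a_def b_def)
  have "a ^ Suc d - b ^ Suc d = a ^ d - b ^ d + x * (a ^ Suc d + b ^ Suc d)"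
    unfolding distrib_left using ea eb by linarith
  moreover have "x * 2 \<le> x * (a ^ Suc d + b ^ Suc d)" using S2 x by (intro mult_left_mono) auto
  ultimately have D: "2 * real (Suc d) * x \<le> a ^ Suc d - b ^ Suc d" using IH(2) by (simp add: algebra_simps)
  have "a ^ Suc d + b ^ Suc d = a ^ d + b ^ d + x * (a ^ Suc d - b ^ Suc d)"
    unfolding right_diff_distrib using ea eb by linarith
  moreover have "x * (2 * real (Suc d) * x) \<le> x * (a ^ Suc d - b ^ Suc d)"
    using D x by (intro mult_left_mono) auto
  ultimately have "2 + real d * (real d + 1) * x\<^sup>2 + x * (2 * real (Suc d) * x) \<le> a ^ Suc d + b ^ Suc d"
    using IH(1) by linarith
  moreover have "2 + real d * (real d + 1) * x\<^sup>2 + x * (2 * real (Suc d) * x)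
      = 2 + real (Suc d) * (real (Suc d) + 1) * x\<^sup>2"
    by (simp add: algebra_simps power2_eq_square)
  ultimately show ?case using D by (simp add: a_def b_def)
qed simp

lemma inverse_powers_ge:
  fixes x :: real
  assumes "\<bar>x\<bar> < 1"
  shows "2 + real d * (real d + 1) * x\<^sup>2 \<le> (1 / (1 - x)) ^ d + (1 / (1 + x)) ^ d"
  using inverse_powers_ge_nonneg[of x d] inverse_powers_ge_nonneg[of "- x" d] assms
  by (cases "0 \<le> x") auto

text \<open>The coefficient 1/2 of x^2 is the exact one of -ln(1-x): it survives the limit of small
  parameters in the variance bound, whereas the cubic term disappears there. Both signs are settled
  by monotonicity of the difference of logarithms.\<close>

lemma inverse_one_minus_le_exp:
  fixes x :: real
  assumes "\<bar>x\<bar> \<le> 1 / 2"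
  shows "1 / (1 - x) \<le> exp (x + x\<^sup>2 / 2 + \<bar>x\<bar> ^ 3)"
proof -
  have "0 \<le> x + x\<^sup>2 / 2 + \<bar>x\<bar> ^ 3 + ln (1 - x)"
  proof (cases "0 \<le> x")
    case True
    let ?g = "\<lambda>x::real. x + x\<^sup>2 / 2 + x ^ 3 + ln (1 - x)"
    have "?g 0 \<le> ?g x"
    proof (rule DERIV_nonneg_imp_nondecreasing[of 0 x ?g, OF True])
      fix y assume y: "0 \<le> y" "y \<le> x"
      then have y1: "y \<le> 1 / 2" using assms by linarith
      have "(?g has_real_derivative (1 + y + 3 * y\<^sup>2 - 1 / (1 - y))) (at y)"
        using y1 by (auto intro!: derivative_eq_intros simp: field_simps)
      moreover have "1 + y + 3 * y\<^sup>2 - 1 / (1 - y) = y\<^sup>2 * (2 - 3 * y) / (1 - y)"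
        using y1 by (simp add: field_simps power2_eq_square)
      moreover have "0 \<le> y\<^sup>2 * (2 - 3 * y) / (1 - y)" using y1 by simp
      ultimately show "\<exists>d. (?g has_real_derivative d) (at y) \<and> 0 \<le> d" by (intro exI conjI) simp_all
    qed
    then show ?thesis using True by simp
  next
    case False
    let ?g = "\<lambda>x::real. - x + x\<^sup>2 / 2 + x ^ 3 + ln (1 + x)"
    have "?g 0 \<le> ?g (- x)"
    proof (rule DERIV_nonneg_imp_nondecreasing[of 0 "- x" ?g])
      fix y assume y: "0 \<le> y" "y \<le> - x"
      have "(?g has_real_derivative (- 1 + y + 3 * y\<^sup>2 + 1 / (1 + y))) (at y)"
        using y by (auto intro!: derivative_eq_intros simp: field_simps)
      moreover have "- 1 + y + 3 * y\<^sup>2 + 1 / (1 + y) = y\<^sup>2 * (4 + 3 * y) / (1 + y)"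
        using y by (simp add: field_simps power2_eq_square)
      moreover have "0 \<le> y\<^sup>2 * (4 + 3 * y) / (1 + y)" using y by simp
      ultimately show "\<exists>d. (?g has_real_derivative d) (at y) \<and> 0 \<le> d" by (intro exI conjI) simp_all
    qed (use False in simp)
    then show ?thesis using False by simp
  qed
  then have "- ln (1 - x) \<le> x + x\<^sup>2 / 2 + \<bar>x\<bar> ^ 3" by linarith
  then have "exp (- ln (1 - x)) \<le> exp (x + x\<^sup>2 / 2 + \<bar>x\<bar> ^ 3)" by simp
  moreover have "exp (- ln (1 - x)) = 1 / (1 - x)"
    using assms by (simp add: exp_minus inverse_eq_divide)
  ultimately show ?thesis by simp
qed

lemma inverse_one_minus_le_exp_square:
  fixes x :: real
  assumes "\<bar>x\<bar> \<le> 1 / 2"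
  shows "1 / (1 - x) \<le> exp (x + x\<^sup>2)"
proof -
  have "\<bar>x\<bar> * \<bar>x\<bar>\<^sup>2 \<le> 1 / 2 * \<bar>x\<bar>\<^sup>2" using assms by (intro mult_right_mono) auto
  then have "x + x\<^sup>2 / 2 + \<bar>x\<bar> ^ 3 \<le> x + x\<^sup>2" by (simp add: power3_eq_cube power2_eq_square)
  then have "exp (x + x\<^sup>2 / 2 + \<bar>x\<bar> ^ 3) \<le> exp (x + x\<^sup>2)" by simp
  then show ?thesis using inverse_one_minus_le_exp[OF assms] by linarith
qed

text \<open>For a unit vector the squared coordinates are weights with sum 1, so the form is an
  average of the \<open>a j\<close>.\<close>

lemma onb_quadratic_abs_le:
  assumes v: "onb P v" and n: "norm \<psi> = 1" "\<psi> \<in> range_space P" and a: "\<And>j. j < cdim P \<Longrightarrow> \<bar>a j\<bar> \<le> L"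
  shows "\<bar>\<Sum>j<cdim P. a j * (cmod (cinner (v j) \<psi>))\<^sup>2\<bar> \<le> L"
proof -
  have "\<bar>\<Sum>j<cdim P. a j * (cmod (cinner (v j) \<psi>))\<^sup>2\<bar> \<le> (\<Sum>j<cdim P. \<bar>a j * (cmod (cinner (v j) \<psi>))\<^sup>2\<bar>)"
    by (rule sum_abs)
  also have "\<dots> \<le> (\<Sum>j<cdim P. L * (cmod (cinner (v j) \<psi>))\<^sup>2)"
    using a by (intro sum_mono) (auto simp: abs_mult intro!: mult_right_mono)
  also have "\<dots> = L" using onb_parseval[OF v n(2)] n(1) by (simp flip: sum_distrib_left)
  finally show ?thesis .
qed

text \<open>The sum (1 - t q)^(-d) + (1 + t q)^(-d) lies pointwise above 2 + d(d+1) t^2 q^2, and its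
  mean lies below 2 exp(t^2 S2/2 + O(t^3)), with no term linear in t because the x j sum to 0.
  Subtracting 2, dividing by t^2 and letting t tend to 0 gives the claim.\<close>

lemma sphere_second_moment:
  fixes P :: "'n::finite cmat" and x :: "nat \<Rightarrow> real"
  assumes P: "orth_proj P" "range_space P \<noteq> {0}" and v: "onb P v" and x: "(\<Sum>j<cdim P. x j) = 0"
  shows "(\<integral>\<^sup>+\<psi>. ennreal ((\<Sum>j<cdim P. x j * (cmod (cinner (v j) \<psi>))\<^sup>2)\<^sup>2) \<partial>sphere_measure P)
       \<le> ennreal ((\<Sum>j<cdim P. (x j)\<^sup>2) / (real (cdim P) * (real (cdim P) + 1)))"
proof -
  let ?S = "sphere_measure P"
  interpret S: prob_space ?S by (rule prob_space_sphere_measure)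
  define d where "d = cdim P"
  have d: "d > 0" unfolding d_def by (rule cdim_pos[OF P(2)])
  define D where "D = real d * (real d + 1)"
  have D: "D > 0" using d by (simp add: D_def)
  define q where "q \<psi> = (\<Sum>j<d. x j * (cmod (cinner (v j) \<psi>))\<^sup>2)" for \<psi>
  have q_meas [measurable]: "q \<in> borel_measurable borel"
    unfolding q_def by (intro borel_measurable_continuous_onI continuous_intros)
  \<comment> \<open>A common bound for the |x j| that is also at least 1, so that t X \<le> 1/2
    controls every t x j and t itself.\<close>
  define X where "X = 1 + (\<Sum>j<d. \<bar>x j\<bar>)"
  have X: "X \<ge> 1" by (simp add: X_def sum_nonneg)
  have xX: "\<bar>x j\<bar> \<le> X" if "j < d" for j
    using member_le_sum[of j "{..<d}" "\<lambda>j. \<bar>x j\<bar>"] that by (auto simp: X_def)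
  define S2 where "S2 = (\<Sum>j<d. (x j)\<^sup>2)"
  define S3 where "S3 = (\<Sum>j<d. \<bar>x j\<bar> ^ 3)"
  have S23: "0 \<le> S2" "0 \<le> S3" by (auto simp: S2_def S3_def intro!: sum_nonneg)
  define I where "I = (\<integral>\<^sup>+\<psi>. ennreal ((q \<psi>)\<^sup>2) \<partial>?S)"
  have mgf: "(\<integral>\<^sup>+\<psi>. ennreal ((1 / (1 - t * q \<psi>)) ^ d) \<partial>?S) \<le> ennreal (exp (t\<^sup>2 * S2 / 2 + \<bar>t\<bar> ^ 3 * S3))"
    if t: "\<bar>t\<bar> * X \<le> 1 / 2" for t
  proof -
    have tx: "\<bar>t * x j\<bar> \<le> 1 / 2" if "j < d" for j
    proof -
      have "\<bar>t * x j\<bar> \<le> \<bar>t\<bar> * X" unfolding abs_mult by (intro mult_left_mono xX[OF that]) simp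
      then show ?thesis using t by linarith
    qed
    have "(\<integral>\<^sup>+\<psi>. ennreal ((1 / (1 - t * q \<psi>)) ^ d) \<partial>?S) = ennreal (\<Prod>j<d. 1 / (1 - t * x j))"
      using sphere_measure_quadratic[OF P(1) v, of "\<lambda>j. t * x j"] tx
      by (force simp: q_def d_def sum_distrib_left mult.assoc power_divide)
    also have "\<dots> \<le> ennreal (\<Prod>j<d. exp (t * x j + (t * x j)\<^sup>2 / 2 + \<bar>t * x j\<bar> ^ 3))"
      using tx by (intro ennreal_leI prod_mono) (force intro: inverse_one_minus_le_exp)
    also have "(\<Prod>j<d. exp (t * x j + (t * x j)\<^sup>2 / 2 + \<bar>t * x j\<bar> ^ 3))
        = exp (t * (\<Sum>j<d. x j) + t\<^sup>2 * S2 / 2 + \<bar>t\<bar> ^ 3 * S3)"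
      by (simp add: exp_sum[symmetric] sum.distrib S2_def S3_def power_mult_distrib abs_mult
          sum_distrib_left sum_divide_distrib)
    finally show ?thesis using x by (simp add: d_def)
  qed
  have main: "ennreal (D * t\<^sup>2) * I + 2 \<le> ennreal (2 * exp (t\<^sup>2 * S2 / 2 + \<bar>t\<bar> ^ 3 * S3))"
    if t: "0 < t" "t * X \<le> 1 / 2" for t
  proof -
    have "ennreal (D * t\<^sup>2) * I + 2 = (\<integral>\<^sup>+\<psi>. ennreal (D * t\<^sup>2) * ennreal ((q \<psi>)\<^sup>2) + 2 \<partial>?S)"
      by (simp add: nn_integral_add nn_integral_cmult I_def S.emeasure_space_1[simplified])
    also have "\<dots> \<le> (\<integral>\<^sup>+\<psi>. ennreal ((1 / (1 - t * q \<psi>)) ^ d) + ennreal ((1 / (1 - (- t) * q \<psi>)) ^ d) \<partial>?S)"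
    proof (rule nn_integral_mono_AE, use AE_sphere_measure[OF P] in eventually_elim)
      fix \<psi> assume \<psi>: "\<psi> \<in> range_space P \<and> norm \<psi> = 1"
      have "\<bar>q \<psi>\<bar> \<le> X" unfolding q_def d_def
        by (rule onb_quadratic_abs_le[OF v]) (use \<psi> xX in \<open>auto simp: d_def\<close>)
      then have "t * \<bar>q \<psi>\<bar> \<le> t * X" using t by (intro mult_left_mono) auto
      moreover have "\<bar>t * q \<psi>\<bar> = t * \<bar>q \<psi>\<bar>" using t by (simp add: abs_mult)
      ultimately have tq: "\<bar>t * q \<psi>\<bar> < 1" using t by linarith
      have "ennreal (D * t\<^sup>2) * ennreal ((q \<psi>)\<^sup>2) + 2 = ennreal (2 + real d * (real d + 1) * (t * q \<psi>)\<^sup>2)"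
        using D by (simp add: D_def power_mult_distrib mult_ac add.commute flip: ennreal_mult ennreal_plus ennreal_numeral)
      also have "\<dots> \<le> ennreal ((1 / (1 - t * q \<psi>)) ^ d + (1 / (1 + t * q \<psi>)) ^ d)"
        by (intro ennreal_leI inverse_powers_ge tq)
      also have "\<dots> = ennreal ((1 / (1 - t * q \<psi>)) ^ d) + ennreal ((1 / (1 - (- t) * q \<psi>)) ^ d)"
        using tq by (subst ennreal_plus) auto
      finally show "ennreal (D * t\<^sup>2) * ennreal ((q \<psi>)\<^sup>2) + 2
          \<le> ennreal ((1 / (1 - t * q \<psi>)) ^ d) + ennreal ((1 / (1 - (- t) * q \<psi>)) ^ d)" .
    qed
    also have "\<dots> = (\<integral>\<^sup>+\<psi>. ennreal ((1 / (1 - t * q \<psi>)) ^ d) \<partial>?S) + (\<integral>\<^sup>+\<psi>. ennreal ((1 / (1 - (- t) * q \<psi>)) ^ d) \<partial>?S)"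
      by (rule nn_integral_add) auto
    also have "\<dots> \<le> ennreal (exp (t\<^sup>2 * S2 / 2 + \<bar>t\<bar> ^ 3 * S3)) + ennreal (exp ((- t)\<^sup>2 * S2 / 2 + \<bar>- t\<bar> ^ 3 * S3))"
      using t by (intro add_mono mgf) auto
    also have "\<dots> = ennreal (2 * exp (t\<^sup>2 * S2 / 2 + \<bar>t\<bar> ^ 3 * S3))"
      by (simp flip: ennreal_plus)
    finally show ?thesis .
  qed
  \<comment> \<open>Finiteness first, by one admissible t, so that the inequality can be moved to
    the reals, where 2 may be subtracted.\<close>
  have "I \<noteq> \<infinity>"
  proof
    assume "I = \<infinity>"
    then have "\<infinity> \<le> ennreal (2 * exp ((1 / (2 * X))\<^sup>2 * S2 / 2 + \<bar>1 / (2 * X)\<bar> ^ 3 * S3))"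
      using main[of "1 / (2 * X)"] X D by (simp add: ennreal_mult_top)
    then show False by (simp add: top_unique)
  qed
  then obtain i where i: "I = ennreal i" "0 \<le> i" by (cases I) auto
  \<comment> \<open>With y the exponent in \<open>main\<close>, exp y \<le> 1 + y + y^2 for y in
    [0,1]; \<open>G t\<close> is (2 y + 2 y^2) / t^2, which is continuous with value S2 at t =
    0.\<close>
  define G where "G t = S2 + 2 * t * S3 + 2 * t\<^sup>2 * (S2 / 2 + t * S3)\<^sup>2" for t
  have bound: "D * i \<le> G t" if t: "0 < t" "t * X \<le> 1 / 2" "t * (S2 / 2 + S3) \<le> 1" for t
  proof -
    have t1: "t \<le> 1" using mult_left_mono[of 1 X t] X t by linarith
    define y where "y = t\<^sup>2 * (S2 / 2 + t * S3)"
    have "S2 / 2 + t * S3 \<le> S2 / 2 + S3" using t1 S23 mult_right_mono[of t 1 S3] by simp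
    then have "t * (S2 / 2 + t * S3) \<le> 1" using t(1,3) mult_left_mono[of _ _ t] by (smt (verit))
    then have "t * (t * (S2 / 2 + t * S3)) \<le> t * 1" using t(1) by (intro mult_left_mono) auto
    then have "y \<le> 1" using t1 unfolding y_def power2_eq_square mult.assoc by linarith
    moreover have "0 \<le> y" using S23 t by (simp add: y_def)
    ultimately have y: "0 \<le> y" "y \<le> 1" by auto
    have "ennreal (D * t\<^sup>2 * i + 2) = ennreal (D * t\<^sup>2) * I + 2"
      using i D by (simp add: ennreal_mult flip: ennreal_numeral)
    also have "\<dots> \<le> ennreal (2 * exp y)"
      using main[OF t(1,2)] t(1) by (simp add: y_def power2_eq_square power3_eq_cube algebra_simps)
    finally have "D * t\<^sup>2 * i + 2 \<le> 2 * exp y" by simp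
    also have "\<dots> \<le> 2 * (1 + y + y\<^sup>2)" using exp_bound[OF y] by simp
    finally have "D * t\<^sup>2 * i \<le> 2 * y + 2 * y\<^sup>2" by simp
    also have "\<dots> = G t * t\<^sup>2" by (simp add: y_def G_def power2_eq_square algebra_simps)
    finally have "(D * i) * t\<^sup>2 \<le> G t * t\<^sup>2" by (simp add: mult_ac)
    then show ?thesis using t(1) by simp
  qed
  have "isCont G 0" unfolding G_def by (intro continuous_intros)
  then have "(G \<longlongrightarrow> G 0) (at_right 0)"
    unfolding isCont_def by (rule filterlim_mono) (auto simp: at_le)
  moreover have "eventually (\<lambda>t. D * i \<le> G t) (at_right 0)"
  proof -
    have "((\<lambda>t. t * X) \<longlongrightarrow> 0 * X) (at_right 0)"
      by (intro tendsto_intros)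
    then have "eventually (\<lambda>t. t * X < 1 / 2) (at_right 0)"
      by (rule order_tendstoD) simp
    moreover have "((\<lambda>t. t * (S2 / 2 + S3)) \<longlongrightarrow> 0 * (S2 / 2 + S3)) (at_right 0)"
      by (intro tendsto_intros)
    then have "eventually (\<lambda>t. t * (S2 / 2 + S3) < 1) (at_right 0)"
      by (rule order_tendstoD) simp
    ultimately show ?thesis using eventually_at_right_less[of 0]
      by eventually_elim (auto intro: bound)
  qed
  ultimately have "D * i \<le> G 0"
    by (intro tendsto_lowerbound[of G]) auto
  then have "i \<le> S2 / D" using D by (simp add: G_def field_simps)
  then show ?thesis using i by (simp add: I_def q_def S2_def D_def d_def ennreal_leI)
qed

text \<open>Because the squared coordinates of a unit vector sum to 1, the threshold can be absorbed
  into the eigenvalues: with x j = \<theta> (a j - \<tau> - s) the event says that the form is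
  positive, so (1 - form)^(-d) is at least 1 on it and at least 0 elsewhere. Its mean therefore
  bounds the probability.\<close>

lemma sphere_upper_tail:
  fixes P :: "'n::finite cmat" and a :: "nat \<Rightarrow> real"
  assumes P: "orth_proj P" "range_space P \<noteq> {0}" and v: "onb P v"
    and a: "\<And>j. j < cdim P \<Longrightarrow> \<bar>a j\<bar> \<le> L" and L: "L > 0" and s: "s > 0"
  shows "measure (sphere_measure P)
      {\<psi>. (\<Sum>j<cdim P. a j) / cdim P + s < (\<Sum>j<cdim P. a j * (cmod (cinner (v j) \<psi>))\<^sup>2)}
    \<le> exp (- (11 / 256) * cdim P * s\<^sup>2 / L\<^sup>2)"
proof -
  let ?S = "sphere_measure P"
  interpret S: prob_space ?S by (rule prob_space_sphere_measure)
  define d where "d = cdim P"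
  have d: "d > 0" unfolding d_def by (rule cdim_pos[OF P(2)])
  define q where "q \<psi> = (\<Sum>j<d. a j * (cmod (cinner (v j) \<psi>))\<^sup>2)" for \<psi>
  define \<tau> where "\<tau> = (\<Sum>j<d. a j) / d"
  have q_meas [measurable]: "q \<in> borel_measurable borel"
    unfolding q_def by (intro borel_measurable_continuous_onI continuous_intros)
  have sum_a: "(\<Sum>j<d. a j) = d * \<tau>" using d by (simp add: \<tau>_def)
  have "\<bar>\<Sum>j<d. a j\<bar> \<le> (\<Sum>j<d. L)" using a by (intro order_trans[OF sum_abs] sum_mono) (auto simp: d_def)
  then have \<tau>: "\<bar>\<tau>\<bar> \<le> L" using d by (simp add: \<tau>_def abs_mult field_simps)
  have q_le: "\<bar>q \<psi>\<bar> \<le> L" if "\<psi> \<in> range_space P \<and> norm \<psi> = 1" for \<psi>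
    unfolding q_def d_def by (rule onb_quadratic_abs_le[OF v]) (use that a in auto)
  define A where "A = {\<psi>. \<tau> + s < q \<psi>}"
  have A [measurable]: "A \<in> sets borel" unfolding A_def by measurable
  have "measure ?S A \<le> exp (- (11 / 256) * d * s\<^sup>2 / L\<^sup>2)"
  \<comment> \<open>The form and its mean \<tau> both lie in [-L, L], so for s > 2 L the event is
    null.\<close>
  proof (cases "s \<le> 2 * L")
    case False
    have "AE \<psi> in ?S. \<not> \<psi> \<in> A"
      using AE_sphere_measure[OF P]
    proof eventually_elim
      fix \<psi> assume "\<psi> \<in> range_space P \<and> norm \<psi> = 1"
      from q_le[OF this] show "\<not> \<psi> \<in> A" using \<tau> False by (auto simp: A_def)
    qed
    then have "measure ?S A = 0" using A by (subst S.prob_eq_0) auto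
    then show ?thesis by simp
  next
    case True
    \<comment> \<open>As |a j - \<tau> - s| \<le> 4 L and s \<le> 2 L, this is the largest multiple
      of s / L^2 that ensures |x j| \<le> 1/2. The sum of the (a j - \<tau> - s)^2 is at most 5 d
      L^2, so the exponent is at most d s^2 / L^2 times -1/16 + 5/256 = -11/256.\<close>
    define \<theta> where "\<theta> = s / (16 * L\<^sup>2)"
    have \<theta>: "\<theta> > 0" using s L by (simp add: \<theta>_def)
    have \<theta>L: "\<theta> * (4 * L) \<le> 1 / 2" using True L s by (simp add: \<theta>_def power2_eq_square field_simps)
    define x where "x j = \<theta> * (a j - \<tau> - s)" for j
    have xb: "\<bar>x j\<bar> \<le> 1 / 2" if "j < d" for j
    proof -
      have "\<bar>a j - \<tau> - s\<bar> \<le> 4 * L" using a[of j] that \<tau> True s by (auto simp: d_def)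
      then have "\<theta> * \<bar>a j - \<tau> - s\<bar> \<le> \<theta> * (4 * L)" using \<theta> by (intro mult_left_mono) auto
      then have "\<theta> * \<bar>a j - \<tau> - s\<bar> \<le> 1 / 2" using \<theta>L by linarith
      moreover have "\<bar>x j\<bar> = \<theta> * \<bar>a j - \<tau> - s\<bar>" using \<theta> by (simp add: x_def abs_mult)
      ultimately show ?thesis by linarith
    qed
    have "emeasure ?S A = (\<integral>\<^sup>+\<psi>. indicator A \<psi> \<partial>?S)" using A by simp
    also have "\<dots> \<le> (\<integral>\<^sup>+\<psi>. ennreal (1 / (1 - (\<Sum>j<d. x j * (cmod (cinner (v j) \<psi>))\<^sup>2)) ^ d) \<partial>?S)"
    proof (rule nn_integral_mono_AE, use AE_sphere_measure[OF P] in eventually_elim)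
      fix \<psi> assume \<psi>: "\<psi> \<in> range_space P \<and> norm \<psi> = 1"
      have "(\<Sum>j<d. (cmod (cinner (v j) \<psi>))\<^sup>2) = 1"
        using onb_parseval[OF v, of \<psi>] \<psi> by (simp add: d_def)
      then have "(\<Sum>j<d. x j * (cmod (cinner (v j) \<psi>))\<^sup>2) = \<theta> * (q \<psi> - (\<tau> + s))"
        by (simp add: x_def q_def algebra_simps sum.distrib sum_subtractf flip: sum_distrib_left)
      moreover have "\<bar>\<Sum>j<d. x j * (cmod (cinner (v j) \<psi>))\<^sup>2\<bar> \<le> 1 / 2"
        unfolding d_def by (rule onb_quadratic_abs_le[OF v]) (use \<psi> xb in \<open>auto simp: d_def\<close>)
      moreover have "0 \<le> \<theta> * (q \<psi> - (\<tau> + s))" if "\<psi> \<in> A"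
        using \<theta> that by (auto simp: A_def)
      ultimately have "1 \<le> 1 / (1 - (\<Sum>j<d. x j * (cmod (cinner (v j) \<psi>))\<^sup>2)) ^ d" if "\<psi> \<in> A"
        using that by (auto simp: le_divide_eq intro!: power_le_one)
      then show "indicator A \<psi> \<le> ennreal (1 / (1 - (\<Sum>j<d. x j * (cmod (cinner (v j) \<psi>))\<^sup>2)) ^ d)"
        by (auto simp: indicator_def)
    qed
    also have "\<dots> = ennreal (\<Prod>j<d. 1 / (1 - x j))"
      unfolding d_def by (rule sphere_measure_quadratic[OF P(1) v]) (use xb in \<open>force simp: d_def\<close>)
    also have "\<dots> \<le> ennreal (\<Prod>j<d. exp (x j + (x j)\<^sup>2))"
      using xb by (intro ennreal_leI prod_mono) (force intro: inverse_one_minus_le_exp_square)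
    also have "(\<Prod>j<d. exp (x j + (x j)\<^sup>2)) = exp (\<Sum>j<d. x j + (x j)\<^sup>2)"
      by (simp add: exp_sum)
    also have "(\<Sum>j<d. x j + (x j)\<^sup>2) \<le> - (11 / 256) * d * s\<^sup>2 / L\<^sup>2"
    proof -
      have 1: "(\<Sum>j<d. x j) = - \<theta> * d * s"
        by (simp add: x_def sum_subtractf sum_a algebra_simps flip: sum_distrib_left)
      have 3: "(\<Sum>j<d. (x j)\<^sup>2) = \<theta>\<^sup>2 * (\<Sum>j<d. (a j)\<^sup>2 - 2 * (\<tau> + s) * a j + (\<tau> + s)\<^sup>2)"
        unfolding sum_distrib_left by (intro sum.cong refl) (simp add: x_def power2_eq_square algebra_simps)
      have "(\<Sum>j<d. (a j)\<^sup>2 - 2 * (\<tau> + s) * a j + (\<tau> + s)\<^sup>2)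
          = (\<Sum>j<d. (a j)\<^sup>2) - 2 * (\<tau> + s) * (d * \<tau>) + d * (\<tau> + s)\<^sup>2"
        by (simp add: sum.distrib sum_subtractf sum_a flip: sum_distrib_left)
      also have "\<dots> = (\<Sum>j<d. (a j)\<^sup>2) - d * \<tau>\<^sup>2 + d * s\<^sup>2"
        by (simp add: power2_eq_square algebra_simps)
      also have "\<dots> \<le> d * L\<^sup>2 + d * (4 * L\<^sup>2)"
      proof -
        have "(\<Sum>j<d. (a j)\<^sup>2) \<le> (\<Sum>j<d. L\<^sup>2)"
          using a by (intro sum_mono) (simp add: d_def abs_le_square_iff[symmetric] less_imp_le[OF L])
        moreover have "s\<^sup>2 \<le> (2 * L)\<^sup>2" using True s by (intro power_mono) auto
        then have "d * s\<^sup>2 \<le> d * (4 * L\<^sup>2)" by (intro mult_left_mono) (auto simp: power_mult_distrib)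
        moreover have "0 \<le> d * \<tau>\<^sup>2" by simp
        moreover have "(\<Sum>j<d. L\<^sup>2) = d * L\<^sup>2" by simp
        ultimately show ?thesis by linarith
      qed
      also have "\<dots> = 5 * d * L\<^sup>2" by simp
      finally have 2: "(\<Sum>j<d. (x j)\<^sup>2) \<le> \<theta>\<^sup>2 * (5 * d * L\<^sup>2)"
        unfolding 3 by (rule mult_left_mono) simp
      have "- \<theta> * d * s + \<theta>\<^sup>2 * (5 * d * L\<^sup>2) = - (11 / 256) * d * s\<^sup>2 / L\<^sup>2"
        using L by (simp add: \<theta>_def field_simps power2_eq_square)
      then show ?thesis using 1 2 by (simp add: sum.distrib)
    qed
    finally have "emeasure ?S A \<le> ennreal (exp (- (11 / 256) * d * s\<^sup>2 / L\<^sup>2))"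
      by (simp add: ennreal_leI)
    then show ?thesis by (simp add: S.emeasure_eq_measure)
  qed
  then show ?thesis by (simp add: A_def \<tau>_def q_def d_def)
qed

section \<open>Unitary evolution and the absolute value of an operator\<close>

lemma self_adjoint_spectral_UNIV:
  fixes A :: "'n::finite cmat"
  assumes A: "self_adjoint A"
  obtains N v and lam :: "nat \<Rightarrow> real" where "orthonormal N v"
    "\<And>x. (\<Sum>k<N. cinner (v k) x *s v k) = x"
    "\<And>x. A *v x = (\<Sum>k<N. (of_real (lam k) * cinner (v k) x) *s v k)"
proof -
  let ?N = "vec.dim (UNIV :: (complex^'n) set)"
  obtain v and lam :: "nat \<Rightarrow> real" where v: "orthonormal ?N v"
    "\<And>k. k < ?N \<Longrightarrow> v k \<in> UNIV"
    "\<And>k. k < ?N \<Longrightarrow> A *v v k = of_real (lam k) *s v k"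
    by (rule self_adjoint_spectral[OF A vec.subspace_UNIV UNIV_I]) (rule that)
  have e: "(\<Sum>k<?N. cinner (v k) x *s v k) = x" for x
    using orthonormal_span_expand[OF v(1), of x] orthonormal_span_dim[OF v(1)] by simp
  have "A *v x = (\<Sum>k<?N. (of_real (lam k) * cinner (v k) x) *s v k)" for x
  proof -
    have "A *v x = A *v (\<Sum>k<?N. cinner (v k) x *s v k)" by (simp only: e)
    also have "\<dots> = (\<Sum>k<?N. cinner (v k) x *s (A *v v k))"
      by (simp add: vec.linear_sum[OF matrix_vector_mul_linear_gen] matrix_scale)
    also have "\<dots> = (\<Sum>k<?N. (of_real (lam k) * cinner (v k) x) *s v k)"
      using v(3) by (intro sum.cong refl) (simp add: mult.commute)
    finally show ?thesis .
  qed
  then show ?thesis by (rule that[OF v(1) e])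
qed

text \<open>This and its converse below translate between entries and action: \<open>mexp\<close>
  and \<open>trace\<close> are defined by entries, whereas spectral data describe how an operator
  acts.\<close>

lemma matrix_entry_outer:
  fixes M :: "'n::finite cmat"
  assumes "\<And>x. M *v x = (\<Sum>k<m. (c k * cinner (v k) x) *s v k)"
  shows "M $ i $ j = (\<Sum>k<m. c k * v k $ i * cnj (v k $ j))"
proof -
  have "M $ i $ j = (M *v axis j 1) $ i"
    by (simp add: matrix_vector_mult_def axis_def if_distrib[of "(*) _"] cong: if_cong)
  also have "\<dots> = (\<Sum>k<m. c k * v k $ i * cnj (v k $ j))"
    unfolding assms by (simp add: cinner_def axis_def if_distrib[of "(*) _"] mult_ac cong: if_cong)
  finally show ?thesis .
qed

lemma matrix_apply_outer:
  fixes M :: "'n::finite cmat"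
  assumes "\<And>i j. M $ i $ j = (\<Sum>k<m. c k * v k $ i * cnj (v k $ j))"
  shows "M *v x = (\<Sum>k<m. (c k * cinner (v k) x) *s v k)"
proof (subst vec_eq_iff, rule allI)
  fix i
  have "(M *v x) $ i = (\<Sum>j\<in>UNIV. \<Sum>k<m. c k * v k $ i * cnj (v k $ j) * x $ j)"
    by (simp add: matrix_vector_mult_def assms sum_distrib_right)
  also have "\<dots> = (\<Sum>k<m. \<Sum>j\<in>UNIV. c k * v k $ i * cnj (v k $ j) * x $ j)" by (rule sum.swap)
  also have "\<dots> = (\<Sum>k<m. (c k * cinner (v k) x) *s v k) $ i"
    by (simp add: cinner_def sum_distrib_left sum_distrib_right mult_ac)
  finally show "(M *v x) $ i = (\<Sum>k<m. (c k * cinner (v k) x) *s v k) $ i" .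
qed

text \<open>The factor 1 gives the expansion the shape expected by
  \<open>matrix_entry_outer\<close>.\<close>

lemma onb_proj_apply:
  assumes P: "orth_proj P" and b: "onb P b"
  shows "P *v x = (\<Sum>k<cdim P. (1 * cinner (b k) x) *s b k)"
proof -
  have "P *v x \<in> range_space P"
    using P by (simp add: range_space_def orth_proj_def matrix_vector_mul_assoc)
  then have "P *v x = (\<Sum>k<cdim P. cinner (b k) (P *v x) *s b k)" by (rule onb_expand[OF b])
  also have "\<dots> = (\<Sum>k<cdim P. (1 * cinner (b k) x) *s b k)"
  proof (rule sum.cong[OF refl])
    fix k assume "k \<in> {..<cdim P}"
    then have "P *v b k = b k" using b by (simp add: onb_def range_space_def)
    then have "cinner (b k) (P *v x) = cinner (b k) x"
      using P self_adjoint_cinner[of P "b k" x] by (simp add: orth_proj_def)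
    then show "cinner (b k) (P *v x) *s b k = (1 * cinner (b k) x) *s b k" by simp
  qed
  finally show ?thesis .
qed

text \<open>Valid for every orthonormal basis of the macro space, so the same trace may be evaluated
  in the eigenbasis of whichever operator is under study.\<close>

lemma trace_proj_mult:
  assumes P: "orth_proj P" and b: "onb P b"
  shows "trace (P ** G) = (\<Sum>k<cdim P. cinner (b k) (G *v b k))"
proof -
  have "trace (P ** G) = (\<Sum>i\<in>UNIV. \<Sum>j\<in>UNIV. \<Sum>k<cdim P. b k $ i * cnj (b k $ j) * G $ j $ i)"
    by (simp add: trace_def matrix_matrix_mult_def matrix_entry_outer[OF onb_proj_apply[OF P b]] sum_distrib_right)
  also have "\<dots> = (\<Sum>i\<in>UNIV. \<Sum>k<cdim P. \<Sum>j\<in>UNIV. b k $ i * cnj (b k $ j) * G $ j $ i)"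
    by (rule sum.cong[OF refl], rule sum.swap)
  also have "\<dots> = (\<Sum>k<cdim P. \<Sum>i\<in>UNIV. \<Sum>j\<in>UNIV. b k $ i * cnj (b k $ j) * G $ j $ i)"
    by (rule sum.swap)
  also have "\<dots> = (\<Sum>k<cdim P. \<Sum>j\<in>UNIV. \<Sum>i\<in>UNIV. b k $ i * cnj (b k $ j) * G $ j $ i)"
    by (rule sum.cong[OF refl], rule sum.swap)
  also have "\<dots> = (\<Sum>k<cdim P. cinner (b k) (G *v b k))"
    by (simp add: cinner_def matrix_vector_mult_def sum_distrib_left mult_ac)
  finally show ?thesis .
qed

lemma mscale_apply: "mscale c A *v x = c *s (A *v x)"
  by (simp add: mscale_def matrix_vector_mult_def vec_eq_iff sum_distrib_left mult_ac)

text \<open>In an eigenbasis each entry of the matrix series is a finite combination of scalar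
  exponential series, so convergence of the defining series comes together with its value.\<close>

lemma mexp_apply_spectral:
  fixes H :: "'n::finite cmat" and h :: "nat \<Rightarrow> real"
  assumes o: "orthonormal N v" and e: "\<And>x. (\<Sum>k<N. cinner (v k) x *s v k) = x"
    and H: "\<And>x. H *v x = (\<Sum>k<N. (of_real (h k) * cinner (v k) x) *s v k)"
  shows "mexp (mscale c H) *v x = (\<Sum>k<N. (exp (c * of_real (h k)) * cinner (v k) x) *s v k)"
proof (rule matrix_apply_outer)
  fix i j
  have pow: "mpow (mscale c H) n *v x = (\<Sum>k<N. ((c * of_real (h k)) ^ n * cinner (v k) x) *s v k)" for n x
  proof (induction n)
    case 0
    then show ?case by (simp add: mpow_def e)
  next
    case (Suc n)
    have "mpow (mscale c H) (Suc n) *v x = mscale c H *v (mpow (mscale c H) n *v x)"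
      by (simp add: mpow_def matrix_vector_mul_assoc)
    also have "\<dots> = (\<Sum>k<N. c *s ((of_real (h k) * ((c * of_real (h k)) ^ n * cinner (v k) x)) *s v k))"
      unfolding Suc mscale_apply H vec.scale_sum_right
      by (intro sum.cong refl) (simp add: orthonormal_cinner_sum[OF o])
    also have "\<dots> = (\<Sum>k<N. ((c * of_real (h k)) ^ Suc n * cinner (v k) x) *s v k)"
      by (simp add: mult_ac)
    finally show ?case .
  qed
  have "(\<lambda>n. mpow (mscale c H) n $ i $ j / of_nat (fact n)) sums
      (\<Sum>k<N. exp (c * of_real (h k)) * v k $ i * cnj (v k $ j))"
  proof -
    have "mpow (mscale c H) n $ i $ j / of_nat (fact n)
        = (\<Sum>k<N. (c * of_real (h k)) ^ n /\<^sub>R fact n * v k $ i * cnj (v k $ j))" for n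
      unfolding matrix_entry_outer[OF pow] sum_divide_distrib
      by (intro sum.cong refl) (simp add: scaleR_conv_of_real field_simps)
    then show ?thesis by (simp only:) (intro sums_sum sums_mult2 exp_converges)
  qed
  then show "mexp (mscale c H) $ i $ j = (\<Sum>k<N. exp (c * of_real (h k)) * v k $ i * cnj (v k $ j))"
    by (simp add: mexp_def sums_iff)
qed

section \<open>Unitary time evolution\<close>

lemma evol_spectral:
  fixes H :: "'n::finite cmat"
  assumes "self_adjoint H"
  obtains N v and h :: "nat \<Rightarrow> real" where "orthonormal N v" "\<And>x. (\<Sum>k<N. cinner (v k) x *s v k) = x"
    "\<And>t x. evol H t *v x = (\<Sum>k<N. (exp (- \<i> * of_real t * of_real (h k)) * cinner (v k) x) *s v k)"
    "\<And>t x. mexp (mscale (\<i> * of_real t) H) *v x = (\<Sum>k<N. (exp (\<i> * of_real t * of_real (h k)) * cinner (v k) x) *s v k)"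
proof -
  obtain N v and h :: "nat \<Rightarrow> real" where *: "orthonormal N v" "\<And>x. (\<Sum>k<N. cinner (v k) x *s v k) = x"
    "\<And>x. H *v x = (\<Sum>k<N. (of_real (h k) * cinner (v k) x) *s v k)"
    by (rule self_adjoint_spectral_UNIV[OF assms]) (rule that)
  show ?thesis
    by (rule that[OF *(1,2), of h]) (simp_all add: evol_def mexp_apply_spectral[OF *])
qed

text \<open>The eigenvalues of the evolution are exponentials of purely imaginary numbers, hence
  have modulus 1.\<close>

lemma evol_cinner:
  assumes "self_adjoint H"
  shows "cinner (evol H t *v x) (evol H t *v y) = cinner x y"
proof -
  obtain N v and h :: "nat \<Rightarrow> real" where *: "orthonormal N v" "\<And>x. (\<Sum>k<N. cinner (v k) x *s v k) = x"
    "\<And>t x. evol H t *v x = (\<Sum>k<N. (exp (- \<i> * of_real t * of_real (h k)) * cinner (v k) x) *s v k)"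
    "\<And>t x. mexp (mscale (\<i> * of_real t) H) *v x = (\<Sum>k<N. (exp (\<i> * of_real t * of_real (h k)) * cinner (v k) x) *s v k)"
    by (rule evol_spectral[OF assms]) (rule that)
  have "cinner (evol H t *v x) (evol H t *v y)
      = (\<Sum>k<N. cnj (cinner (v k) x) * cinner (v k) y)"
    unfolding *(3) orthonormal_cinner_sums[OF *(1)]
  proof (rule sum.cong[OF refl])
    fix k
    define z where "z = - \<i> * of_real t * of_real (h k)"
    have "cnj (exp z) * exp z = exp (cnj z + z)" by (simp add: exp_cnj exp_add)
    also have "cnj z + z = 0" by (simp add: z_def)
    finally have "cnj (exp z) * exp z = 1" by simp
    then show "cnj (exp z * cinner (v k) x) * (exp z * cinner (v k) y) = cnj (cinner (v k) x) * cinner (v k) y"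
      by (metis complex_cnj_mult mult.assoc mult.left_commute mult.right_neutral mult.commute)
  qed
  also have "\<dots> = cinner (\<Sum>k<N. cinner (v k) x *s v k) (\<Sum>k<N. cinner (v k) y *s v k)"
    by (simp add: orthonormal_cinner_sums[OF *(1)])
  finally show ?thesis by (simp only: *(2))
qed

lemma evol_norm:
  assumes "self_adjoint H" shows "norm (evol H t *v x) = norm x"
  unfolding norm_eq Re_cinner[symmetric] evol_cinner[OF assms] ..

lemma cinner_evol_adjoint:
  assumes "self_adjoint H"
  shows "cinner x (mexp (mscale (\<i> * of_real t) H) *v y) = cinner (evol H t *v x) y"
proof -
  obtain N v and h :: "nat \<Rightarrow> real" where *: "orthonormal N v" "\<And>x. (\<Sum>k<N. cinner (v k) x *s v k) = x"
    "\<And>t x. evol H t *v x = (\<Sum>k<N. (exp (- \<i> * of_real t * of_real (h k)) * cinner (v k) x) *s v k)"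
    "\<And>t x. mexp (mscale (\<i> * of_real t) H) *v x = (\<Sum>k<N. (exp (\<i> * of_real t * of_real (h k)) * cinner (v k) x) *s v k)"
    by (rule evol_spectral[OF assms]) (rule that)
  show ?thesis
    unfolding *(3,4) cinner_sum_left cinner_sum_right cinner_scale_left cinner_scale_right
    by (intro sum.cong refl) (simp add: exp_cnj cnj_cinner mult_ac)
qed

text \<open>Continuity jointly in time and state is what later yields product measurability for
  Fubini in the time average.\<close>

lemma continuous_evol:
  assumes "self_adjoint H"
  shows "continuous_on UNIV (\<lambda>(t, \<psi>). evol H t *v \<psi>)"
proof -
  obtain N v and h :: "nat \<Rightarrow> real" where *: "orthonormal N v" "\<And>x. (\<Sum>k<N. cinner (v k) x *s v k) = x"
    "\<And>t x. evol H t *v x = (\<Sum>k<N. (exp (- \<i> * of_real t * of_real (h k)) * cinner (v k) x) *s v k)"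
    "\<And>t x. mexp (mscale (\<i> * of_real t) H) *v x = (\<Sum>k<N. (exp (\<i> * of_real t * of_real (h k)) * cinner (v k) x) *s v k)"
    by (rule evol_spectral[OF assms]) (rule that)
  show ?thesis unfolding *(3) case_prod_beta by (intro continuous_intros)
qed

section \<open>Operator norm and absolute value\<close>

lemma opnorm_bound: "norm (B *v x) \<le> opnorm B * norm x"
  unfolding opnorm_def by (rule onorm[OF matrix_vector_mul_bounded_linear])

lemma opnorm_nonneg: "0 \<le> opnorm B"
  unfolding opnorm_def by (rule onorm_pos_le[OF matrix_vector_mul_bounded_linear])

lemma cinner_adj_right: "cinner x (adj A *v y) = cinner (A *v x) y"
  using arg_cong[OF cinner_adj_left[of A y x], of cnj] by (simp only: cnj_cinner)

lemma norm_matrix_sq: "complex_of_real ((norm (B *v x))\<^sup>2) = cinner x ((adj B ** B) *v x)"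
  by (simp only: cinner_self[symmetric] matrix_vector_mul_assoc[symmetric] cinner_adj_right)

lemma self_adjoint_gram: "self_adjoint (adj B ** B)"
  by (simp add: self_adjoint_def adj_def matrix_matrix_mult_def vec_eq_iff mult.commute)

text \<open>Square roots are taken of the eigenvalues of the Gram operator, which are nonnegative
  because the k-th one equals |B v k|^2.\<close>

lemma positive_sqrt_exists:
  fixes B :: "'n::finite cmat"
  shows "\<exists>A. positive_op A \<and> A ** A = adj B ** B"
proof -
  obtain N v and lam :: "nat \<Rightarrow> real" where o: "orthonormal N v"
    and e: "\<And>x. (\<Sum>k<N. cinner (v k) x *s v k) = x"
    and C: "\<And>x. (adj B ** B) *v x = (\<Sum>k<N. (of_real (lam k) * cinner (v k) x) *s v k)"
    by (rule self_adjoint_spectral_UNIV[OF self_adjoint_gram]) (rule that)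
  have lam: "0 \<le> lam k" if "k < N" for k
  proof -
    have "complex_of_real ((norm (B *v v k))\<^sup>2) = of_real (lam k)"
      using o that by (simp only: norm_matrix_sq C orthonormal_cinner_sum[OF o that]) (simp add: orthonormal_def)
    then show ?thesis by (metis of_real_eq_iff zero_le_power2)
  qed
  define X :: "'n cmat" where "X = (\<chi> i j. \<Sum>k<N. of_real (sqrt (lam k)) * v k $ i * cnj (v k $ j))"
  have X: "X *v x = (\<Sum>k<N. (of_real (sqrt (lam k)) * cinner (v k) x) *s v k)" for x
    by (rule matrix_apply_outer) (simp add: X_def)
  have "self_adjoint X" by (simp add: self_adjoint_def adj_def X_def vec_eq_iff mult_ac)
  moreover have "0 \<le> Re (cinner x (X *v x))" for x
  proof -
    have "cinner x (X *v x) = (\<Sum>k<N. of_real (sqrt (lam k) * (cmod (cinner (v k) x))\<^sup>2))"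
      unfolding X cinner_sum_right cinner_scale_right
      by (intro sum.cong refl) (simp add: complex_norm_square cnj_cinner mult_ac del: of_real_power)
    then show ?thesis using lam by (auto simp: intro!: sum_nonneg)
  qed
  moreover have "X ** X = adj B ** B"
    unfolding matrix_eq
  proof
    fix x
    have "(X ** X) *v x = X *v (X *v x)" by (simp add: matrix_vector_mul_assoc)
    also have "\<dots> = (\<Sum>k<N. (of_real (lam k) * cinner (v k) x) *s v k)"
      unfolding X[of "X *v x"]
    proof (rule sum.cong[OF refl])
      fix k assume k: "k \<in> {..<N}"
      then have "cinner (v k) (X *v x) = of_real (sqrt (lam k)) * cinner (v k) x"
        unfolding X by (simp add: orthonormal_cinner_sum[OF o])
      moreover have "complex_of_real (sqrt (lam k)) * of_real (sqrt (lam k)) = of_real (lam k)"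
        using lam k by (simp flip: of_real_mult)
      ultimately show "(of_real (sqrt (lam k)) * cinner (v k) (X *v x)) *s v k
          = (of_real (lam k) * cinner (v k) x) *s v k" by (simp flip: mult.assoc)
    qed
    finally show "(X ** X) *v x = (adj B ** B) *v x" by (simp only: C)
  qed
  ultimately show ?thesis by (auto simp: positive_op_def)
qed

text \<open>Existence alone does not give access to the definite description in \<open>mabs\<close>.
  The two roots are compared on an eigenbasis of \<open>A\<close>.\<close>

lemma positive_sqrt_unique:
  fixes A A' :: "'n::finite cmat"
  assumes A: "positive_op A" and A': "positive_op A'" and eq: "A ** A = A' ** A'"
  shows "A = A'"
proof -
  have sA: "self_adjoint A" and sA': "self_adjoint A'" using A A' by (auto simp: positive_op_def)
  obtain N v and lam :: "nat \<Rightarrow> real" where o: "orthonormal N v"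
    and e: "\<And>x. (\<Sum>k<N. cinner (v k) x *s v k) = x"
    and s: "\<And>x. A *v x = (\<Sum>k<N. (of_real (lam k) * cinner (v k) x) *s v k)"
    by (rule self_adjoint_spectral_UNIV[OF sA]) (rule that)
  have "A' *v v k = A *v v k" if k: "k < N" for k
  proof -
    have "A *v v k = (\<Sum>j<N. (if j = k then of_real (lam k) else 0) *s v j)"
      unfolding s using o k by (intro sum.cong refl) (auto simp: orthonormal_def)
    also have "\<dots> = of_real (lam k) *s v k"
      using k by (simp add: if_distrib[of "\<lambda>c. c *s _"] cong: if_cong)
    finally have Av: "A *v v k = of_real (lam k) *s v k" .
    have "cinner (v k) (A *v v k) = of_real (lam k)"
      unfolding Av cinner_scale_right using o k by (simp add: orthonormal_def)
    then have lam: "0 \<le> lam k" using A by (metis Re_complex_of_real positive_op_def)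
    have sq: "A' *v (A' *v v k) = of_real ((lam k)\<^sup>2) *s v k"
      using eq by (simp add: matrix_vector_mul_assoc)
        (simp add: matrix_vector_mul_assoc[symmetric] eq[symmetric] Av matrix_scale power2_eq_square)
    \<comment> \<open>From A'^2 v = lam^2 v it follows that A' y = -lam y; positivity of A' then
      leaves only y = 0 or lam = 0. In the second case |A' v|^2 = <v, A'^2 v> = 0.\<close>
    define y where "y = A' *v v k - of_real (lam k) *s v k"
    have y': "A' *v y = of_real (- lam k) *s y"
      by (simp add: y_def matrix_vector_mult_diff_distrib sq matrix_scale power2_eq_square
          vec.scale_right_diff_distrib)
    have "cinner y (A' *v y) = of_real (- lam k * (norm y)\<^sup>2)"
      unfolding y' cinner_scale_right cinner_self by simp
    then have "0 \<le> - lam k * (norm y)\<^sup>2" using A' by (metis Re_complex_of_real positive_op_def)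
    then have "y = 0 \<or> lam k = 0" using lam
      by (metis mult_minus_left mult_nonneg_nonneg neg_0_le_iff_le order_antisym zero_le_power2 mult_eq_0_iff norm_eq_zero power_eq_0_iff)
    then show ?thesis
    proof
      assume "y = 0" then show ?thesis by (simp add: y_def Av)
    next
      assume l: "lam k = 0"
      have "complex_of_real ((norm (A' *v v k))\<^sup>2) = cinner (v k) (A' *v (A' *v v k))"
        by (simp only: cinner_self[symmetric] self_adjoint_cinner[OF sA'])
      then have "A' *v v k = 0" by (simp add: sq l)
      then show ?thesis by (simp add: Av l)
    qed
  qed
  then have *: "\<And>k. k < N \<Longrightarrow> A' *v v k = A *v v k" .
  have "A' *v x = A *v x" for x
  proof -
    have "A' *v (\<Sum>k<N. cinner (v k) x *s v k) = A *v (\<Sum>k<N. cinner (v k) x *s v k)"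
      using * by (simp add: vec.linear_sum[OF matrix_vector_mul_linear_gen] matrix_scale)
    then show ?thesis by (simp only: e)
  qed
  then show ?thesis by (simp add: matrix_eq)
qed

lemma mabs_props: "positive_op (mabs B)" "mabs B ** mabs B = adj B ** B"
proof -
  obtain A where A: "positive_op A \<and> A ** A = adj B ** B" using positive_sqrt_exists by blast
  have "positive_op (mabs B) \<and> mabs B ** mabs B = adj B ** B"
    unfolding mabs_def by (rule theI[of _ A]) (use A positive_sqrt_unique in metis)+
  then show "positive_op (mabs B)" "mabs B ** mabs B = adj B ** B" by auto
qed

text \<open>B and |B| give every vector the same length. In an eigenbasis of |B| each eigenvalue
  \<xi> enters as \<xi>^2 times a weight that is at most 1 by Bessel's inequality, and \<xi>^2 \<le>
  \<xi> times the operator norm.\<close>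

lemma orthonormal_sum_norm_le_trace_mabs:
  fixes B :: "'n::finite cmat"
  assumes f: "orthonormal d f"
  shows "(\<Sum>k<d. (norm (B *v f k))\<^sup>2) \<le> opnorm B * Re (trace (mabs B))"
proof -
  define X where "X = mabs B"
  have X: "positive_op X" "X ** X = adj B ** B" using mabs_props by (auto simp: X_def)
  have sX: "self_adjoint X" using X by (simp add: positive_op_def)
  obtain N w and \<xi> :: "nat \<Rightarrow> real" where o: "orthonormal N w"
    and e: "\<And>x. (\<Sum>k<N. cinner (w k) x *s w k) = x"
    and s: "\<And>x. X *v x = (\<Sum>k<N. (of_real (\<xi> k) * cinner (w k) x) *s w k)"
    by (rule self_adjoint_spectral_UNIV[OF sX]) (rule that)
  have BX: "norm (B *v x) = norm (X *v x)" for x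
  proof -
    have "complex_of_real ((norm (B *v x))\<^sup>2) = of_real ((norm (X *v x))\<^sup>2)"
      unfolding norm_matrix_sq using X(2) sX by (simp add: self_adjoint_def)
    then show ?thesis by (simp only: of_real_eq_iff power2_eq_iff_nonneg norm_ge_zero)
  qed
  have nX: "(norm (X *v x))\<^sup>2 = (\<Sum>m<N. (\<xi> m)\<^sup>2 * (cmod (cinner (w m) x))\<^sup>2)" for x
    unfolding s orthonormal_norm_sum[OF o] by (simp add: norm_mult power_mult_distrib)
  have \<xi>: "0 \<le> \<xi> m" "\<xi> m \<le> opnorm B" if m: "m < N" for m
  proof -
    have "cinner (w m) (X *v w m) = of_real (\<xi> m)"
      unfolding s orthonormal_cinner_sum[OF o m] using o m by (simp add: orthonormal_def)
    then show "0 \<le> \<xi> m" using X by (metis Re_complex_of_real positive_op_def)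
    have nw: "norm (w m) = 1" by (rule orthonormal_norm[OF o m])
    have "\<xi> m = cmod (cinner (w m) (X *v w m))" using \<open>cinner (w m) (X *v w m) = of_real (\<xi> m)\<close> \<open>0 \<le> \<xi> m\<close> by simp
    also have "\<dots> \<le> norm (w m) * norm (X *v w m)" by (rule cmod_cinner_le)
    also have "\<dots> \<le> opnorm B" using opnorm_bound[of B "w m"] by (simp add: nw BX)
    finally show "\<xi> m \<le> opnorm B" .
  qed
  have tr: "trace X = of_real (\<Sum>m<N. \<xi> m)"
  proof -
    have "trace X = (\<Sum>i\<in>UNIV. \<Sum>m<N. of_real (\<xi> m) * w m $ i * cnj (w m $ i))"
      unfolding trace_def matrix_entry_outer[OF s] ..
    also have "\<dots> = (\<Sum>m<N. \<Sum>i\<in>UNIV. of_real (\<xi> m) * w m $ i * cnj (w m $ i))" by (rule sum.swap)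
    also have "\<dots> = (\<Sum>m<N. of_real (\<xi> m) * cinner (w m) (w m))"
      by (simp add: cinner_def sum_distrib_left mult_ac)
    also have "\<dots> = (\<Sum>m<N. of_real (\<xi> m))"
      using o by (intro sum.cong refl) (simp add: orthonormal_def)
    finally show ?thesis by simp
  qed
  have "(\<Sum>k<d. (norm (B *v f k))\<^sup>2) = (\<Sum>m<N. (\<xi> m)\<^sup>2 * (\<Sum>k<d. (cmod (cinner (f k) (w m)))\<^sup>2))"
    unfolding BX nX sum_distrib_left by (subst sum.swap) (simp add: cmod_cinner_commute)
  also have "\<dots> \<le> (\<Sum>m<N. opnorm B * \<xi> m)"
  proof (rule sum_mono)
    fix m assume "m \<in> {..<N}"
    then have m: "m < N" by simp
    have "(\<xi> m)\<^sup>2 * (\<Sum>k<d. (cmod (cinner (f k) (w m)))\<^sup>2) \<le> (\<xi> m)\<^sup>2 * 1"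
      using bessel[OF f, of "w m"] orthonormal_norm[OF o m] by (intro mult_left_mono) auto
    also have "\<dots> \<le> opnorm B * \<xi> m" using \<xi>[OF m] by (simp add: power2_eq_square mult_right_mono)
    finally show "(\<xi> m)\<^sup>2 * (\<Sum>k<d. (cmod (cinner (f k) (w m)))\<^sup>2) \<le> opnorm B * \<xi> m" .
  qed
  also have "\<dots> = opnorm B * Re (trace (mabs B))" by (simp add: tr X_def[symmetric] sum_distrib_left)
  finally show ?thesis .
qed

section \<open>Quadratic forms of general operators\<close>

lemma self_adjointI:
  assumes "\<And>x y. cinner (A *v x) y = cinner x (A *v y)"
  shows "self_adjoint A"
proof -
  have "adj A *v x = A *v x" for x
  proof -
    have "cinner (adj A *v x - A *v x) y = 0" for y
      by (simp add: cinner_diff_left cinner_adj_left assms)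
    from this[of "adj A *v x - A *v x"] show ?thesis by (simp add: cinner_self)
  qed
  then show ?thesis by (simp add: self_adjoint_def matrix_eq)
qed

text \<open>R need not preserve the macro space, so its compression is diagonalised instead; both
  have the same form there. The last conclusion is the basis independence of the Hilbert-Schmidt
  norm of the compression: it allows the Hermitian and anti-Hermitian parts of one operator, which
  have different eigenbases, to be measured in one common basis.\<close>

lemma hermitian_form_diagonal:
  fixes R P :: "'n::finite cmat"
  assumes P: "orth_proj P" and R: "self_adjoint R"
  obtains v and a :: "nat \<Rightarrow> real" where "onb P v"
    "\<And>\<psi>. \<psi> \<in> range_space P \<Longrightarrow> cinner \<psi> (R *v \<psi>) = of_real (\<Sum>j<cdim P. a j * (cmod (cinner (v j) \<psi>))\<^sup>2)"
    "\<And>j. j < cdim P \<Longrightarrow> cinner (v j) (R *v v j) = of_real (a j)"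
    "\<And>b. onb P b \<Longrightarrow> (\<Sum>j<cdim P. (a j)\<^sup>2) = (\<Sum>k<cdim P. \<Sum>l<cdim P. (cmod (cinner (b l) (R *v b k)))\<^sup>2)"
proof -
  let ?d = "cdim P"
  have PP: "self_adjoint P" "\<And>x. P *v (P *v x) = P *v x"
    using P by (auto simp: orth_proj_def matrix_vector_mul_assoc)
  define C where "C = P ** R ** P"
  have C: "C *v x = P *v (R *v (P *v x))" for x
    by (simp add: C_def matrix_vector_mul_assoc matrix_mul_assoc)
  have sC: "self_adjoint C"
    by (rule self_adjointI) (simp add: C self_adjoint_cinner[OF PP(1)] self_adjoint_cinner[OF R])
  have CR: "C *v x \<in> range_space P" for x by (simp add: C range_space_def PP)
  have CRin: "cinner x (C *v y) = cinner x (R *v y)" if "x \<in> range_space P" "y \<in> range_space P" for x y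
    using that by (simp add: C range_space_def self_adjoint_cinner[OF PP(1), symmetric])
  obtain v a where v: "orthonormal (cdim P) v" "\<And>k. k < cdim P \<Longrightarrow> v k \<in> range_space P"
    "\<And>k. k < cdim P \<Longrightarrow> C *v v k = complex_of_real (a k) *s v k"
    by (rule self_adjoint_spectral[OF sC range_space_subspace CR, folded cdim_def]) (rule that)
  have onb: "onb P v" using v by (simp add: onb_iff)
  have form: "cinner \<psi> (R *v \<psi>) = of_real (\<Sum>j<?d. a j * (cmod (cinner (v j) \<psi>))\<^sup>2)"
    if \<psi>: "\<psi> \<in> range_space P" for \<psi>
  proof -
    have e: "\<psi> = (\<Sum>j<?d. cinner (v j) \<psi> *s v j)" by (rule onb_expand[OF onb \<psi>])
    have "C *v (\<Sum>j<?d. cinner (v j) \<psi> *s v j) = (\<Sum>j<?d. (of_real (a j) * cinner (v j) \<psi>) *s v j)"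
      using v(3) by (simp add: vec.linear_sum[OF matrix_vector_mul_linear_gen] matrix_scale mult.commute)
    then have "cinner \<psi> (C *v \<psi>) = cinner (\<Sum>j<?d. cinner (v j) \<psi> *s v j) (\<Sum>j<?d. (of_real (a j) * cinner (v j) \<psi>) *s v j)"
      using e by metis
    also have "\<dots> = (\<Sum>j<?d. of_real (a j * (cmod (cinner (v j) \<psi>))\<^sup>2))"
      unfolding orthonormal_cinner_sums[OF v(1)]
      by (intro sum.cong refl) (simp add: complex_norm_square mult_ac del: of_real_power)
    finally show ?thesis using CRin[OF \<psi> \<psi>] by simp
  qed
  have diag: "cinner (v j) (R *v v j) = of_real (a j)" if j: "j < ?d" for j
  proof -
    have "cinner (v j) (R *v v j) = cinner (v j) (C *v v j)" using CRin v(2)[OF j] by simp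
    also have "\<dots> = of_real (a j)"
      unfolding v(3)[OF j] cinner_scale_right using v(1) j by (simp add: orthonormal_def)
    finally show ?thesis .
  qed
  have squares: "(\<Sum>j<?d. (a j)\<^sup>2) = (\<Sum>k<?d. \<Sum>l<?d. (cmod (cinner (b l) (R *v b k)))\<^sup>2)" if b: "onb P b" for b
  proof -
    have sym: "cmod (cinner x (C *v y)) = cmod (cinner y (C *v x))" for x y
      using self_adjoint_cinner[OF sC, of x y] cmod_cinner_commute[of "C *v x" y] by simp
    have "(\<Sum>j<?d. (a j)\<^sup>2) = (\<Sum>j<?d. (norm (C *v v j))\<^sup>2)"
      using v(3) orthonormal_norm[OF v(1)] by (simp flip: scaleR_eq_scale)
    also have "\<dots> = (\<Sum>j<?d. \<Sum>k<?d. (cmod (cinner (b k) (C *v v j)))\<^sup>2)"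
      by (simp add: onb_parseval[OF b CR])
    also have "\<dots> = (\<Sum>j<?d. \<Sum>k<?d. (cmod (cinner (v j) (C *v b k)))\<^sup>2)"
      by (simp only: sym)
    also have "\<dots> = (\<Sum>k<?d. \<Sum>j<?d. (cmod (cinner (v j) (C *v b k)))\<^sup>2)" by (rule sum.swap)
    also have "\<dots> = (\<Sum>k<?d. (norm (C *v b k))\<^sup>2)" by (simp add: onb_parseval[OF onb CR])
    also have "\<dots> = (\<Sum>k<?d. \<Sum>l<?d. (cmod (cinner (b l) (C *v b k)))\<^sup>2)" by (simp add: onb_parseval[OF b CR])
    also have "\<dots> = (\<Sum>k<?d. \<Sum>l<?d. (cmod (cinner (b l) (R *v b k)))\<^sup>2)"
      using b by (intro sum.cong refl) (simp add: CRin onb_def)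
    finally show ?thesis .
  qed
  show ?thesis by (rule that[OF onb form diag squares])
qed

text \<open>Subtracting the mean eigenvalue \<tau> makes the eigenvalues sum to 0, as
  \<open>sphere_second_moment\<close> demands, and can only decrease their sum of squares.\<close>

lemma hermitian_variance:
  fixes R P :: "'n::finite cmat"
  assumes P: "orth_proj P" "range_space P \<noteq> {0}" and R: "self_adjoint R" and b: "onb P b"
  shows "(\<integral>\<^sup>+\<psi>. ennreal ((Re (cinner \<psi> (R *v \<psi>)) - Re (trace (P ** R)) / cdim P)\<^sup>2) \<partial>sphere_measure P)
    \<le> ennreal ((\<Sum>k<cdim P. \<Sum>l<cdim P. (cmod (cinner (b l) (R *v b k)))\<^sup>2) / (real (cdim P) * (real (cdim P) + 1)))"
proof -
  obtain v a where v: "onb P v"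
    "\<And>\<psi>. \<psi> \<in> range_space P \<Longrightarrow> cinner \<psi> (R *v \<psi>) = of_real (\<Sum>j<cdim P. a j * (cmod (cinner (v j) \<psi>))\<^sup>2)"
    "\<And>j. j < cdim P \<Longrightarrow> cinner (v j) (R *v v j) = of_real (a j)"
    "\<And>b. onb P b \<Longrightarrow> (\<Sum>j<cdim P. (a j)\<^sup>2) = (\<Sum>k<cdim P. \<Sum>l<cdim P. (cmod (cinner (b l) (R *v b k)))\<^sup>2)"
    by (rule hermitian_form_diagonal[OF P(1) R]) (rule that)
  define d where "d = cdim P"
  have d: "d > 0" unfolding d_def by (rule cdim_pos[OF P(2)])
  define \<tau> where "\<tau> = (\<Sum>j<d. a j) / d"
  have sum_a: "(\<Sum>j<d. a j) = d * \<tau>" using d by (simp add: \<tau>_def)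
  have tr: "Re (trace (P ** R)) = (\<Sum>j<d. a j)"
    by (simp add: trace_proj_mult[OF P(1) v(1)] v(3) d_def)
  have "(\<integral>\<^sup>+\<psi>. ennreal ((Re (cinner \<psi> (R *v \<psi>)) - Re (trace (P ** R)) / cdim P)\<^sup>2) \<partial>sphere_measure P)
      = (\<integral>\<^sup>+\<psi>. ennreal ((\<Sum>j<cdim P. (a j - \<tau>) * (cmod (cinner (v j) \<psi>))\<^sup>2)\<^sup>2) \<partial>sphere_measure P)"
  proof (rule nn_integral_cong_AE, use AE_sphere_measure[OF P] in eventually_elim)
    fix \<psi> assume \<psi>: "\<psi> \<in> range_space P \<and> norm \<psi> = 1"
    have "(\<Sum>j<cdim P. (a j - \<tau>) * (cmod (cinner (v j) \<psi>))\<^sup>2)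
        = (\<Sum>j<cdim P. a j * (cmod (cinner (v j) \<psi>))\<^sup>2) - \<tau> * (\<Sum>j<cdim P. (cmod (cinner (v j) \<psi>))\<^sup>2)"
      by (simp add: left_diff_distrib sum_subtractf sum_distrib_left)
    moreover have "(\<Sum>j<cdim P. (cmod (cinner (v j) \<psi>))\<^sup>2) = 1" using onb_parseval[OF v(1), of \<psi>] \<psi> by simp
    ultimately have "Re (cinner \<psi> (R *v \<psi>)) - Re (trace (P ** R)) / cdim P = (\<Sum>j<cdim P. (a j - \<tau>) * (cmod (cinner (v j) \<psi>))\<^sup>2)"
      using \<psi> by (simp add: v(2) tr \<tau>_def d_def)
    then show "ennreal ((Re (cinner \<psi> (R *v \<psi>)) - Re (trace (P ** R)) / cdim P)\<^sup>2)
        = ennreal ((\<Sum>j<cdim P. (a j - \<tau>) * (cmod (cinner (v j) \<psi>))\<^sup>2)\<^sup>2)" by simp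
  qed
  also have "\<dots> \<le> ennreal ((\<Sum>j<cdim P. (a j - \<tau>)\<^sup>2) / (real (cdim P) * (real (cdim P) + 1)))"
    by (rule sphere_second_moment[OF P v(1)]) (use sum_a in \<open>simp add: sum_subtractf d_def\<close>)
  also have "\<dots> \<le> ennreal ((\<Sum>j<cdim P. (a j)\<^sup>2) / (real (cdim P) * (real (cdim P) + 1)))"
  proof (intro ennreal_leI divide_right_mono)
    have "(\<Sum>j<d. (a j - \<tau>)\<^sup>2) = (\<Sum>j<d. (a j)\<^sup>2 - 2 * \<tau> * a j + \<tau>\<^sup>2)"
      by (intro sum.cong refl) (simp add: power2_eq_square algebra_simps)
    also have "\<dots> = (\<Sum>j<d. (a j)\<^sup>2) - 2 * \<tau> * (d * \<tau>) + d * \<tau>\<^sup>2"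
      by (simp add: sum.distrib sum_subtractf sum_a flip: sum_distrib_left)
    also have "\<dots> = (\<Sum>j<d. (a j)\<^sup>2) - d * \<tau>\<^sup>2" by (simp add: power2_eq_square)
    also have "\<dots> \<le> (\<Sum>j<d. (a j)\<^sup>2)" by simp
    finally show "(\<Sum>j<cdim P. (a j - \<tau>)\<^sup>2) \<le> (\<Sum>j<cdim P. (a j)\<^sup>2)" by (simp only: d_def)
  qed simp
  finally show ?thesis by (simp only: v(4)[OF b])
qed

text \<open>The one-sided tail is applied to the eigenvalues and to their negatives, whence the
  factor 2.\<close>

lemma hermitian_tail:
  fixes R P :: "'n::finite cmat"
  assumes P: "orth_proj P" "range_space P \<noteq> {0}" and R: "self_adjoint R"
    and L: "\<And>x. norm x = 1 \<Longrightarrow> \<bar>Re (cinner x (R *v x))\<bar> \<le> L" "L > 0" and s: "s > 0"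
  shows "measure (sphere_measure P) {\<psi>. s < \<bar>Re (cinner \<psi> (R *v \<psi>)) - Re (trace (P ** R)) / cdim P\<bar>}
    \<le> 2 * exp (- (11 / 256) * cdim P * s\<^sup>2 / L\<^sup>2)"
proof -
  let ?S = "sphere_measure P"
  interpret S: prob_space ?S by (rule prob_space_sphere_measure)
  obtain v a where v: "onb P v"
    "\<And>\<psi>. \<psi> \<in> range_space P \<Longrightarrow> cinner \<psi> (R *v \<psi>) = of_real (\<Sum>j<cdim P. a j * (cmod (cinner (v j) \<psi>))\<^sup>2)"
    "\<And>j. j < cdim P \<Longrightarrow> cinner (v j) (R *v v j) = of_real (a j)"
    "\<And>b. onb P b \<Longrightarrow> (\<Sum>j<cdim P. (a j)\<^sup>2) = (\<Sum>k<cdim P. \<Sum>l<cdim P. (cmod (cinner (b l) (R *v b k)))\<^sup>2)"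
    by (rule hermitian_form_diagonal[OF P(1) R]) (rule that)
  have nv: "norm (v j) = 1" if "j < cdim P" for j
    using v(1) that by (auto simp: onb_iff intro: orthonormal_norm)
  have a: "\<bar>a j\<bar> \<le> L" if "j < cdim P" for j
    using L(1)[OF nv[OF that]] v(3)[OF that] by simp
  have tr: "Re (trace (P ** R)) = (\<Sum>j<cdim P. a j)"
    by (simp add: trace_proj_mult[OF P(1) v(1)] v(3))
  define E where "E c = {\<psi>. (\<Sum>j<cdim P. c j) / cdim P + s < (\<Sum>j<cdim P. c j * (cmod (cinner (v j) \<psi>))\<^sup>2)}" for c :: "nat \<Rightarrow> real"
  have E: "E c \<in> sets borel" for c
    unfolding E_def by (intro borel_open open_Collect_less continuous_intros)
  have bound: "measure ?S (E c) \<le> exp (- (11 / 256) * cdim P * s\<^sup>2 / L\<^sup>2)"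
    if "\<And>j. j < cdim P \<Longrightarrow> \<bar>c j\<bar> \<le> L" for c
    unfolding E_def by (rule sphere_upper_tail[OF P v(1) that L(2) s])
  have "measure ?S {\<psi>. s < \<bar>Re (cinner \<psi> (R *v \<psi>)) - Re (trace (P ** R)) / cdim P\<bar>} \<le> measure ?S (E a \<union> E (\<lambda>j. - a j))"
  proof (rule S.finite_measure_mono_AE)
    show "AE \<psi> in ?S. \<psi> \<in> {\<psi>. s < \<bar>Re (cinner \<psi> (R *v \<psi>)) - Re (trace (P ** R)) / cdim P\<bar>} \<longrightarrow> \<psi> \<in> E a \<union> E (\<lambda>j. - a j)"
      using AE_sphere_measure[OF P]
    proof eventually_elim
      fix \<psi> assume \<psi>: "\<psi> \<in> range_space P \<and> norm \<psi> = 1"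
      have r: "Re (cinner \<psi> (R *v \<psi>)) = (\<Sum>j<cdim P. a j * (cmod (cinner (v j) \<psi>))\<^sup>2)" using v(2) \<psi> by simp
      show "\<psi> \<in> {\<psi>. s < \<bar>Re (cinner \<psi> (R *v \<psi>)) - Re (trace (P ** R)) / cdim P\<bar>} \<longrightarrow> \<psi> \<in> E a \<union> E (\<lambda>j. - a j)"
        by (auto simp: E_def r tr sum_negf abs_if split: if_splits)
    qed
  qed (use E in auto)
  also have "\<dots> \<le> measure ?S (E a) + measure ?S (E (\<lambda>j. - a j))"
    using E by (intro measure_Un_le) auto
  also have "\<dots> \<le> exp (- (11 / 256) * cdim P * s\<^sup>2 / L\<^sup>2) + exp (- (11 / 256) * cdim P * s\<^sup>2 / L\<^sup>2)"
    by (intro add_mono bound) (auto simp: a)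
  finally show ?thesis by simp
qed

text \<open>Together with \<open>hermitian_im\<close> this is the Cartesian decomposition G = R +
  \<i> J into Hermitian operators: their forms are the real and the imaginary part of
  <x|G|x>.\<close>

definition hermitian_re :: "'n::finite cmat \<Rightarrow> 'n cmat" where
  "hermitian_re G = mscale (1 / 2) (G + adj G)"

definition hermitian_im :: "'n::finite cmat \<Rightarrow> 'n cmat" where
  "hermitian_im G = mscale (- \<i> / 2) (G - adj G)"

lemma self_adjoint_hermitian_re: "self_adjoint (hermitian_re G)"
  by (simp add: self_adjoint_def adj_def hermitian_re_def mscale_def vec_eq_iff add.commute)

lemma self_adjoint_hermitian_im: "self_adjoint (hermitian_im G)"
  by (simp add: self_adjoint_def adj_def hermitian_im_def mscale_def vec_eq_iff algebra_simps)

lemma cinner_hermitian_re: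
  "cinner x (hermitian_re G *v y) = (cinner x (G *v y) + cnj (cinner y (G *v x))) / 2"
  by (simp add: hermitian_re_def mscale_apply cinner_scale_right matrix_vector_mult_add_rdistrib
      cinner_add_right cinner_adj_right cnj_cinner)

lemma cinner_hermitian_im:
  "cinner x (hermitian_im G *v y) = - \<i> / 2 * (cinner x (G *v y) - cnj (cinner y (G *v x)))"
  by (simp add: hermitian_im_def mscale_apply cinner_scale_right matrix_vector_mult_diff_rdistrib
      cinner_diff_right cinner_adj_right cnj_cinner right_diff_distrib diff_divide_distrib)

lemma Re_form_hermitian_re: "Re (cinner x (hermitian_re G *v x)) = Re (cinner x (G *v x))"
  by (simp add: cinner_hermitian_re)

lemma Re_form_hermitian_im: "Re (cinner x (hermitian_im G *v x)) = Im (cinner x (G *v x))"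
  by (simp add: cinner_hermitian_im)

lemma form_deviation_parts:
  assumes P: "orth_proj P"
  shows "Re (cinner \<psi> (G *v \<psi>) - trace (P ** G) / of_nat (cdim P)) = Re (cinner \<psi> (hermitian_re G *v \<psi>)) - Re (trace (P ** hermitian_re G)) / cdim P"
    and "Im (cinner \<psi> (G *v \<psi>) - trace (P ** G) / of_nat (cdim P)) = Re (cinner \<psi> (hermitian_im G *v \<psi>)) - Re (trace (P ** hermitian_im G)) / cdim P"
proof -
  obtain b where b: "onb P b" using onb_exists[OF P] by blast
  show "Re (cinner \<psi> (G *v \<psi>) - trace (P ** G) / of_nat (cdim P)) = Re (cinner \<psi> (hermitian_re G *v \<psi>)) - Re (trace (P ** hermitian_re G)) / cdim P"
    by (simp add: trace_proj_mult[OF P b] Re_form_hermitian_re)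
  show "Im (cinner \<psi> (G *v \<psi>) - trace (P ** G) / of_nat (cdim P)) = Re (cinner \<psi> (hermitian_im G *v \<psi>)) - Re (trace (P ** hermitian_im G)) / cdim P"
    by (simp add: trace_proj_mult[OF P b] Re_form_hermitian_im)
qed

text \<open>No constant is lost in passing from Hermitian to general operators: entrywise |R_lk|^2 +
  |J_lk|^2 is the mean of |G_lk|^2 and |G_kl|^2, so the squared Hilbert-Schmidt norms of the two
  parts add up to that of G.\<close>

lemma form_variance:
  fixes G P :: "'n::finite cmat"
  assumes P: "orth_proj P" "range_space P \<noteq> {0}" and b: "onb P b"
  shows "(\<integral>\<^sup>+\<psi>. ennreal ((cmod (cinner \<psi> (G *v \<psi>) - trace (P ** G) / of_nat (cdim P)))\<^sup>2) \<partial>sphere_measure P)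
    \<le> ennreal ((\<Sum>k<cdim P. \<Sum>l<cdim P. (cmod (cinner (b l) (G *v b k)))\<^sup>2) / (real (cdim P) * (real (cdim P) + 1)))"
proof -
  let ?d = "cdim P" and ?R = "hermitian_re G" and ?J = "hermitian_im G"
  let ?D = "real (cdim P) * (real (cdim P) + 1)"
  let ?h = "\<lambda>X \<psi>. (Re (cinner \<psi> (X *v \<psi>)) - Re (trace (P ** X)) / cdim P)\<^sup>2"
  let ?N = "\<lambda>X. \<Sum>k<cdim P. \<Sum>l<cdim P. (cmod (cinner (b l) (X *v b k)))\<^sup>2"
  have [measurable]: "?h X \<in> borel_measurable borel" for X
    by (intro borel_measurable_continuous_onI continuous_intros)
  have "(\<integral>\<^sup>+\<psi>. ennreal ((cmod (cinner \<psi> (G *v \<psi>) - trace (P ** G) / of_nat (cdim P)))\<^sup>2) \<partial>sphere_measure P)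
      = (\<integral>\<^sup>+\<psi>. ennreal (?h ?R \<psi>) + ennreal (?h ?J \<psi>) \<partial>sphere_measure P)"
    by (simp only: cmod_power2 form_deviation_parts[OF P(1)] ennreal_plus zero_le_power2)
  also have "\<dots> = (\<integral>\<^sup>+\<psi>. ennreal (?h ?R \<psi>) \<partial>sphere_measure P) + (\<integral>\<^sup>+\<psi>. ennreal (?h ?J \<psi>) \<partial>sphere_measure P)"
    by (rule nn_integral_add) measurable
  also have "\<dots> \<le> ennreal (?N ?R / ?D) + ennreal (?N ?J / ?D)"
    by (intro add_mono hermitian_variance[OF P _ b] self_adjoint_hermitian_re self_adjoint_hermitian_im)
  also have "\<dots> = ennreal ((?N ?R + ?N ?J) / ?D)"
    by (simp add: add_divide_distrib sum_nonneg flip: ennreal_plus)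
  also have "?N ?R + ?N ?J = ?N G"
  proof -
    have pt: "(cmod (cinner (b l) (?R *v b k)))\<^sup>2 + (cmod (cinner (b l) (?J *v b k)))\<^sup>2
        = ((cmod (cinner (b l) (G *v b k)))\<^sup>2 + (cmod (cinner (b k) (G *v b l)))\<^sup>2) / 2" for k l
      unfolding cinner_hermitian_re cinner_hermitian_im cmod_power2
      by (simp add: power2_eq_square field_simps)
    have "?N ?R + ?N ?J = (?N G + (\<Sum>k<?d. \<Sum>l<?d. (cmod (cinner (b k) (G *v b l)))\<^sup>2)) / 2"
      unfolding sum.distrib[symmetric] pt sum_divide_distrib ..
    also have "(\<Sum>k<?d. \<Sum>l<?d. (cmod (cinner (b k) (G *v b l)))\<^sup>2) = ?N G" by (rule sum.swap)
    finally show ?thesis by simp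
  qed
  finally show ?thesis .
qed

text \<open>A complex number of modulus above \<delta> has real or imaginary part above \<delta> /
  sqrt 2. The union of the two events doubles the prefactor to 4, and the square root halves the
  rate 11/256.\<close>

lemma form_tail:
  fixes G P :: "'n::finite cmat"
  assumes P: "orth_proj P" "range_space P \<noteq> {0}"
    and L: "\<And>x. norm x = 1 \<Longrightarrow> cmod (cinner x (G *v x)) \<le> L" "L > 0" and \<delta>: "\<delta> > 0"
  shows "measure (sphere_measure P) {\<psi>. \<delta> < cmod (cinner \<psi> (G *v \<psi>) - trace (P ** G) / of_nat (cdim P))}
    \<le> 4 * exp (- (11 / 512) * cdim P * \<delta>\<^sup>2 / L\<^sup>2)"
proof -
  let ?S = "sphere_measure P"
  interpret S: prob_space ?S by (rule prob_space_sphere_measure)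
  define s where "s = \<delta> / sqrt 2"
  have s: "s > 0" "s\<^sup>2 = \<delta>\<^sup>2 / 2" using \<delta> by (auto simp: s_def power_divide)
  define E where "E X = {\<psi>. s < \<bar>Re (cinner \<psi> (X *v \<psi>)) - Re (trace (P ** X)) / cdim P\<bar>}" for X
  have E: "E X \<in> sets borel" for X
    unfolding E_def by (intro borel_open open_Collect_less continuous_intros)
  have bound: "measure ?S (E X) \<le> 2 * exp (- (11 / 256) * cdim P * s\<^sup>2 / L\<^sup>2)"
    if "self_adjoint X" "\<And>x. norm x = 1 \<Longrightarrow> \<bar>Re (cinner x (X *v x))\<bar> \<le> L" for X
    unfolding E_def by (rule hermitian_tail[OF P that L(2) s(1)])
  have "{\<psi>. \<delta> < cmod (cinner \<psi> (G *v \<psi>) - trace (P ** G) / of_nat (cdim P))}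
      \<subseteq> E (hermitian_re G) \<union> E (hermitian_im G)"
  proof
    fix \<psi> assume "\<psi> \<in> {\<psi>. \<delta> < cmod (cinner \<psi> (G *v \<psi>) - trace (P ** G) / of_nat (cdim P))}"
    then have c: "\<delta> < cmod (cinner \<psi> (G *v \<psi>) - trace (P ** G) / of_nat (cdim P))" (is "\<delta> < cmod ?z") by simp
    show "\<psi> \<in> E (hermitian_re G) \<union> E (hermitian_im G)"
    proof (rule ccontr)
      assume "\<psi> \<notin> E (hermitian_re G) \<union> E (hermitian_im G)"
      then have "\<bar>Re ?z\<bar> \<le> s" "\<bar>Im ?z\<bar> \<le> s"
        unfolding form_deviation_parts[OF P(1)] by (auto simp: E_def)
      then have "(Re ?z)\<^sup>2 \<le> s\<^sup>2" "(Im ?z)\<^sup>2 \<le> s\<^sup>2"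
        using s(1) by (simp_all add: abs_le_square_iff[symmetric])
      then have "(cmod ?z)\<^sup>2 \<le> \<delta>\<^sup>2" unfolding cmod_power2 using s(2) by linarith
      then have "cmod ?z \<le> \<delta>" by (rule power2_le_imp_le) (use \<delta> in simp)
      then show False using c by linarith
    qed
  qed
  then have "measure ?S {\<psi>. \<delta> < cmod (cinner \<psi> (G *v \<psi>) - trace (P ** G) / of_nat (cdim P))}
      \<le> measure ?S (E (hermitian_re G) \<union> E (hermitian_im G))"
    using E by (intro S.finite_measure_mono) auto
  also have "\<dots> \<le> measure ?S (E (hermitian_re G)) + measure ?S (E (hermitian_im G))"
    using E by (intro measure_Un_le) auto
  also have "\<dots> \<le> 2 * exp (- (11 / 256) * cdim P * s\<^sup>2 / L\<^sup>2) + 2 * exp (- (11 / 256) * cdim P * s\<^sup>2 / L\<^sup>2)"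
    by (intro add_mono bound self_adjoint_hermitian_re self_adjoint_hermitian_im)
      (auto simp: Re_form_hermitian_re Re_form_hermitian_im intro: order_trans[OF _ L(1)] abs_Re_le_cmod abs_Im_le_cmod)
  finally show ?thesis by (simp add: s(2))
qed

lemma (in prob_space) markov_complement:
  assumes [measurable]: "g \<in> borel_measurable M" and g: "\<And>x. 0 \<le> g x"
    and K: "(\<integral>\<^sup>+x. ennreal (g x) \<partial>M) \<le> ennreal (\<epsilon> * c)" and c: "0 \<le> c" and e: "0 < \<epsilon>"
  shows "1 - \<epsilon> \<le> measure M {x \<in> space M. g x \<le> c}"
\<comment> \<open>Markov's inequality divides by c. For c = 0, which occurs when B = 0, the integral
  vanishes and g is 0 almost everywhere.\<close>
proof (cases "c = 0")
  case True
  then have "(\<integral>\<^sup>+x. ennreal (g x) \<partial>M) = 0" using K by simp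
  then have "AE x in M. g x \<le> 0" by (simp add: nn_integral_0_iff_AE ennreal_eq_0_iff)
  then have "measure M {x \<in> space M. g x \<le> 0} = 1" by (subst prob_Collect_eq_1) auto
  then show ?thesis using True e by simp
next
  case False
  then have c: "c > 0" using c by simp
  have "ennreal c * emeasure M {x \<in> space M. c < g x} = (\<integral>\<^sup>+x. ennreal c * indicator {x \<in> space M. c < g x} x \<partial>M)"
    by (subst nn_integral_cmult_indicator) auto
  also have "\<dots> \<le> (\<integral>\<^sup>+x. ennreal (g x) \<partial>M)"
    by (intro nn_integral_mono) (auto simp: indicator_def ennreal_leI)
  also note K
  finally have "ennreal (c * measure M {x \<in> space M. c < g x}) \<le> ennreal (\<epsilon> * c)"
    using c by (simp add: emeasure_eq_measure ennreal_mult)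
  then have "c * measure M {x \<in> space M. c < g x} \<le> c * \<epsilon>" using e c by (simp add: mult.commute)
  then have "measure M {x \<in> space M. c < g x} \<le> \<epsilon>" using c by simp
  moreover have "measure M {x \<in> space M. \<not> g x \<le> c} = 1 - measure M {x \<in> space M. g x \<le> c}"
    by (rule prob_neg) simp
  ultimately show ?thesis by (simp add: not_le)
qed

section \<open>Typicality of expectation values\<close>

text \<open>In the Heisenberg picture the time dependence sits in the operator, so at fixed t the
  deviation is that of one quadratic form in the initial state.\<close>

definition heisenberg :: "'n::finite cmat \<Rightarrow> 'n cmat \<Rightarrow> real \<Rightarrow> 'n cmat" where
  "heisenberg H B t = mexp (mscale (\<i> * of_real t) H) ** B ** evol H t"

lemma cinner_heisenberg:
  assumes "self_adjoint H"
  shows "cinner x (heisenberg H B t *v y) = cinner (evol H t *v x) (B *v (evol H t *v y))"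
  by (simp add: heisenberg_def matrix_vector_mul_assoc[symmetric] cinner_evol_adjoint[OF assms])

lemma expect_minus_wfun:
  assumes "self_adjoint H"
  shows "expect (evol H t *v \<psi>) B - wfun H P B t
       = cinner \<psi> (heisenberg H B t *v \<psi>) - trace (P ** heisenberg H B t) / of_nat (cdim P)"
  unfolding expect_def wfun_def cinner_heisenberg[OF assms]
  by (simp add: heisenberg_def evol_def matrix_mul_assoc)

lemma orthonormal_form_sum_le:
  assumes "orthonormal d f"
  shows "(\<Sum>k<d. \<Sum>l<d. (cmod (cinner (f l) (B *v f k)))\<^sup>2) \<le> (\<Sum>k<d. (norm (B *v f k))\<^sup>2)"
  by (intro sum_mono bessel assms)

text \<open>Evolution carries an orthonormal basis of the macro space to another orthonormal family
  \<open>f\<close>, and the entries of the Heisenberg operator are those of B along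
  \<open>f\<close>. By Bessel's inequality their squares sum to at most W, which is estimated either
  term by term with the operator norm or through |B|; finally d(d+1) \<ge> d^2. The third conclusion
  makes the square root in the second bound meaningful.\<close>

lemma deviation_variance:
  fixes H P B :: "'n::finite cmat"
  assumes H: "self_adjoint H" and P: "orth_proj P" "range_space P \<noteq> {0}"
  shows "(\<integral>\<^sup>+\<psi>. ennreal ((cmod (expect (evol H t *v \<psi>) B - wfun H P B t))\<^sup>2) \<partial>sphere_measure P)
      \<le> ennreal ((opnorm B)\<^sup>2 / cdim P)" (is ?bound1)
    and "(\<integral>\<^sup>+\<psi>. ennreal ((cmod (expect (evol H t *v \<psi>) B - wfun H P B t))\<^sup>2) \<partial>sphere_measure P)
      \<le> ennreal (opnorm B * Re (trace (mabs B)) / (real (cdim P))\<^sup>2)" (is ?bound2)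
    and "0 \<le> opnorm B * Re (trace (mabs B))"
proof -
  define d where "d = cdim P"
  have d: "d > 0" unfolding d_def by (rule cdim_pos[OF P(2)])
  obtain b where b: "onb P b" using onb_exists[OF P(1)] by blast
  define f where "f k = evol H t *v b k" for k
  have f: "orthonormal d f"
    using b by (simp add: orthonormal_def onb_def f_def evol_cinner[OF H] d_def)
  define W where "W = (\<Sum>k<d. (norm (B *v f k))\<^sup>2)"
  have W0: "0 \<le> W" by (simp add: W_def sum_nonneg)
  have "W \<le> (\<Sum>k<d. (opnorm B)\<^sup>2)"
    unfolding W_def
  proof (rule sum_mono)
    fix k assume "k \<in> {..<d}"
    then have "norm (B *v f k) \<le> opnorm B" using opnorm_bound[of B "f k"] orthonormal_norm[OF f] by simp
    then show "(norm (B *v f k))\<^sup>2 \<le> (opnorm B)\<^sup>2" by (intro power_mono) auto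
  qed
  then have W1: "W \<le> d * (opnorm B)\<^sup>2" by simp
  have W2: "W \<le> opnorm B * Re (trace (mabs B))"
    unfolding W_def by (rule orthonormal_sum_norm_le_trace_mabs[OF f])
  then show tr0: "0 \<le> opnorm B * Re (trace (mabs B))" using W0 by linarith
  have "(\<integral>\<^sup>+\<psi>. ennreal ((cmod (expect (evol H t *v \<psi>) B - wfun H P B t))\<^sup>2) \<partial>sphere_measure P)
      \<le> ennreal ((\<Sum>k<d. \<Sum>l<d. (cmod (cinner (b l) (heisenberg H B t *v b k)))\<^sup>2) / (real d * (real d + 1)))"
    unfolding expect_minus_wfun[OF H] d_def by (rule form_variance[OF P b])
  also have "\<dots> \<le> ennreal (W / (real d * (real d + 1)))"
    unfolding cinner_heisenberg[OF H] W_def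
    using orthonormal_form_sum_le[OF f, of B] by (intro ennreal_leI divide_right_mono) (auto simp: f_def)
  finally have main: "(\<integral>\<^sup>+\<psi>. ennreal ((cmod (expect (evol H t *v \<psi>) B - wfun H P B t))\<^sup>2) \<partial>sphere_measure P)
      \<le> ennreal (W / (real d * (real d + 1)))" .
  have "W / (real d * (real d + 1)) \<le> (opnorm B)\<^sup>2 / d"
  proof -
    have "W / (real d * (real d + 1)) \<le> (d * (opnorm B)\<^sup>2) / (real d * real d)"
      using W1 W0 d by (intro frac_le) auto
    then show ?thesis using d by simp
  qed
  then show ?bound1 using main by (auto simp: d_def intro: order_trans ennreal_leI)
  have "W / (real d * (real d + 1)) \<le> opnorm B * Re (trace (mabs B)) / (real d)\<^sup>2"
    using W2 tr0 d by (intro frac_le) (auto simp: power2_eq_square)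
  then show ?bound2 using main by (auto simp: d_def intro: order_trans ennreal_leI)
qed

lemma deviation_tail:
  fixes H P B :: "'n::finite cmat"
  assumes H: "self_adjoint H" and P: "orth_proj P" "range_space P \<noteq> {0}"
    and B: "opnorm B > 0" and \<delta>: "\<delta> > 0"
  shows "measure (sphere_measure P) {\<psi>. \<delta> < cmod (expect (evol H t *v \<psi>) B - wfun H P B t)}
    \<le> 4 * exp (- (11 / 512) * cdim P * \<delta>\<^sup>2 / (opnorm B)\<^sup>2)"
  unfolding expect_minus_wfun[OF H]
proof (rule form_tail[OF P _ B \<delta>])
  fix x :: "complex^'n" assume "norm x = 1"
  then have n: "norm (evol H t *v x) = 1" by (simp add: evol_norm[OF H])
  have "cmod (cinner (evol H t *v x) (B *v (evol H t *v x))) \<le> norm (evol H t *v x) * norm (B *v (evol H t *v x))"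
    by (rule cmod_cinner_le)
  also have "\<dots> \<le> opnorm B" using opnorm_bound[of B "evol H t *v x"] n by simp
  finally show "cmod (cinner x (heisenberg H B t *v x)) \<le> opnorm B" by (simp add: cinner_heisenberg[OF H])
qed

text \<open>Writing the trace as a finite sum over a fixed basis exhibits the mean, too, as a
  continuous function of time.\<close>

lemma continuous_deviation:
  assumes H: "self_adjoint H" and P: "orth_proj P" and nz: "range_space P \<noteq> {0}"
  shows "continuous_on UNIV (\<lambda>(t, \<psi>). expect (evol H t *v \<psi>) B - wfun H P B t)"
proof -
  obtain b where b: "onb P b" using onb_exists[OF P] by blast
  have ev: "continuous_on UNIV (\<lambda>p. evol H (fst p) *v snd p)"
    using continuous_evol[OF H] by (simp add: case_prod_beta)
  have ev': "continuous_on UNIV (\<lambda>p::real \<times> (complex^'a). evol H (fst p) *v b k)" for k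
    by (rule continuous_on_compose2[OF ev, of _ "\<lambda>p. (fst p, b k)", simplified])
       (auto intro!: continuous_intros)
  show ?thesis
    unfolding expect_minus_wfun[OF H] trace_proj_mult[OF P b] cinner_heisenberg[OF H] case_prod_beta
    by (intro continuous_intros ev ev' continuous_on_compose2[OF matrix_vector_mult_linear_continuous_on])
       (use cdim_pos[OF nz] in auto)
qed

theorem theorem3:
  fixes H P B :: "'n::finite cmat"
  assumes H_sa: "self_adjoint H"
    and P_proj: "orth_proj P"
    and P_nonzero: "range_space P \<noteq> {0}"
  shows
    "(\<forall>(t::real) (\<epsilon>::real). \<epsilon> > 0 \<longrightarrow>
        measure (sphere_measure P)
          {\<psi>0. cmod (expect (evol H t *v \<psi>0) B - wfun H P B t)
                 \<le> min (opnorm B / sqrt (\<epsilon> * cdim P))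
                     (min (sqrt (opnorm B * Re (trace (mabs B)) / (\<epsilon> * (cdim P)\<^sup>2)))
                          (sqrt (18 * pi ^ 3 * ln (4 / \<epsilon>) / cdim P) * opnorm B))}
          \<ge> 1 - \<epsilon>)
     \<and> (\<forall>(T::real) (\<epsilon>::real). T > 0 \<longrightarrow> \<epsilon> > 0 \<longrightarrow>
        measure (sphere_measure P)
          {\<psi>0. (1 / T) * integral {0..T}
                   (\<lambda>t. (cmod (expect (evol H t *v \<psi>0) B - wfun H P B t))\<^sup>2)
                 \<le> (opnorm B)\<^sup>2 / (\<epsilon> * cdim P)}
          \<ge> 1 - \<epsilon>)"
proof (intro conjI allI impI)
  note P = P_proj P_nonzero
  let ?S = "sphere_measure P"
  interpret S: prob_space ?S by (rule prob_space_sphere_measure)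
  define z where "z t \<psi> = expect (evol H t *v \<psi>) B - wfun H P B t" for t \<psi>
  define L where "L = opnorm B"
  define d where "d = cdim P"
  have d: "d > 0" unfolding d_def by (rule cdim_pos[OF P(2)])
  have L0: "0 \<le> L" unfolding L_def by (rule opnorm_nonneg)
  have cont: "continuous_on UNIV (\<lambda>p. z (fst p) (snd p))"
    using continuous_deviation[OF H_sa P_proj P_nonzero] by (simp add: z_def case_prod_beta)
  have cont_\<psi>: "continuous_on UNIV (z t)" for t
    by (rule continuous_on_compose2[OF cont, of _ "\<lambda>\<psi>. (t, \<psi>)", simplified]) (auto intro!: continuous_intros)
  have cont_t: "continuous_on UNIV (\<lambda>t. z t \<psi>)" for \<psi>
    by (rule continuous_on_compose2[OF cont, of _ "\<lambda>t. (t, \<psi>)", simplified]) (auto intro!: continuous_intros)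
  have [measurable]: "z t \<in> borel_measurable borel" for t
    by (rule borel_measurable_continuous_onI[OF cont_\<psi>])
  have z_sets: "{\<psi>. cmod (z t \<psi>) \<le> c} \<in> sets borel" for t c by measurable
  have var1: "(\<integral>\<^sup>+\<psi>. ennreal ((cmod (z t \<psi>))\<^sup>2) \<partial>?S) \<le> ennreal (L\<^sup>2 / d)" for t
    unfolding z_def L_def d_def by (rule deviation_variance(1)[OF H_sa P])
  have var2: "(\<integral>\<^sup>+\<psi>. ennreal ((cmod (z t \<psi>))\<^sup>2) \<partial>?S) \<le> ennreal (L * Re (trace (mabs B)) / (real d)\<^sup>2)" for t
    unfolding z_def L_def d_def by (rule deviation_variance(2)[OF H_sa P])
  have tr0: "0 \<le> L * Re (trace (mabs B))" unfolding L_def by (rule deviation_variance(3)[OF H_sa P])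
  {
    fix t \<epsilon> :: real assume e: "\<epsilon> > 0"
    define good where "good c \<longleftrightarrow> 1 - \<epsilon> \<le> measure ?S {\<psi>. cmod (z t \<psi>) \<le> c}" for c
    have cheb: "good (sqrt c)" if "(\<integral>\<^sup>+\<psi>. ennreal ((cmod (z t \<psi>))\<^sup>2) \<partial>?S) \<le> ennreal (\<epsilon> * c)" "0 \<le> c" for c
    proof -
      have "1 - \<epsilon> \<le> measure ?S {\<psi> \<in> space ?S. (cmod (z t \<psi>))\<^sup>2 \<le> c}"
        by (rule S.markov_complement[OF _ _ that e]) auto
      also have "{\<psi> \<in> space ?S. (cmod (z t \<psi>))\<^sup>2 \<le> c} = {\<psi>. cmod (z t \<psi>) \<le> sqrt c}"
        using that(2) by (auto intro: real_le_rsqrt sqrt_ge_absD)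
      finally show ?thesis by (simp add: good_def)
    qed
    have g1: "good (L / sqrt (\<epsilon> * d))"
    proof -
      have "good (sqrt (L\<^sup>2 / (\<epsilon> * d)))"
        by (rule cheb) (use var1[of t] e d in auto)
      then show ?thesis using L0 by (simp add: real_sqrt_divide)
    qed
    have g2: "good (sqrt (L * Re (trace (mabs B)) / (\<epsilon> * (real d)\<^sup>2)))"
      by (rule cheb) (use var2[of t] e d tr0 in auto)
    have g3: "good (sqrt (18 * pi ^ 3 * ln (4 / \<epsilon>) / d) * L)"
    proof (cases "L = 0 \<or> \<epsilon> \<ge> 1")
      case True
      then show ?thesis
      proof
        assume "L = 0" then show ?thesis using g1 by simp
      next
        \<comment> \<open>Here the claim is void since 1 - \<epsilon> \<le> 0. Treating it apart
          matters because the logarithm becomes negative for \<epsilon> > 4; in the remaining case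
          it is positive.\<close>
        assume "\<epsilon> \<ge> 1"
        then have "1 - \<epsilon> \<le> 0" by simp
        then show ?thesis unfolding good_def using measure_nonneg order_trans by blast
      qed
    next
      case False
      then have L: "L > 0" and e1: "\<epsilon> < 1" using L0 by auto
      define l where "l = ln (4 / \<epsilon>)"
      have l: "l > 0" unfolding l_def using e e1 by simp
      define \<delta> where "\<delta> = sqrt (18 * pi ^ 3 * l / d) * L"
      have \<delta>: "\<delta> > 0" using l L d by (simp add: \<delta>_def)
      have "\<delta>\<^sup>2 = 18 * pi ^ 3 * l / d * L\<^sup>2" using l by (simp add: \<delta>_def power_mult_distrib)
      \<comment> \<open>198 is 11 times 18. The comparison with l needs only 198/512 pi^3 \<ge> 1,
        for which pi > 3 is ample.\<close>
      then have "- (11 / 512) * d * \<delta>\<^sup>2 / L\<^sup>2 = - (198 / 512 * pi ^ 3) * l"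
        using L d by (simp add: field_simps)
      also have "\<dots> \<le> - l"
      proof -
        have "3 ^ 3 \<le> pi ^ 3" using pi_gt3 by (intro power_mono) auto
        then have "1 \<le> 198 / 512 * pi ^ 3" by simp
        then have "1 * l \<le> 198 / 512 * pi ^ 3 * l" using l by (intro mult_right_mono) auto
        then show ?thesis by linarith
      qed
      finally have "exp (- (11 / 512) * d * \<delta>\<^sup>2 / L\<^sup>2) \<le> exp (- l)" by (simp only: exp_le_cancel_iff)
      also have "exp (- l) = \<epsilon> / 4" using e by (simp add: l_def exp_minus)
      finally have "4 * exp (- (11 / 512) * d * \<delta>\<^sup>2 / L\<^sup>2) \<le> \<epsilon>" by simp
      moreover have "measure ?S {\<psi>. \<delta> < cmod (z t \<psi>)} \<le> 4 * exp (- (11 / 512) * d * \<delta>\<^sup>2 / L\<^sup>2)"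
        using deviation_tail[OF H_sa P L[unfolded L_def] \<delta>, of t] by (simp only: z_def L_def d_def)
      moreover have "measure ?S {\<psi> \<in> space ?S. \<not> cmod (z t \<psi>) \<le> \<delta>} = 1 - measure ?S {\<psi> \<in> space ?S. cmod (z t \<psi>) \<le> \<delta>}"
        by (rule S.prob_neg) (use z_sets in simp)
      ultimately have "good \<delta>" by (simp add: good_def not_le)
      then show ?thesis by (simp add: \<delta>_def l_def)
    qed
    \<comment> \<open>The three bounds do not depend on the state, so their minimum is one of them
      and no union bound is needed.\<close>
    have "good (min (L / sqrt (\<epsilon> * d)) (min (sqrt (L * Re (trace (mabs B)) / (\<epsilon> * (real d)\<^sup>2)))
        (sqrt (18 * pi ^ 3 * ln (4 / \<epsilon>) / d) * L)))"
      using g1 g2 g3 by (simp add: min_def)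
    then show "1 - \<epsilon> \<le> measure ?S
          {\<psi>0. cmod (expect (evol H t *v \<psi>0) B - wfun H P B t)
                 \<le> min (opnorm B / sqrt (\<epsilon> * cdim P))
                     (min (sqrt (opnorm B * Re (trace (mabs B)) / (\<epsilon> * (cdim P)\<^sup>2)))
                          (sqrt (18 * pi ^ 3 * ln (4 / \<epsilon>) / cdim P) * opnorm B))}"
      by (simp add: good_def z_def L_def d_def)
  next
    fix T \<epsilon> :: real assume T: "T > 0" and e: "\<epsilon> > 0"
    \<comment> \<open>The indicator moves the time average to Lebesgue measure on the whole line, so
      that Fubini applies and the variance bound at each fixed t can be integrated over the
      interval.\<close>
    define h where "h t \<psi> = indicator {0..T} t * (cmod (z t \<psi>))\<^sup>2 / T" for t \<psi>
    define g where "g \<psi> = 1 / T * integral {0..T} (\<lambda>t. (cmod (z t \<psi>))\<^sup>2)" for \<psi>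
    have h0: "0 \<le> h t \<psi>" for t \<psi> using T by (simp add: h_def)
    have z_meas: "(\<lambda>p. z (fst p) (snd p)) \<in> borel_measurable (borel \<Otimes>\<^sub>M borel)"
      unfolding borel_prod by (rule borel_measurable_continuous_onI[OF cont])
    have h_meas [measurable]: "(\<lambda>(\<psi>, t). ennreal (h t \<psi>)) \<in> borel_measurable (?S \<Otimes>\<^sub>M lborel)"
    proof -
      have "(\<lambda>p. (snd p, fst p)) \<in> (?S \<Otimes>\<^sub>M lborel) \<rightarrow>\<^sub>M (borel \<Otimes>\<^sub>M borel)"
        by measurable
      from measurable_compose[OF this z_meas]
      have [measurable]: "(\<lambda>p. z (snd p) (fst p)) \<in> borel_measurable (?S \<Otimes>\<^sub>M lborel)" by simp
      show ?thesis unfolding h_def case_prod_beta by measurable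
    qed
    \<comment> \<open>Continuity in t identifies the gauge integral of the statement with a Lebesgue
      integral; this also gives the measurability of \<open>g\<close>, as an integral depending on a
      parameter.\<close>
    have g_eq: "ennreal (g \<psi>) = (\<integral>\<^sup>+t. ennreal (h t \<psi>) \<partial>lborel)" for \<psi>
    proof -
      have "continuous_on {0..T} (\<lambda>t. (cmod (z t \<psi>))\<^sup>2)"
        by (intro continuous_intros continuous_on_subset[OF cont_t]) auto
      then have i: "set_integrable lborel {0..T} (\<lambda>t. (cmod (z t \<psi>))\<^sup>2)"
        by (rule borel_integrable_atLeastAtMost')
      have hi: "h t \<psi> = 1 / T * (indicator {0..T} t *\<^sub>R (cmod (z t \<psi>))\<^sup>2)" for t by (simp add: h_def)
      have "integrable lborel (\<lambda>t. h t \<psi>)"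
        unfolding hi using i by (intro integrable_mult_right) (simp add: set_integrable_def)
      then have "(\<integral>\<^sup>+t. ennreal (h t \<psi>) \<partial>lborel) = ennreal (\<integral>t. h t \<psi> \<partial>lborel)"
        by (rule nn_integral_eq_integral) (simp add: h0)
      also have "(\<integral>t. h t \<psi> \<partial>lborel) = 1 / T * (\<integral>t. indicator {0..T} t *\<^sub>R (cmod (z t \<psi>))\<^sup>2 \<partial>lborel)"
        unfolding hi by (rule integral_mult_right_zero)
      also have "\<dots> = g \<psi>"
        using set_borel_integral_eq_integral(2)[OF i] by (simp add: g_def set_lebesgue_integral_def)
      finally show ?thesis ..
    qed
    have g0: "0 \<le> g \<psi>" for \<psi>
      unfolding g_def using T by (intro mult_nonneg_nonneg integral_nonneg integrable_continuous_real
          continuous_intros continuous_on_subset[OF cont_t]) auto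
    have "g = (\<lambda>\<psi>. enn2real (\<integral>\<^sup>+t. ennreal (h t \<psi>) \<partial>lborel))"
      by (simp add: fun_eq_iff g_eq[symmetric] g0)
    then have g_meas: "g \<in> borel_measurable ?S" by simp
    interpret pair_sigma_finite ?S "lborel :: real measure"
      by (intro pair_sigma_finite.intro S.sigma_finite_measure_axioms lborel.sigma_finite_measure_axioms)
    have "(\<integral>\<^sup>+\<psi>. ennreal (g \<psi>) \<partial>?S) = (\<integral>\<^sup>+t. (\<integral>\<^sup>+\<psi>. ennreal (h t \<psi>) \<partial>?S) \<partial>lborel)"
      unfolding g_eq by (rule Fubini'[symmetric]) (use h_meas in simp)
    also have "\<dots> \<le> (\<integral>\<^sup>+t. ennreal (L\<^sup>2 / d / T) * indicator {0..T} t \<partial>lborel)"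
    proof (rule nn_integral_mono)
      fix t
      have "(\<integral>\<^sup>+\<psi>. ennreal (h t \<psi>) \<partial>?S) = (\<integral>\<^sup>+\<psi>. ennreal (indicator {0..T} t / T) * ennreal ((cmod (z t \<psi>))\<^sup>2) \<partial>?S)"
        using T by (intro nn_integral_cong) (simp add: h_def flip: ennreal_mult)
      also have "\<dots> = ennreal (indicator {0..T} t / T) * (\<integral>\<^sup>+\<psi>. ennreal ((cmod (z t \<psi>))\<^sup>2) \<partial>?S)"
        by (rule nn_integral_cmult) measurable
      also have "\<dots> \<le> ennreal (indicator {0..T} t / T) * ennreal (L\<^sup>2 / d)"
        by (intro mult_left_mono var1) simp
      also have "\<dots> = ennreal (L\<^sup>2 / d / T) * indicator {0..T} t"
        using T by (auto simp: indicator_def mult_ac simp flip: ennreal_mult)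
      finally show "(\<integral>\<^sup>+\<psi>. ennreal (h t \<psi>) \<partial>?S) \<le> ennreal (L\<^sup>2 / d / T) * indicator {0..T} t" .
    qed
    also have "\<dots> = ennreal (L\<^sup>2 / d / T) * ennreal T" using T by (simp add: nn_integral_cmult_indicator)
    also have "\<dots> = ennreal (\<epsilon> * (L\<^sup>2 / (\<epsilon> * d)))" using T e by (simp flip: ennreal_mult)
    finally have "1 - \<epsilon> \<le> measure ?S {\<psi> \<in> space ?S. g \<psi> \<le> L\<^sup>2 / (\<epsilon> * d)}"
      by (intro S.markov_complement g_meas g0 e) (use e in auto)
    then show "1 - \<epsilon> \<le> measure ?S
          {\<psi>0. (1 / T) * integral {0..T}
                   (\<lambda>t. (cmod (expect (evol H t *v \<psi>0) B - wfun H P B t))\<^sup>2)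
                 \<le> (opnorm B)\<^sup>2 / (\<epsilon> * cdim P)}"
      by (simp add: g_def z_def L_def d_def)
  }
qed

end
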